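(* Let $n$ be a positive integer and $u\ne0$ a (real or complex) parameter. Throughout, upper signs are taken for $j=1$ and lower signs for $j=2$. For $j=1,2$ let $\alpha_j$ be a given reference point and let the domain $\Xi_j(u,\alpha_j)$ comprise the set of points $\xi$ for which there is a path $\mathcal{L}_j$ linking $\xi$ with $\alpha_j$ in $\Delta$ having the properties (i) $\mathcal{L}_j$ consists of a finite chain of $R_2$ arcs, and (ii) as $t$ passes along $\mathcal{L}_j$ from $\alpha_j$ to $\xi$, the real part of $(-1)^jut-E_0^{\pm}(t)$ is nonincreasing. Then for $\xi\in\Xi_j(u,\alpha_j)$ the differential equation $$\frac{d^2W}{d\xi^2}=\{u^2+u\phi(\xi)+\psi(\xi)\}W$$ has solutions of the form $$W_{n,1}(u,\xi)=\exp\{S_n^{+}(u,\xi)\}\left[\exp\{u\xi+E_0^{+}(\xi)\}+\varepsilon_{n,1}(u,\xi)\right],$$ $$W_{n,2}(u,\xi)=\exp\{S_n^{-}(u,\xi)\}\left[\exp\{-u\xi+E_0^{-}(\xi)\}+\varepsilon_{n,2}(u,\xi)\right],$$ where both $|\varepsilon_{n,j}(u,\xi)|$ and $\left|\dfrac{1}{u+\frac12\phi(\xi)}\dfrac{\partial\varepsilon_{n,j}(u,\xi)}{\partial\xi}\right|$ are at most $$\begin{aligned}&\kappa_0(u,\xi)\left|\frac{\exp\{\pm u\xi+E_0^{\pm}(\xi)\}}{u^n}\right|\int_{\mathcal{L}_j}|\chi_n^{\pm}(u,t)\,dt|\\&\times\exp\Bigg\{\frac{1}{|u|}\left(2+2\kappa_0(u,\xi)+\frac{\kappa_0(u,\xi)\kappa_2(\xi)}{|u|}\right)\int_{\mathcal{L}_j}|T_n^{\pm}(u,t)\,dt|\\&\qquad+\frac{\kappa_0(u,\xi)}{|u|}\int_{\mathcal{L}_j}|\phi'(t)\,dt|+\frac{\kappa_0(u,\xi)}{|u|^n}\int_{\mathcal{L}_j}|\chi_n^{\pm}(u,t)\,dt|\Bigg\}.\end{aligned}$$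 Here $$\kappa_0(u,\xi)=\sup_{t\in\mathcal{L}_j}\left\{\frac{1}{|1+\phi(t)/(2u)|}\right\},\qquad \kappa_2(\xi)=\sup_{t\in\mathcal{L}_j}|\phi(t)|.$$
   Context: $\Delta$ is a complex domain in the $\xi$-plane (possibly unbounded) and $\phi,\psi$ are functions analytic in $\Delta$, independent of $u$. (They arise from the equation $d^2w/dz^2=\{u^2f_0(z)+uf_1(z)+g(z)\}w$, with $f_0$ without zeros, via $\xi=\int f_0^{1/2}(z)\,dz$, $W=f_0^{1/4}(z)w$, which gives $\phi=f_1/f_0$ and $\psi=\dfrac{4f_0f_0''-5f_0'^2}{16f_0^3}+\dfrac{g}{f_0}$.) Coefficients: $E_s^{\pm}(\xi)=\int F_s^{\pm}(\xi)\,d\xi$ ($s=0,1,2,\dots$; arbitrary constants of integration), where $$F_0^{\pm}=\pm\tfrac12\phi,\qquad F_1^{\pm}=\tfrac12\psi-\tfrac18\phi^2\mp\tfrac14\phi',$$ $$F_{s+1}^{\pm}=-\frac12\frac{dF_s^{\pm}}{d\xi}-\frac12\sum_{j=0}^{s}F_j^{\pm}F_{s-j}^{\pm}\quad(s=1,2,3,\dots).$$ Further, $$S_n^{\pm}(u,\xi)=\sum_{s=1}^{n-1}(\pm1)^s\frac{E_s^{\pm}(\xi)}{u^s},\qquad T_n^{\pm}(u,\xi)=\sum_{s=0}^{n-2}(\pm1)^s\frac{F_{s+1}^{\pm}(\xi)}{u^s},$$ and, writing $T^\pm=T_n^\pm(u,\xi)$, $$\chi_n^{\pm}(u,\xi)=(\pm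 u)^{n-1}\left[\psi\mp\frac12\phi'-\frac14\phi^2-2T^{\pm}-\frac{\phi T^{\pm}}{u}\mp\frac1u\frac{dT^{\pm}}{d\xi}-\frac{\{T^{\pm}\}^2}{u^2}\right].$$ Empty sums are zero. An $R_2$ arc is an arc with a parametrization $t=t(\tau)$ for which $t''(\tau)$ is continuous and $t'(\tau)$ does not vanish. $\int|h(t)\,dt|$ denotes integration with respect to arc length. The integrals and suprema in the bound are assumed finite. The point $\alpha_j$ may be at infinity provided the integrals converge; in that case $\alpha_j$ is the infinite end of a fixed unbounded $R_2$ arc in $\Delta$, and all paths $\mathcal{L}_j$ coincide with that arc near $\alpha_j$. If $\Delta$ is not simply connected, $E_s^\pm$ and the solutions are understood as analytically continued along $\mathcal{L}_j$. *)

theory Defs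
  imports "HOL-Complex_Analysis.Complex_Analysis"
begin

text \<open>Throughout, \<open>\<sigma>\<close> is the sign: \<open>\<sigma> = 1\<close> for upper signs (\<open>j = 1\<close>), \<open>\<sigma> = -1\<close> for
  lower signs (\<open>j = 2\<close>).\<close>

definition pm :: "nat \<Rightarrow> complex" where
  "pm j = (if j = 1 then 1 else - 1)"

fun LG_F :: "complex \<Rightarrow> (complex \<Rightarrow> complex) \<Rightarrow> (complex \<Rightarrow> complex) \<Rightarrow> nat \<Rightarrow> complex \<Rightarrow> complex"
where
  "LG_F \<sigma> \<phi> \<psi> 0 = (\<lambda>z. \<sigma> * (\<phi> z / 2))"
| "LG_F \<sigma> \<phi> \<psi> (Suc 0) = (\<lambda>z. \<psi> z / 2 - (\<phi> z)\<^sup>2 / 8 - \<sigma> * (deriv \<phi> z / 4))"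
| "LG_F \<sigma> \<phi> \<psi> (Suc (Suc s)) =
     (\<lambda>z. - (deriv (LG_F \<sigma> \<phi> \<psi> (Suc s)) z / 2)
          - (\<Sum>j=0..Suc s. LG_F \<sigma> \<phi> \<psi> j z * LG_F \<sigma> \<phi> \<psi> (Suc s - j) z) / 2)"

definition LG_S :: "complex \<Rightarrow> nat \<Rightarrow> complex \<Rightarrow> (nat \<Rightarrow> complex \<Rightarrow> complex) \<Rightarrow> complex \<Rightarrow> complex"
where
  "LG_S \<sigma> n u E z = (\<Sum>s\<in>{1..<n}. \<sigma> ^ s * (E s z / u ^ s))"

text \<open>The index set \<open>{..<n-1}\<close> is \<open>{0..n-2}\<close> for \<open>n \<ge> 2\<close> and empty for \<open>n = 1\<close>.\<close>

definition LG_T :: "complex \<Rightarrow> (complex \<Rightarrow> complex) \<Rightarrow> (complex \<Rightarrow> complex) \<Rightarrow> nat \<Rightarrow> complex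
    \<Rightarrow> complex \<Rightarrow> complex" where
  "LG_T \<sigma> \<phi> \<psi> n u z = (\<Sum>s\<in>{..<n-1}. \<sigma> ^ s * (LG_F \<sigma> \<phi> \<psi> (s + 1) z / u ^ s))"

definition LG_chi :: "complex \<Rightarrow> (complex \<Rightarrow> complex) \<Rightarrow> (complex \<Rightarrow> complex) \<Rightarrow> nat \<Rightarrow> complex
    \<Rightarrow> complex \<Rightarrow> complex" where
  "LG_chi \<sigma> \<phi> \<psi> n u z = (\<sigma> * u) ^ (n - 1) *
     (\<psi> z - \<sigma> * (deriv \<phi> z / 2) - (\<phi> z)\<^sup>2 / 4 - 2 * LG_T \<sigma> \<phi> \<psi> n u z
      - \<phi> z * LG_T \<sigma> \<phi> \<psi> n u z / u
      - \<sigma> * (deriv (LG_T \<sigma> \<phi> \<psi> n u) z / u)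
      - (LG_T \<sigma> \<phi> \<psi> n u z)\<^sup>2 / u\<^sup>2)"

text \<open>An \<open>R\<^sub>2\<close> arc with parameter interval \<open>I\<close>; derivatives are one-sided at end points of \<open>I\<close>.\<close>

definition R2_arc :: "(real \<Rightarrow> complex) \<Rightarrow> real set \<Rightarrow> bool" where
  "R2_arc t I \<longleftrightarrow> (\<exists>t' t''. (\<forall>\<tau>\<in>I. (t has_vector_derivative t' \<tau>) (at \<tau> within I)
      \<and> (t' has_vector_derivative t'' \<tau>) (at \<tau> within I) \<and> t' \<tau> \<noteq> 0)
    \<and> continuous_on I t'')"

text \<open>Finite chains of \<open>R\<^sub>2\<close> arcs, the successive arcs being parametrized over adjacent intervals.
  The chain begins at a point, or with an arc over \<open>{..b}\<close> (used for arcs from infinity).\<close>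

inductive R2_chain :: "(real \<Rightarrow> complex) \<Rightarrow> real set \<Rightarrow> bool" for t where
  point: "R2_chain t {a}"
| ray: "R2_arc t {..b} \<Longrightarrow> R2_chain t {..b}"
| snoc: "R2_chain t I \<Longrightarrow> b \<in> I \<Longrightarrow> I \<subseteq> {..b} \<Longrightarrow> b < c \<Longrightarrow> R2_arc t {b..c} \<Longrightarrow>
    R2_chain t (I \<union> {b..c})"

text \<open>Integration of \<open>|h(t) dt|\<close> with respect to arc length; the derivative can fail to exist only
  at the finitely many junctions and the end points.\<close>

definition arc_density :: "(real \<Rightarrow> complex) \<Rightarrow> (complex \<Rightarrow> complex) \<Rightarrow> real \<Rightarrow> real" where
  "arc_density t h \<tau> = norm (h (t \<tau>)) * norm (vector_derivative t (at \<tau>))"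

definition arc_integrable :: "(real \<Rightarrow> complex) \<Rightarrow> real set \<Rightarrow> (complex \<Rightarrow> complex) \<Rightarrow> bool" where
  "arc_integrable t I h \<longleftrightarrow> arc_density t h integrable_on I"

definition arc_integral :: "(real \<Rightarrow> complex) \<Rightarrow> real set \<Rightarrow> (complex \<Rightarrow> complex) \<Rightarrow> real" where
  "arc_integral t I h = integral I (arc_density t h)"

text \<open>A reference point \<open>\<alpha>\<close> is either a point of \<open>\<Delta>\<close>, or the infinite end (parameter tending to
  \<open>-\<infinity>\<close>) of a fixed unbounded \<open>R\<^sub>2\<close> arc parametrized over \<open>{..0}\<close>. In both cases branches of
  multivalued functions are prescribed along \<open>ref_curve \<alpha>\<close>, which in the first case is just the
  point itself at parameter \<open>0\<close>. Paths from \<open>\<alpha>\<close> have parameter interval \<open>path_dom \<alpha> b\<close>, and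
  \<open>ref_filter \<alpha>\<close> expresses nearness to \<open>\<alpha>\<close> in terms of the parameter.\<close>

datatype ref_point = Finite_Point complex | Infinite_End "real \<Rightarrow> complex"

fun ref_curve :: "ref_point \<Rightarrow> real \<Rightarrow> complex" where
  "ref_curve (Finite_Point a) = (\<lambda>\<tau>. a)"
| "ref_curve (Infinite_End A) = A"

fun ref_dom :: "ref_point \<Rightarrow> real set" where
  "ref_dom (Finite_Point a) = {0}"
| "ref_dom (Infinite_End A) = {..0}"

fun ref_filter :: "ref_point \<Rightarrow> real filter" where
  "ref_filter (Finite_Point a) = principal {0}"
| "ref_filter (Infinite_End A) = at_bot"

fun path_dom :: "ref_point \<Rightarrow> real \<Rightarrow> real set" where
  "path_dom (Finite_Point a) b = {0..b}"
| "path_dom (Infinite_End A) b = {..b}"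

fun ref_point_in :: "complex set \<Rightarrow> ref_point \<Rightarrow> bool" where
  "ref_point_in \<Delta> (Finite_Point a) \<longleftrightarrow> a \<in> \<Delta>"
| "ref_point_in \<Delta> (Infinite_End A) \<longleftrightarrow>
     R2_arc A {..0} \<and> A ` {..0} \<subseteq> \<Delta> \<and> filterlim A at_infinity at_bot"

text \<open>Analytic continuation along a curve \<open>t\<close> with parameter interval \<open>I\<close>: \<open>f \<tau>\<close> is a function
  element (germ) at \<open>t \<tau>\<close>, and neighbouring function elements are direct continuations of
  each other.\<close>

definition continued_along ::
  "(real \<Rightarrow> complex) \<Rightarrow> real set \<Rightarrow> (real \<Rightarrow> complex \<Rightarrow> complex) \<Rightarrow> bool" where
  "continued_along t I f \<longleftrightarrow> (\<forall>\<tau>\<in>I. f \<tau> analytic_on {t \<tau>} \<and>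
     (\<forall>\<^sub>F \<tau>' in at \<tau> within I. \<forall>\<^sub>F z in nhds (t \<tau>'). f \<tau>' z = f \<tau> z))"

text \<open>\<open>f\<close> is the continuation, along the path \<open>t\<close> over \<open>path_dom \<alpha> b\<close>, of the branch \<open>e\<close> prescribed
  at \<open>\<alpha>\<close>.\<close>

definition continuation_from ::
  "ref_point \<Rightarrow> (real \<Rightarrow> complex \<Rightarrow> complex) \<Rightarrow> (real \<Rightarrow> complex) \<Rightarrow> real
    \<Rightarrow> (real \<Rightarrow> complex \<Rightarrow> complex) \<Rightarrow> bool" where
  "continuation_from \<alpha> e t b f \<longleftrightarrow> continued_along t (path_dom \<alpha> b) f \<and>
     (\<forall>\<^sub>F \<tau> in ref_filter \<alpha>. \<forall>\<^sub>F z in nhds (t \<tau>). f \<tau> z = e \<tau> z)"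

definition antiderivative_branch ::
  "ref_point \<Rightarrow> (complex \<Rightarrow> complex) \<Rightarrow> (real \<Rightarrow> complex \<Rightarrow> complex) \<Rightarrow> bool" where
  "antiderivative_branch \<alpha> g e \<longleftrightarrow> continued_along (ref_curve \<alpha>) (ref_dom \<alpha>) e \<and>
     (\<forall>\<tau>\<in>ref_dom \<alpha>. \<forall>\<^sub>F z in nhds (ref_curve \<alpha> \<tau>). (e \<tau> has_field_derivative g z) (at z))"

definition path_from ::
  "complex set \<Rightarrow> ref_point \<Rightarrow> (real \<Rightarrow> complex) \<Rightarrow> real \<Rightarrow> complex \<Rightarrow> bool" where
  "path_from \<Delta> \<alpha> t b \<xi> \<longleftrightarrow> R2_chain t (path_dom \<alpha> b) \<and> t ` path_dom \<alpha> b \<subseteq> \<Delta> \<and>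
     (\<forall>\<^sub>F \<tau> in ref_filter \<alpha>. t \<tau> = ref_curve \<alpha> \<tau>) \<and> t b = \<xi>"

text \<open>Here \<open>e0\<close> is the branch of \<open>E\<^sub>0\<close> prescribed at \<open>\<alpha>\<close> and \<open>f0\<close> its continuation along the path.\<close>

definition admissible_path ::
  "complex set \<Rightarrow> complex \<Rightarrow> nat \<Rightarrow> ref_point \<Rightarrow> (real \<Rightarrow> complex \<Rightarrow> complex)
    \<Rightarrow> (real \<Rightarrow> complex) \<Rightarrow> real \<Rightarrow> (real \<Rightarrow> complex \<Rightarrow> complex) \<Rightarrow> complex \<Rightarrow> bool" where
  "admissible_path \<Delta> u j \<alpha> e0 t b f0 \<xi> \<longleftrightarrow> path_from \<Delta> \<alpha> t b \<xi> \<and>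
     continuation_from \<alpha> e0 t b f0 \<and>
     antimono_on (path_dom \<alpha> b) (\<lambda>\<tau>. Re ((- 1) ^ j * u * t \<tau> - f0 \<tau> (t \<tau>)))"

definition Xi ::
  "complex set \<Rightarrow> complex \<Rightarrow> nat \<Rightarrow> ref_point \<Rightarrow> (real \<Rightarrow> complex \<Rightarrow> complex) \<Rightarrow> complex set" where
  "Xi \<Delta> u j \<alpha> e0 = {\<xi>. \<exists>t b f0. admissible_path \<Delta> u j \<alpha> e0 t b f0 \<xi>}"

definition solves_near ::
  "complex \<Rightarrow> (complex \<Rightarrow> complex) \<Rightarrow> (complex \<Rightarrow> complex) \<Rightarrow> (complex \<Rightarrow> complex) \<Rightarrow> complex \<Rightarrow> bool"
where
  "solves_near u \<phi> \<psi> w a \<longleftrightarrow> w analytic_on {a} \<and>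
     (\<forall>\<^sub>F z in nhds a. deriv (deriv w) z = (u\<^sup>2 + u * \<phi> z + \<psi> z) * w z)"

definition kappa0 :: "(complex \<Rightarrow> complex) \<Rightarrow> complex \<Rightarrow> complex set \<Rightarrow> real" where
  "kappa0 \<phi> u L = (SUP t\<in>L. 1 / norm (1 + \<phi> t / (2 * u)))"

definition kappa2 :: "(complex \<Rightarrow> complex) \<Rightarrow> complex set \<Rightarrow> real" where
  "kappa2 \<phi> L = (SUP t\<in>L. norm (\<phi> t))"

text \<open>Finiteness of all integrals and suprema in the bound. Since \<open>1 / 0 = 0\<close>, finiteness of the
  supremum defining \<open>kappa0\<close> includes nonvanishing of \<open>1 + \<phi> / (2 u)\<close> as a separate condition.\<close>

definition bound_finite :: "complex \<Rightarrow> (complex \<Rightarrow> complex) \<Rightarrow> (complex \<Rightarrow> complex) \<Rightarrow> nat \<Rightarrow> complex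
    \<Rightarrow> (real \<Rightarrow> complex) \<Rightarrow> real set \<Rightarrow> bool" where
  "bound_finite \<sigma> \<phi> \<psi> n u t I \<longleftrightarrow>
     arc_integrable t I (LG_chi \<sigma> \<phi> \<psi> n u) \<and> arc_integrable t I (LG_T \<sigma> \<phi> \<psi> n u) \<and>
     arc_integrable t I (deriv \<phi>) \<and>
     (\<forall>z\<in>t ` I. 1 + \<phi> z / (2 * u) \<noteq> 0) \<and>
     bdd_above ((\<lambda>z. 1 / norm (1 + \<phi> z / (2 * u))) ` t ` I) \<and>
     bdd_above ((\<lambda>z. norm (\<phi> z)) ` t ` I)"

text \<open>The error bound at \<open>\<xi>\<close> for the path \<open>t\<close> over \<open>I\<close>; \<open>E0\<close> is the function element of \<open>E\<^sub>0\<close> at \<open>\<xi>\<close>.\<close>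

definition error_bound :: "complex \<Rightarrow> (complex \<Rightarrow> complex) \<Rightarrow> (complex \<Rightarrow> complex) \<Rightarrow> nat \<Rightarrow> complex
    \<Rightarrow> (complex \<Rightarrow> complex) \<Rightarrow> (real \<Rightarrow> complex) \<Rightarrow> real set \<Rightarrow> complex \<Rightarrow> real" where
  "error_bound \<sigma> \<phi> \<psi> n u E0 t I \<xi> =
     (let \<kappa>0 = kappa0 \<phi> u (t ` I); \<kappa>2 = kappa2 \<phi> (t ` I) in
      \<kappa>0 * norm (exp (\<sigma> * u * \<xi> + E0 \<xi>) / u ^ n) * arc_integral t I (LG_chi \<sigma> \<phi> \<psi> n u)
      * exp (1 / norm u * (2 + 2 * \<kappa>0 + \<kappa>0 * \<kappa>2 / norm u) * arc_integral t I (LG_T \<sigma> \<phi> \<psi> n u)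
           + \<kappa>0 / norm u * arc_integral t I (deriv \<phi>)
           + \<kappa>0 / norm u ^ n * arc_integral t I (LG_chi \<sigma> \<phi> \<psi> n u)))"

end

theory Submission imports Defs begin

text \<open>With \<open>v = \<sigma> u\<close>, \<open>\<theta> = v z + E\<^sub>0\<close> and \<open>p = \<theta>' = v + \<sigma> \<phi> / 2\<close>, a solution is written
  \<open>W = exp S (exp \<theta> + \<epsilon>)\<close> and \<open>\<epsilon>\<close> is split along the two exponentials \<open>exp (\<plusminus>\<theta>)\<close>:
  \<open>\<epsilon> = exp \<theta> (g + h)\<close> and \<open>\<epsilon>' / p = exp \<theta> (g - h)\<close>. Since \<open>S' = T / v\<close>, the differential equation becomes
  \<open>g' = r / 2\<close>, \<open>h' = - 2 p h - r / 2\<close> with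
  \<open>r = (\<chi> / (v^(n-1) p)) (1 + g + h) + 2 (2 T / v + p' / p) h\<close>.
  Monotonicity of \<open>Re \<theta>\<close> along the path makes the term \<open>- 2 p h\<close> harmless, so a Gronwall-type comparison
  bounds \<open>g\<close> and \<open>h\<close> by \<open>A exp (A + B) / 2\<close>, where \<open>A\<close> is the integral of \<open>|\<chi>|\<close> and \<open>B\<close> combines
  the integrals of \<open>|T|\<close> and \<open>|\<phi>'|\<close>; this is sharper than the stated bound.
  For a finite reference point the solution is fixed by \<open>g = h = 0\<close> there. For an infinite one it is a
  limit point of solutions with \<open>g = h = 0\<close> at points receding to infinity; the uniform bounds provide
  compactness and show that \<open>g\<close> and \<open>h\<close> vanish at infinity.\<close>

section \<open>Linear differential equations on simply connected domains\<close>

text \<open>The order of quantifiers shapes the proof: one solution has to serve every end point and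
  every path, so it must be fixed before any path is known, from data at the reference point alone.
  The estimates are therefore proved for an arbitrary solution whose coefficients are small
  somewhere on the path, and that smallness is arranged separately. If \<Delta> is simply connected,
  the solution must moreover be a single holomorphic function on \<Delta>; this is why a global
  existence theorem is needed besides the continuation of germs along curves. The coefficients g and
  h come from Y = W exp(- S - \<theta>) and Z = (W' - S' W) exp(- S - \<theta>) / p, both of which
  equal 1 for W = exp(S + \<theta>): one sets Y = 1 + g + h and Z = 1 + g - h. In these variables
  the large coefficient p multiplies h only. A barrier with strict inequalities then replaces the
  usual iteration of a Volterra integral equation, and a chain of arcs can be treated arc by
  arc.\<close>

lemma norm_primitive_segment_le:
  fixes F f :: "complex \<Rightarrow> complex"
  assumes der: "\<And>x. x \<in> closed_segment a z \<Longrightarrow> (F has_field_derivative f x) (at x)"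
    and Fa: "F a = 0"
    and bnd: "\<And>x. x \<in> closed_segment a z \<Longrightarrow> norm (f x) \<le> M * (C * (M * norm (x - a)) ^ k / fact k)"
  shows "norm (F z) \<le> C * (M * norm (z - a)) ^ Suc k / fact (Suc k)"
proof -
  define l where "l s = a + complex_of_real s * (z - a)" for s
  have lseg: "l s \<in> closed_segment a z" if "0 \<le> s" "s \<le> 1" for s
    using that unfolding l_def closed_segment_def
    by (auto simp: algebra_simps scaleR_conv_of_real intro!: exI[of _ s])
  have lder: "(l has_vector_derivative (z - a)) (at s within A)" for s A
    unfolding l_def by (auto intro!: derivative_eq_intros)
  have Fl: "((\<lambda>s. F (l s)) has_vector_derivative ((z - a) * f (l s))) (at s within A)"
    if "0 \<le> s" "s \<le> 1" for s A
    using field_vector_diff_chain_within[OF lder[of s A]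
        has_field_derivative_at_within[OF der[OF lseg[OF that]]]] by (simp add: o_def)
  \<comment> \<open>Along the segment the scalar majorant has exactly the assumed bound of the
    integrand as its derivative. This is the induction step of the Picard estimate: integrating the
    \<open>k\<close>-th exponential term gives the next one.\<close>
  have "norm (F (l 1) - F (l 0)) \<le>
     C * (M * norm (z - a) * 1) ^ Suc k / fact (Suc k) - C * (M * norm (z - a) * 0) ^ Suc k / fact (Suc k)"
  proof (rule differentiable_bound_general[of 0 1 "\<lambda>s. F (l s)"
        "\<lambda>s. C * (M * norm (z - a) * s) ^ Suc k / fact (Suc k)"
        "\<lambda>s. (z - a) * f (l s)" "\<lambda>s. norm (z - a) * (M * (C * (M * norm (l s - a)) ^ k / fact k))"])
    show "continuous_on {0..1} (\<lambda>s. F (l s))"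
      by (rule continuous_on_vector_derivative[of _ _ "\<lambda>s. (z - a) * f (l s)"]) (use Fl in auto)
    show "continuous_on {0..1} (\<lambda>s. C * (M * cmod (z - a) * s) ^ Suc k / fact (Suc k))"
      by (intro continuous_intros) auto
  next
    fix x :: real assume x: "0 < x" "x < 1"
    show "((\<lambda>s. F (l s)) has_vector_derivative (z - a) * f (l x)) (at x)"
      using Fl x by simp
    have "((\<lambda>s. C * (M * cmod (z - a) * s) ^ Suc k / fact (Suc k)) has_real_derivative
       C * (of_nat (Suc k) * (M * cmod (z - a) * x) ^ k * (M * cmod (z - a))) / fact (Suc k)) (at x)"
      by (rule derivative_eq_intros refl | simp)+
    also have "C * (of_nat (Suc k) * (M * cmod (z - a) * x) ^ k * (M * cmod (z - a))) / fact (Suc k)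
       = norm (z - a) * (M * (C * (M * norm (l x - a)) ^ k / fact k))"
      using x unfolding l_def by (simp add: norm_mult divide_simps mult_ac)
    finally show "((\<lambda>s. C * (M * cmod (z - a) * s) ^ Suc k / fact (Suc k)) has_vector_derivative
          cmod (z - a) * (M * (C * (M * cmod (l x - a)) ^ k / fact k))) (at x)"
      by (simp add: has_real_derivative_iff_has_vector_derivative)
    show "cmod ((z - a) * f (l x)) \<le> cmod (z - a) * (M * (C * (M * cmod (l x - a)) ^ k / fact k))"
      using bnd[OF lseg[of x]] x unfolding norm_mult by (intro mult_left_mono) auto
  qed simp
  then show ?thesis by (simp add: l_def Fa)
qed

lemma holomorphic_convex_primitive_zero:
  fixes f :: "complex \<Rightarrow> complex"
  assumes "convex S" "open S" "f holomorphic_on S"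
  obtains F where "F a = 0" "\<And>x. x \<in> S \<Longrightarrow> (F has_field_derivative f x) (at x)"
proof -
  obtain g where g: "\<And>x. x \<in> S \<Longrightarrow> (g has_field_derivative f x) (at x within S)"
    using holomorphic_convex_primitive'[OF assms] by blast
  show ?thesis
  proof (rule that[of "\<lambda>x. g x - g a"])
    fix x assume "x \<in> S"
    then have "(g has_field_derivative f x) (at x)"
      using g assms(2) by (metis at_within_open)
    then show "((\<lambda>x. g x - g a) has_field_derivative f x) (at x)"
      by (auto intro!: derivative_eq_intros)
  qed simp
qed

text \<open>Picard iteration, written as a series: each term is the primitive, vanishing at
  \<open>z0\<close>, of a coefficient times the preceding term of the other component. Convexity
  provides the primitives and lets the estimate run along segments from \<open>z0\<close>. The
  off-diagonal form is that of w'' = q w after a conformal change of variable.\<close>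

lemma linear_system_convex:
  fixes a b :: "complex \<Rightarrow> complex"
  assumes S: "open S" "convex S" and a: "a holomorphic_on S" and b: "b holomorphic_on S"
    and z0: "z0 \<in> S"
  obtains v1 v2 where "v1 z0 = c1" "v2 z0 = c2"
    "\<And>z. z \<in> S \<Longrightarrow> (v1 has_field_derivative a z * v2 z) (at z)"
    "\<And>z. z \<in> S \<Longrightarrow> (v2 has_field_derivative b z * v1 z) (at z)"
proof -
  \<comment> \<open>A choice of primitive as a total operator allows the iterates to be defined by
    recursion before they are known to be holomorphic.\<close>
  define prim where "prim f = (SOME F. F z0 = 0 \<and> (\<forall>x\<in>S. (F has_field_derivative f x) (at x)))"
    for f :: "complex \<Rightarrow> complex"
  have prim: "prim f z0 = 0 \<and> (\<forall>x\<in>S. (prim f has_field_derivative f x) (at x))"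
    if f: "f holomorphic_on S" for f
  proof -
    obtain F where "F z0 = 0" "\<And>x. x \<in> S \<Longrightarrow> (F has_field_derivative f x) (at x)"
      using holomorphic_convex_primitive_zero[OF S(2,1) f, of z0] by blast
    then have "\<exists>F. F z0 = 0 \<and> (\<forall>x\<in>S. (F has_field_derivative f x) (at x))" by blast
    from someI_ex[OF this] show ?thesis unfolding prim_def .
  qed
  define it where "it = rec_nat ((\<lambda>z::complex. c1), (\<lambda>z::complex. c2))
    (\<lambda>_ p. (prim (\<lambda>z. a z * snd p z), prim (\<lambda>z. b z * fst p z)))"
  have it0: "it 0 = ((\<lambda>z. c1), (\<lambda>z. c2))" and
    itS: "it (Suc k) = (prim (\<lambda>z. a z * snd (it k) z), prim (\<lambda>z. b z * fst (it k) z))" for k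
    unfolding it_def by (simp_all only: nat.rec prod.sel)
  define x where "x k = fst (it k)" for k
  define y where "y k = snd (it k)" for k
  have x0: "x 0 = (\<lambda>z. c1)" and y0: "y 0 = (\<lambda>z. c2)" and
    xS: "x (Suc k) = prim (\<lambda>z. a z * y k z)" and yS: "y (Suc k) = prim (\<lambda>z. b z * x k z)" for k
    unfolding x_def y_def it0 itS by simp_all
  have hol: "x k holomorphic_on S \<and> y k holomorphic_on S" for k
  proof (induction k)
    case 0
    then show ?case by (simp add: x0 y0)
  next
    case (Suc k)
    have "(\<lambda>z. a z * y k z) holomorphic_on S" "(\<lambda>z. b z * x k z) holomorphic_on S"
      using Suc a b by (auto intro!: holomorphic_intros)
    from this[THEN prim] show ?case
      unfolding xS yS holomorphic_on_open[OF S(1)] by blast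
  qed
  have hola: "(\<lambda>z. a z * y k z) holomorphic_on S" and holb: "(\<lambda>z. b z * x k z) holomorphic_on S" for k
    using hol a b by (auto intro!: holomorphic_intros)
  have xSd: "x (Suc k) z0 = 0" "z \<in> S \<Longrightarrow> (x (Suc k) has_field_derivative a z * y k z) (at z)"
   and ySd: "y (Suc k) z0 = 0" "z \<in> S \<Longrightarrow> (y (Suc k) has_field_derivative b z * x k z) (at z)" for k z
    using prim[OF hola] prim[OF holb] unfolding xS yS by auto
  \<comment> \<open>Termwise derivatives of the two series. The term of index 0 is constant, so its
    derivative is 0 and the others are shifted by one.\<close>
  define x' where "x' k z = (case k of 0 \<Rightarrow> 0 | Suc m \<Rightarrow> a z * y m z)" for k z
  define y' where "y' k z = (case k of 0 \<Rightarrow> 0 | Suc m \<Rightarrow> b z * x m z)" for k z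
  have dx: "(x k has_field_derivative x' k z) (at z)" and dy: "(y k has_field_derivative y' k z) (at z)"
    if "z \<in> S" for k z
    using that xSd ySd by (cases k; simp add: x'_def y'_def x0 y0)+
  define C where "C = max (norm c1) (norm c2)"
  have loc: "\<exists>d h. 0 < d \<and> summable h \<and> (\<forall>k. \<forall>w\<in>ball z d \<inter> S. norm (x k w) \<le> h k \<and> norm (y k w) \<le> h k)"
    if z: "z \<in> S" for z
  proof -
    obtain e where e: "e > 0" "cball z e \<subseteq> S" using S z open_contains_cball by metis
    \<comment> \<open>A compact convex set that contains \<open>z0\<close> and a neighbourhood of
      \<open>z\<close>: segments from \<open>z0\<close> to points near \<open>z\<close> stay inside
      it, and there one constant \<open>M\<close> bounds both coefficients.\<close>
    define H where "H = convex hull (insert z0 (cball z e))"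
    have H: "compact H" "convex H" "z0 \<in> H" "cball z e \<subseteq> H"
      unfolding H_def using hull_subset[of "insert z0 (cball z e)" convex]
      by (auto intro: compact_convex_hull compact_insert)
    have HS: "H \<subseteq> S" unfolding H_def by (rule hull_minimal) (use e z0 S in auto)
    have "compact (a ` H)" "compact (b ` H)"
      by (rule compact_continuous_image[OF continuous_on_subset[OF holomorphic_on_imp_continuous_on[OF a] HS] H(1)],
          rule compact_continuous_image[OF continuous_on_subset[OF holomorphic_on_imp_continuous_on[OF b] HS] H(1)])
    then have "bounded (a ` H)" "bounded (b ` H)" by (auto intro: compact_imp_bounded)
    then obtain Ma Mb where Ma: "\<And>w. w \<in> H \<Longrightarrow> norm (a w) \<le> Ma" and Mb: "\<And>w. w \<in> H \<Longrightarrow> norm (b w) \<le> Mb"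
      unfolding bounded_iff by auto
    define M where "M = max Ma Mb"
    have M: "norm (a w) \<le> M" "norm (b w) \<le> M" if "w \<in> H" for w
      using Ma[OF that] Mb[OF that] by (auto simp: M_def)
    have M0: "M \<ge> 0" using order_trans[OF norm_ge_zero M(1)[OF H(3)]] .
    have bd: "norm (x k w) \<le> C * (M * norm (w - z0)) ^ k / fact k \<and>
              norm (y k w) \<le> C * (M * norm (w - z0)) ^ k / fact k" if "w \<in> H" for k w
      using that
    proof (induction k arbitrary: w)
      case 0
      then show ?case by (simp add: x0 y0 C_def)
    next
      case (Suc k)
      have seg: "closed_segment z0 w \<subseteq> H" by (simp add: H Suc.prems closed_segment_subset)
      have "norm (x (Suc k) w) \<le> C * (M * norm (w - z0)) ^ Suc k / fact (Suc k)"
      proof (rule norm_primitive_segment_le[where f = "\<lambda>z. a z * y k z"])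
        fix v assume v: "v \<in> closed_segment z0 w"
        then show "(x (Suc k) has_field_derivative a v * y k v) (at v)" using xSd seg HS by blast
        have "v \<in> H" using v seg by blast
        then show "norm (a v * y k v) \<le> M * (C * (M * norm (v - z0)) ^ k / fact k)"
          using Suc.IH[of v] M M0 unfolding norm_mult by (intro mult_mono) auto
      qed (rule xSd)
      moreover have "norm (y (Suc k) w) \<le> C * (M * norm (w - z0)) ^ Suc k / fact (Suc k)"
      proof (rule norm_primitive_segment_le[where f = "\<lambda>z. b z * x k z"])
        fix v assume v: "v \<in> closed_segment z0 w"
        then show "(y (Suc k) has_field_derivative b v * x k v) (at v)" using ySd seg HS by blast
        have "v \<in> H" using v seg by blast
        then show "norm (b v * x k v) \<le> M * (C * (M * norm (v - z0)) ^ k / fact k)"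
          using Suc.IH[of v] M M0 unfolding norm_mult by (intro mult_mono) auto
      qed (rule ySd)
      ultimately show ?case by blast
    qed
    define R where "R = M * (norm (z - z0) + e)"
    have sm: "summable (\<lambda>k. C * R ^ k / fact k)"
      using summable_mult[OF summable_exp[of R], of C] by (simp add: divide_inverse mult_ac)
    have C0: "C \<ge> 0" by (simp add: C_def le_max_iff_disj)
    have "norm (x k w) \<le> C * R ^ k / fact k \<and> norm (y k w) \<le> C * R ^ k / fact k"
      if "w \<in> ball z e \<inter> S" for k w
    proof -
      have w: "w \<in> H" using that H(4) by (auto simp: subset_iff)
      have "norm (w - z0) \<le> norm (z - z0) + e"
        using that norm_triangle_ineq[of "w - z" "z - z0"] by (auto simp: dist_norm norm_minus_commute)
      then have "M * norm (w - z0) \<le> R" unfolding R_def using M0 by (rule mult_left_mono)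
      then have "C * (M * norm (w - z0)) ^ k / fact k \<le> C * R ^ k / fact k"
        using C0 M0 by (intro divide_right_mono mult_left_mono power_mono) auto
      then show ?thesis using bd[OF w, of k] by linarith
    qed
    then show ?thesis using e sm by (intro exI[of _ e] exI[of _ "\<lambda>k. C * R ^ k / fact k"]) blast
  qed
  have "\<exists>g g'. \<forall>z\<in>S. (\<lambda>n. x n z) sums g z \<and> (\<lambda>n. x' n z) sums g' z \<and> (g has_field_derivative g' z) (at z)"
  proof (rule series_and_derivative_comparison_local[OF S(1) dx])
    fix z assume "z \<in> S"
    from loc[OF this] obtain d h where "0 < d" "summable h"
      "\<forall>k. \<forall>w\<in>ball z d \<inter> S. norm (x k w) \<le> h k \<and> norm (y k w) \<le> h k" by blast
    then show "\<exists>d h. 0 < d \<and> summable h \<and> (\<forall>\<^sub>F n in sequentially. \<forall>w\<in>ball z d \<inter> S. norm (x n w) \<le> h n)"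
      by (intro exI[of _ d] exI[of _ h] conjI always_eventually) auto
  qed auto
  then obtain v1 v1' where v1: "\<And>z. z \<in> S \<Longrightarrow> (\<lambda>n. x n z) sums v1 z"
    "\<And>z. z \<in> S \<Longrightarrow> (\<lambda>n. x' n z) sums v1' z" "\<And>z. z \<in> S \<Longrightarrow> (v1 has_field_derivative v1' z) (at z)"
    by blast
  have "\<exists>g g'. \<forall>z\<in>S. (\<lambda>n. y n z) sums g z \<and> (\<lambda>n. y' n z) sums g' z \<and> (g has_field_derivative g' z) (at z)"
  proof (rule series_and_derivative_comparison_local[OF S(1) dy])
    fix z assume "z \<in> S"
    from loc[OF this] obtain d h where "0 < d" "summable h"
      "\<forall>k. \<forall>w\<in>ball z d \<inter> S. norm (x k w) \<le> h k \<and> norm (y k w) \<le> h k" by blast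
    then show "\<exists>d h. 0 < d \<and> summable h \<and> (\<forall>\<^sub>F n in sequentially. \<forall>w\<in>ball z d \<inter> S. norm (y n w) \<le> h n)"
      by (intro exI[of _ d] exI[of _ h] conjI always_eventually) auto
  qed auto
  then obtain v2 v2' where v2: "\<And>z. z \<in> S \<Longrightarrow> (\<lambda>n. y n z) sums v2 z"
    "\<And>z. z \<in> S \<Longrightarrow> (\<lambda>n. y' n z) sums v2' z" "\<And>z. z \<in> S \<Longrightarrow> (v2 has_field_derivative v2' z) (at z)"
    by blast
  have "v1' z = a z * v2 z" "v2' z = b z * v1 z" if "z \<in> S" for z
  proof -
    have "(\<lambda>n. x' (Suc n) z) sums (a z * v2 z)" "(\<lambda>n. y' (Suc n) z) sums (b z * v1 z)"
      using sums_mult[OF v2(1)[OF that]] sums_mult[OF v1(1)[OF that]] by (simp_all add: x'_def y'_def)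
    from this[THEN sums_Suc]
    have "(\<lambda>n. x' n z) sums (a z * v2 z)" "(\<lambda>n. y' n z) sums (b z * v1 z)"
      by (simp_all add: x'_def y'_def)
    then show "v1' z = a z * v2 z" "v2' z = b z * v1 z"
      using v1(2)[OF that] v2(2)[OF that] sums_unique2 by blast+
  qed
  moreover have "v1 z0 = c1" "v2 z0 = c2"
  proof -
    have "x n z0 = 0" "y n z0 = 0" if "n \<noteq> 0" for n
      using that xSd(1) ySd(1) by (metis not0_implies_Suc)+
    then have "(\<lambda>n. x n z0) sums c1" "(\<lambda>n. y n z0) sums c2"
      using sums_finite[of "{0}" "\<lambda>n. x n z0"] sums_finite[of "{0}" "\<lambda>n. y n z0"]
      by (simp_all add: x0 y0)
    then show "v1 z0 = c1" "v2 z0 = c2"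
      using v1(1)[OF z0] v2(1)[OF z0] sums_unique2 by blast+
  qed
  ultimately show ?thesis using that[of v1 v2] v1(3) v2(3) by auto
qed

text \<open>The plane is convex already; any other domain is mapped to the unit disc. With
  \<open>g\<close> the inverse map, v1 = w o g and v2 = w' o g satisfy v1' = g' v2 and v2' = g' (q o
  g) v1, so that transporting w and w' as a pair avoids second derivatives of
  \<open>g\<close>.\<close>

lemma linear_ode_simply_connected:
  fixes q :: "complex \<Rightarrow> complex"
  assumes S: "open S" "simply_connected S" and q: "q holomorphic_on S" and z0: "z0 \<in> S"
  obtains w where "w holomorphic_on S" "w z0 = c1" "deriv w z0 = c2"
    "\<And>z. z \<in> S \<Longrightarrow> deriv (deriv w) z = q z * w z"
proof -
  note result = that
  have *: thesis if "w z0 = c1" "w' z0 = c2" "\<And>z. z \<in> S \<Longrightarrow> (w has_field_derivative w' z) (at z)"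
     "\<And>z. z \<in> S \<Longrightarrow> (w' has_field_derivative q z * w z) (at z)" for w w'
  proof (rule result)
    show "w holomorphic_on S" using that S(1) by (metis holomorphic_on_open)
    show "w z0 = c1" "deriv w z0 = c2" using that(1,2) DERIV_imp_deriv[OF that(3)[OF z0]] by auto
    fix z assume z: "z \<in> S"
    have "\<forall>\<^sub>F x in nhds z. x \<in> S" using S z by (simp add: eventually_nhds_in_open)
    then have "\<forall>\<^sub>F x in nhds z. deriv w x = w' x"
      by eventually_elim (rule DERIV_imp_deriv[OF that(3)])
    then show "deriv (deriv w) z = q z * w z"
      using that(4)[OF z] by (simp add: deriv_cong_ev DERIV_imp_deriv)
  qed
  consider "S = UNIV" | (disc) f g where "f holomorphic_on S" "g holomorphic_on ball 0 1"
     "\<And>z. z \<in> S \<Longrightarrow> f z \<in> ball 0 1 \<and> g (f z) = z"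
     "\<And>z. z \<in> ball 0 1 \<Longrightarrow> g z \<in> S \<and> f (g z) = z"
    using Riemann_mapping_theorem[of S] S z0 by auto
  then show thesis
  proof cases
    case 1
    then show thesis
      using linear_system_convex[of UNIV "\<lambda>_. 1" q z0 c1 c2] q * by (auto simp: mult_ac)
  next
    case disc
    have g': "deriv g holomorphic_on ball 0 1" using disc(2) by (simp add: holomorphic_deriv)
    have im: "g ` ball 0 1 \<subseteq> S" using disc(4) by blast
    have qg: "(\<lambda>z. q (g z)) holomorphic_on ball 0 1"
      using holomorphic_on_compose_gen[OF disc(2) q im] by (simp add: o_def)
    have b: "(\<lambda>z. deriv g z * q (g z)) holomorphic_on ball 0 1"
      using g' qg by (rule holomorphic_on_mult)
    obtain v1 v2 where v: "v1 (f z0) = c1" "v2 (f z0) = c2"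
     "\<And>z. z \<in> ball 0 1 \<Longrightarrow> (v1 has_field_derivative deriv g z * v2 z) (at z)"
     "\<And>z. z \<in> ball 0 1 \<Longrightarrow> (v2 has_field_derivative deriv g z * q (g z) * v1 z) (at z)"
      using linear_system_convex[OF open_ball convex_ball g' b, of "f z0" c1 c2] disc(3) z0 by blast
    have df: "(f has_field_derivative deriv f z) (at z)" if "z \<in> S" for z
      using disc(1) S(1) that by (simp add: holomorphic_derivI)
    have gf: "deriv g (f z) * deriv f z = 1" if "z \<in> S" for z
    proof -
      have "(g has_field_derivative deriv g (f z)) (at (f z))"
        using disc(2,3) that by (auto intro: holomorphic_derivI)
      from DERIV_chain2[OF this df[OF that]]
      have 1: "((\<lambda>x. g (f x)) has_field_derivative deriv g (f z) * deriv f z) (at z)" .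
      have "((\<lambda>x. x) has_field_derivative deriv g (f z) * deriv f z) (at z)"
        by (rule has_field_derivative_transform_within_open[OF 1 S(1) that]) (use disc(3) in auto)
      then show ?thesis using DERIV_unique DERIV_ident by blast
    qed
    show thesis
    proof (rule *[of "\<lambda>z. v1 (f z)" "\<lambda>z. v2 (f z)"])
      fix z assume z: "z \<in> S"
      then have fz: "f z \<in> ball 0 1" "g (f z) = z" using disc(3) by auto
      have "((\<lambda>x. v1 (f x)) has_field_derivative deriv g (f z) * v2 (f z) * deriv f z) (at z)"
        using DERIV_chain2[OF v(3)[OF fz(1)] df[OF z]] .
      moreover have "deriv g (f z) * v2 (f z) * deriv f z = v2 (f z)"
        using gf[OF z] by (metis mult.commute mult.left_commute mult.right_neutral)
      ultimately show "((\<lambda>x. v1 (f x)) has_field_derivative v2 (f z)) (at z)" by simp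
      have "((\<lambda>x. v2 (f x)) has_field_derivative deriv g (f z) * q (g (f z)) * v1 (f z) * deriv f z) (at z)"
        using DERIV_chain2[OF v(4)[OF fz(1)] df[OF z]] .
      moreover have "deriv g (f z) * q (g (f z)) * v1 (f z) * deriv f z = q z * v1 (f z)"
        using gf[OF z] fz(2) by (metis mult.commute mult.left_commute mult.right_neutral)
      ultimately show "((\<lambda>x. v2 (f x)) has_field_derivative q z * v1 (f z)) (at z)" by simp
    qed (use v in auto)
  qed
qed

text \<open>All derivatives at \<open>z0\<close> vanish: by Leibniz' rule, differentiating w'' = q w
  expresses each of them through lower ones. The identity theorem does the rest.\<close>

lemma linear_ode_zero:
  fixes q :: "complex \<Rightarrow> complex"
  assumes S: "open S" "connected S" and q: "q holomorphic_on S" and z0: "z0 \<in> S"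
    and w: "w holomorphic_on S" "\<And>z. z \<in> S \<Longrightarrow> deriv (deriv w) z = q z * w z"
    and "w z0 = 0" "deriv w z0 = 0" and "z \<in> S"
  shows "w z = 0"
proof (rule holomorphic_fun_eq_0_on_connected[OF w(1) S _ z0 \<open>z \<in> S\<close>])
  fix n
  show "(deriv ^^ n) w z0 = 0"
  proof (induction n rule: less_induct)
    case (less n)
    consider "n = 0" | "n = 1" | m where "n = Suc (Suc m)"
      by (metis One_nat_def not0_implies_Suc)
    then show ?case
    proof cases
      case (3 m)
      have ev: "\<forall>\<^sub>F z in nhds z0. deriv (deriv w) z = q z * w z"
        using eventually_nhds_in_open[OF S(1) z0] by eventually_elim (rule w(2))
      have "(deriv ^^ n) w z0 = (deriv ^^ m) (deriv (deriv w)) z0"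
        by (simp add: 3 funpow_swap1 del: funpow.simps(2) add: funpow_Suc_right)
      also have "\<dots> = (deriv ^^ m) (\<lambda>z. q z * w z) z0"
        by (rule higher_deriv_cong_ev[OF ev refl])
      also have "\<dots> = (\<Sum>i = 0..m. of_nat (m choose i) * (deriv ^^ i) q z0 * (deriv ^^ (m-i)) w z0)"
        by (rule higher_deriv_mult[OF q w(1) S(1) z0])
      also have "\<dots> = 0"
        by (rule sum.neutral) (use less 3 in auto)
      finally show ?thesis .
    qed (use assms in auto)
  qed
qed

lemma linear_ode_unique:
  fixes q :: "complex \<Rightarrow> complex"
  assumes S: "open S" "connected S" and q: "q holomorphic_on S" and z0: "z0 \<in> S"
    and w: "w holomorphic_on S" "\<And>z. z \<in> S \<Longrightarrow> deriv (deriv w) z = q z * w z"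
    and v: "v holomorphic_on S" "\<And>z. z \<in> S \<Longrightarrow> deriv (deriv v) z = q z * v z"
    and eq: "w z0 = v z0" "deriv w z0 = deriv v z0" and z: "z \<in> S"
  shows "w z = v z"
proof -
  have d: "deriv (\<lambda>z. w z - v z) x = deriv w x - deriv v x" if "x \<in> S" for x
    using that w(1) v(1) S(1) by (intro deriv_diff) (auto simp: holomorphic_on_imp_differentiable_at)
  have hol': "deriv w holomorphic_on S" "deriv v holomorphic_on S"
    using w(1) v(1) S(1) by (auto intro: holomorphic_deriv)
  have "w z - v z = 0"
  proof (rule linear_ode_zero[OF S q z0, of "\<lambda>z. w z - v z"])
    show "(\<lambda>z. w z - v z) holomorphic_on S" using w v by (intro holomorphic_intros)
    fix x assume x: "x \<in> S"
    have "\<forall>\<^sub>F y in nhds x. deriv (\<lambda>z. w z - v z) y = deriv w y - deriv v y"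
      using eventually_nhds_in_open[OF S(1) x] by eventually_elim (rule d)
    then have "deriv (deriv (\<lambda>z. w z - v z)) x = deriv (\<lambda>y. deriv w y - deriv v y) x"
      by (rule deriv_cong_ev) simp
    also have "\<dots> = deriv (deriv w) x - deriv (deriv v) x"
      using hol' S(1) x by (intro deriv_diff) (auto simp: holomorphic_on_imp_differentiable_at)
    finally show "deriv (deriv (\<lambda>z. w z - v z)) x = q x * (w x - v x)"
      using w(2) v(2) x by (simp add: algebra_simps)
  qed (use eq d z z0 in auto)
  then show ?thesis by simp
qed

section \<open>Analytic continuation along a path\<close>

lemma eventually_nhds_transfer:
  assumes "\<forall>\<^sub>F z in nhds a. P z"
  shows "\<forall>\<^sub>F z in nhds a. \<forall>\<^sub>F w in nhds z. P w"
  using assms by (simp add: eventually_eventually)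

lemma eq_on_ball_if_eventually_eq:
  assumes "f holomorphic_on ball a r" "g holomorphic_on ball a r" "x \<in> ball a r"
    and "\<forall>\<^sub>F z in nhds x. f z = g z" and z: "z \<in> ball a r"
  shows "f z = g z"
proof -
  obtain U where U: "open U" "x \<in> U" "\<And>z. z \<in> U \<Longrightarrow> f z = g z"
    using assms(4) unfolding eventually_nhds by blast
  show ?thesis
    by (rule analytic_continuation_open[of "U \<inter> ball a r" "ball a r" f g])
       (use U assms in auto)
qed

lemma analytic_ball_subset:
  assumes "f analytic_on {a}" "open U" "a \<in> U"
  obtains r where "r > 0" "ball a r \<subseteq> U" "f holomorphic_on ball a r"
proof -
  obtain e where e: "e > 0" "f holomorphic_on ball a e" using assms(1) by (auto simp: analytic_at_ball)
  obtain d where d: "d > 0" "ball a d \<subseteq> U" using assms(2,3) open_contains_ball by blast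
  show ?thesis
    by (rule that[of "min e d"]) (use e d in \<open>auto intro: holomorphic_on_subset\<close>)
qed

lemma eventually_nhds_path:
  assumes "continuous_on I t" "c \<in> I" "\<forall>\<^sub>F z in nhds (t c). P z"
  shows "\<forall>\<^sub>F x in at c within I. \<forall>\<^sub>F z in nhds (t x). P z"
proof -
  have "(t \<longlongrightarrow> t c) (at c within I)" using assms(1,2) by (auto simp: continuous_on)
  from eventually_compose_filterlim[OF eventually_nhds_transfer[OF assms(3)] this] show ?thesis .
qed

lemma continued_along_subset:
  assumes "continued_along t I f" "J \<subseteq> I"
  shows "continued_along t J f"
  using assms filter_leD[OF at_le[OF assms(2)]] unfolding continued_along_def by (simp add: subset_iff)

lemma continued_along_local:
  assumes f: "continued_along t I f" and "continuous_on I t" "c \<in> I" "open U" "t c \<in> U"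
  obtains d where "d > 0"
    "\<And>x. x \<in> I \<Longrightarrow> dist x c < d \<Longrightarrow> t x \<in> U \<and> (\<forall>\<^sub>F z in nhds (t x). f x z = f c z)"
proof -
  have 1: "\<forall>\<^sub>F x in at c within I. t x \<in> U"
    using assms(2-5) by (auto simp: continuous_on intro: topological_tendstoD)
  have 2: "\<forall>\<^sub>F x in at c within I. \<forall>\<^sub>F z in nhds (t x). f x z = f c z"
    using f \<open>c \<in> I\<close> by (auto simp: continued_along_def)
  obtain d where "d > 0" "\<forall>x\<in>I. x \<noteq> c \<and> dist x c < d \<longrightarrow> t x \<in> U \<and> (\<forall>\<^sub>F z in nhds (t x). f x z = f c z)"
    using eventually_conj[OF 1 2] unfolding eventually_at by auto
  note d = this
  show ?thesis
  proof (rule that[OF d(1)])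
    fix x assume "x \<in> I" "dist x c < d"
    then show "t x \<in> U \<and> (\<forall>\<^sub>F z in nhds (t x). f x z = f c z)"
      using d(2) assms(5) by (cases "x = c") auto
  qed
qed

lemma continued_along_const:
  assumes "\<And>x. x \<in> I \<Longrightarrow> g analytic_on {t x}"
  shows "continued_along t I (\<lambda>_. g)"
  using assms by (simp add: continued_along_def)

text \<open>Agreement of the two elements is locally all or nothing. Near a parameter
  \<open>c\<close> both families are given by \<open>f c\<close> and \<open>g c\<close> on one ball,
  and by the identity theorem agreement near one point of the ball is agreement on all of it.
  Connectedness of \<open>I\<close> spreads this.\<close>

lemma continued_along_unique:
  assumes I: "connected I" and t: "continuous_on I t"
    and f: "continued_along t I f" and g: "continued_along t I g"
    and s: "s \<in> I" "\<forall>\<^sub>F z in nhds (t s). f s z = g s z" and "x \<in> I"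
  shows "\<forall>\<^sub>F z in nhds (t x). f x z = g x z"
proof (rule connected_induction_simple[OF I \<open>s \<in> I\<close> \<open>x \<in> I\<close>,
      where P = "\<lambda>x. \<forall>\<^sub>F z in nhds (t x). f x z = g x z"])
  fix c assume c: "c \<in> I"
  obtain r1 where r1: "r1 > 0" "f c holomorphic_on ball (t c) r1"
    using f c by (auto simp: continued_along_def analytic_at_ball)
  have "g c analytic_on {t c}" using g c by (auto simp: continued_along_def)
  from analytic_ball_subset[OF this open_ball, of "t c" r1] r1
  obtain r where r: "r > 0" "ball (t c) r \<subseteq> ball (t c) r1" "g c holomorphic_on ball (t c) r"
    by auto
  have fr: "f c holomorphic_on ball (t c) r" using r1 r by (auto intro: holomorphic_on_subset)
  obtain d1 where d1: "d1 > 0" "\<And>x. x \<in> I \<Longrightarrow> dist x c < d1 \<Longrightarrow> t x \<in> ball (t c) r \<and> (\<forall>\<^sub>F z in nhds (t x). f x z = f c z)"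
    using continued_along_local[OF f t c open_ball, of "t c" r] r(1) by auto
  obtain d2 where d2: "d2 > 0" "\<And>x. x \<in> I \<Longrightarrow> dist x c < d2 \<Longrightarrow> t x \<in> ball (t c) r \<and> (\<forall>\<^sub>F z in nhds (t x). g x z = g c z)"
    using continued_along_local[OF g t c open_ball, of "t c" r] r(1) by auto
  define T where "T = I \<inter> ball c (min d1 d2)"
  have openT: "openin (top_of_set I) T" "c \<in> T"
    using c d1(1) d2(1) by (simp_all add: T_def openin_open_Int)
  have "\<forall>\<^sub>F z in nhds (t y). f y z = g y z"
    if "x \<in> T" "y \<in> T" and eq: "\<forall>\<^sub>F z in nhds (t x). f x z = g x z" for x y
  proof -
    have x: "x \<in> I" "dist x c < d1" "dist x c < d2" and y: "y \<in> I" "dist y c < d1" "dist y c < d2"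
      using that by (auto simp: T_def dist_commute)
    have "\<forall>\<^sub>F z in nhds (t x). f c z = g c z"
      using eq conjunct2[OF d1(2)[OF x(1,2)]] conjunct2[OF d2(2)[OF x(1,3)]]
      by eventually_elim auto
    then have eq': "\<And>z. z \<in> ball (t c) r \<Longrightarrow> f c z = g c z"
      using eq_on_ball_if_eventually_eq[OF fr r(3)] d1(2)[OF x(1,2)] by blast
    have "\<forall>\<^sub>F z in nhds (t y). z \<in> ball (t c) r"
      using d1(2)[OF y(1,2)] by (intro eventually_nhds_in_open) auto
    then show ?thesis
      using conjunct2[OF d1(2)[OF y(1,2)]] conjunct2[OF d2(2)[OF y(1,3)]]
      by eventually_elim (use eq' in auto)
  qed
  then show "\<exists>T. openin (top_of_set I) T \<and> c \<in> T \<and>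
      (\<forall>x\<in>T. \<forall>y\<in>T. (\<forall>\<^sub>F z in nhds (t x). f x z = g x z) \<longrightarrow> (\<forall>\<^sub>F z in nhds (t y). f y z = g y z))"
    using openT by blast
qed (rule s(2))

text \<open>Since the pieces are closed, a parameter outside one of them is not a limit point of it,
  and the corresponding filter is trivial; only parameters in the overlap need the agreement of the
  two families.\<close>

lemma continued_along_glue:
  assumes f: "continued_along t A f" and g: "continued_along t B g"
    and cl: "closed A" "closed B" and t: "continuous_on (A \<union> B) t"
    and eq: "\<And>x. x \<in> A \<inter> B \<Longrightarrow> \<forall>\<^sub>F z in nhds (t x). f x z = g x z"
  shows "continued_along t (A \<union> B) (\<lambda>x. if x \<in> A then f x else g x)"
  unfolding continued_along_def
proof (intro ballI conjI)
  let ?F = "\<lambda>x. if x \<in> A then f x else g x"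
  fix c assume c: "c \<in> A \<union> B"
  show "?F c analytic_on {t c}" using c f g by (auto simp: continued_along_def)
  have FB: "\<forall>\<^sub>F z in nhds (t x). ?F x z = g x z" if "x \<in> B" for x
    using eq[of x] that by (cases "x \<in> A") auto
  have "\<forall>\<^sub>F x in at c within A. \<forall>\<^sub>F z in nhds (t x). ?F x z = ?F c z"
  proof (cases "c \<in> A")
    case True
    then have "\<forall>\<^sub>F x in at c within A. \<forall>\<^sub>F z in nhds (t x). f x z = f c z"
      using f by (auto simp: continued_along_def)
    moreover have "\<forall>\<^sub>F x in at c within A. x \<in> A" by (auto simp: eventually_at_filter)
    ultimately show ?thesis by eventually_elim (use True in auto)
  next
    case False
    then have "at c within A = bot"
      using cl(1) by (metis closed_limpt trivial_limit_within)
    then show ?thesis by simp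
  qed
  moreover have "\<forall>\<^sub>F x in at c within B. \<forall>\<^sub>F z in nhds (t x). ?F x z = ?F c z"
  proof (cases "c \<in> B")
    case True
    have "\<forall>\<^sub>F x in at c within B. \<forall>\<^sub>F z in nhds (t x). g x z = g c z"
      using g True by (auto simp: continued_along_def)
    moreover have "\<forall>\<^sub>F x in at c within B. \<forall>\<^sub>F z in nhds (t x). ?F c z = g c z"
      using continuous_on_subset[OF t] True FB[OF True]
      by (intro eventually_nhds_path[where P = "\<lambda>z. ?F c z = g c z" and I = B]) auto
    moreover have "\<forall>\<^sub>F x in at c within B. x \<in> B" by (auto simp: eventually_at_filter)
    ultimately show ?thesis
    proof eventually_elim
      case (elim x)
      from elim(1,2) FB[OF elim(3)] show ?case by eventually_elim simp
    qed
  next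
    case False
    then have "at c within B = bot"
      using cl(2) by (metis closed_limpt trivial_limit_within)
    then show ?thesis by simp
  qed
  ultimately show "\<forall>\<^sub>F x in at c within A \<union> B. \<forall>\<^sub>F z in nhds (t x). ?F x z = ?F c z"
    by (simp add: at_within_union eventually_sup)
qed

section \<open>Germs of solutions and their continuation\<close>

definition ode_germ :: "(complex \<Rightarrow> complex) \<Rightarrow> (complex \<Rightarrow> complex) \<Rightarrow> complex \<Rightarrow> bool" where
  "ode_germ q w a \<longleftrightarrow> w analytic_on {a} \<and> (\<forall>\<^sub>F z in nhds a. deriv (deriv w) z = q z * w z)"

lemma deriv_eventually_cong:
  assumes "\<forall>\<^sub>F z in nhds a. f z = g z"
  shows "\<forall>\<^sub>F z in nhds a. deriv f z = deriv g z"
  using eventually_nhds_transfer[OF assms] by eventually_elim (auto intro: deriv_cong_ev)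

lemma ode_germ_if_solution:
  assumes "open U" "w holomorphic_on U" "\<And>z. z \<in> U \<Longrightarrow> deriv (deriv w) z = q z * w z" "a \<in> U"
  shows "ode_germ q w a"
  unfolding ode_germ_def
proof
  show "w analytic_on {a}" using assms by (meson analytic_at)
  show "\<forall>\<^sub>F z in nhds a. deriv (deriv w) z = q z * w z"
    using eventually_nhds_in_open[OF assms(1,4)] by eventually_elim (rule assms(3))
qed

lemma ode_germ_unique:
  assumes "open \<Delta>" "q holomorphic_on \<Delta>" "a \<in> \<Delta>" "ode_germ q w a" "ode_germ q v a"
    and eq: "w a = v a" "deriv w a = deriv v a"
  shows "\<forall>\<^sub>F z in nhds a. w z = v z"
proof -
  obtain U where U: "open U" "a \<in> U" "\<And>z. z \<in> U \<Longrightarrow> deriv (deriv w) z = q z * w z"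
    "\<And>z. z \<in> U \<Longrightarrow> deriv (deriv v) z = q z * v z"
  proof -
    have "\<forall>\<^sub>F z in nhds a. deriv (deriv w) z = q z * w z \<and> deriv (deriv v) z = q z * v z"
      using assms(4,5) unfolding ode_germ_def by (simp add: eventually_conj)
    then show thesis using that unfolding eventually_nhds by blast
  qed
  obtain r1 where r1: "r1 > 0" "ball a r1 \<subseteq> \<Delta> \<inter> U" "w holomorphic_on ball a r1"
    using analytic_ball_subset[of w a "\<Delta> \<inter> U"] assms U unfolding ode_germ_def by auto
  obtain r where r: "r > 0" "ball a r \<subseteq> ball a r1" "v holomorphic_on ball a r"
    using analytic_ball_subset[of v a "ball a r1"] assms r1(1) unfolding ode_germ_def by auto
  have sub: "ball a r \<subseteq> U" and hol: "q holomorphic_on ball a r" "w holomorphic_on ball a r"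
    using r r1 assms(2) by (auto intro: holomorphic_on_subset)
  have "\<forall>\<^sub>F z in nhds a. z \<in> ball a r" using r by (intro eventually_nhds_in_open) auto
  then show ?thesis
  proof eventually_elim
    case (elim z)
    show ?case
      by (rule linear_ode_unique[OF open_ball connected_ball, of q a r a w v])
         (use sub U r(1,3) elim eq hol in auto)
  qed
qed

text \<open>For a linear equation the germ reaches the whole ball on which \<open>q\<close> is
  holomorphic. The radius does not depend on the germ, so a continuation never stalls inside the
  domain.\<close>

lemma ode_germ_extend:
  assumes q: "q holomorphic_on ball a r" and x: "x \<in> ball a r" and w: "ode_germ q w x"
  obtains v where "v holomorphic_on ball a r" "\<And>z. z \<in> ball a r \<Longrightarrow> deriv (deriv v) z = q z * v z"
    "\<forall>\<^sub>F z in nhds x. w z = v z"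
proof -
  obtain v where v: "v holomorphic_on ball a r" "v x = w x" "deriv v x = deriv w x"
    "\<And>z. z \<in> ball a r \<Longrightarrow> deriv (deriv v) z = q z * v z"
    using linear_ode_simply_connected[OF open_ball _ q x, of "w x" "deriv w x"]
      convex_imp_simply_connected[OF convex_ball] by blast
  have "\<forall>\<^sub>F z in nhds x. w z = v z"
    by (rule ode_germ_unique[OF open_ball q x w ode_germ_if_solution[OF open_ball v(1,4) x]])
       (use v in auto)
  then show ?thesis using that v by blast
qed

lemma ode_continuation_step:
  fixes t :: "real \<Rightarrow> complex"
  assumes f: "continued_along t (closed_segment s x) f"
    and fo: "\<And>c. c \<in> closed_segment s x \<Longrightarrow> ode_germ q (f c) (t c)"
    and v: "\<And>c. c \<in> closed_segment x y \<Longrightarrow> ode_germ q v (t c)"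
    and eq: "\<forall>\<^sub>F z in nhds (t x). f x z = v z"
    and t: "continuous_on (closed_segment s x \<union> closed_segment x y) t"
  obtains g where "continued_along t (closed_segment s y) g"
    "\<And>c. c \<in> closed_segment s y \<Longrightarrow> ode_germ q (g c) (t c)"
    "g s = f s" "\<forall>\<^sub>F z in nhds (t y). g y z = v z"
proof -
  let ?A = "closed_segment s x" and ?B = "closed_segment x y"
  define g where "g c = (if c \<in> ?A then f c else v)" for c
  have vB: "continued_along t ?B (\<lambda>_. v)"
    using v by (intro continued_along_const) (auto simp: ode_germ_def)
  \<comment> \<open>The segments overlap in more than \<open>x\<close> if \<open>y\<close> lies on
    the same side of \<open>x\<close> as \<open>s\<close>. The overlap is connected and contains
    \<open>x\<close>, so agreement at \<open>x\<close> spreads over it.\<close>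
  have eqAB: "\<forall>\<^sub>F z in nhds (t c). f c z = v z" if "c \<in> ?A \<inter> ?B" for c
  proof (rule continued_along_unique[of "?A \<inter> ?B" t f "\<lambda>_. v" x])
    show "connected (?A \<inter> ?B)" by (simp add: convex_Int convex_connected)
    show "continuous_on (?A \<inter> ?B) t" using t by (rule continuous_on_subset) auto
    show "continued_along t (?A \<inter> ?B) f" "continued_along t (?A \<inter> ?B) (\<lambda>_. v)"
      using f vB by (auto intro: continued_along_subset)
  qed (use eq that in auto)
  have g: "continued_along t (?A \<union> ?B) g"
    unfolding g_def using continued_along_glue[OF f vB closed_segment closed_segment t eqAB] by simp
  have sub: "closed_segment s y \<subseteq> ?A \<union> ?B"
    by (auto simp: closed_segment_eq_real_ivl split: if_splits)
  show ?thesis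
  proof (rule that[of g])
    show "continued_along t (closed_segment s y) g" using g sub by (rule continued_along_subset)
    show "ode_germ q (g c) (t c)" if "c \<in> closed_segment s y" for c
      using that sub fo v by (auto simp: g_def)
    show "g s = f s" by (simp add: g_def)
    show "\<forall>\<^sub>F z in nhds (t y). g y z = v z" using eqAB by (auto simp: g_def)
  qed
qed

text \<open>Connectedness first yields, for each parameter separately, a continuation on the segment
  from \<open>s\<close> to it. The interval need not be compact, so these separate continuations
  still have to be merged.\<close>

lemma ode_continuation:
  fixes t :: "real \<Rightarrow> complex"
  assumes \<Delta>: "open \<Delta>" "q holomorphic_on \<Delta>" and I: "connected I"
    and t: "continuous_on I t" "t ` I \<subseteq> \<Delta>" and s: "s \<in> I" and w: "ode_germ q w (t s)"
  obtains f where "continued_along t I f" "\<And>x. x \<in> I \<Longrightarrow> ode_germ q (f x) (t x)"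
    "\<forall>\<^sub>F z in nhds (t s). f s z = w z"
proof -
  have seg: "closed_segment x y \<subseteq> I" if "x \<in> I" "y \<in> I" for x y
    using I that by (simp add: closed_segment_subset connected_convex_1)
  define P where "P f x \<longleftrightarrow> continued_along t (closed_segment s x) f \<and>
    (\<forall>c\<in>closed_segment s x. ode_germ q (f c) (t c)) \<and> (\<forall>\<^sub>F z in nhds (t s). f s z = w z)" for f x
  have loc: "\<exists>r d. r > 0 \<and> d > 0 \<and> ball (t c) r \<subseteq> \<Delta> \<and> (\<forall>x\<in>I. dist x c < d \<longrightarrow> t x \<in> ball (t c) r)"
    if c: "c \<in> I" for c
  proof -
    have "t c \<in> \<Delta>" using t(2) c by blast
    then obtain r where r: "r > 0" "ball (t c) r \<subseteq> \<Delta>"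
      using \<Delta>(1) openE by blast
    moreover obtain d where "d > 0" "\<forall>x\<in>I. dist x c < d \<longrightarrow> dist (t x) (t c) < r"
      using t(1) c r(1) unfolding continuous_on_iff by blast
    ultimately show ?thesis by (intro exI[of _ r] exI[of _ d]) (auto simp: dist_commute)
  qed
  have step: "\<exists>g. P g y \<and> (\<forall>\<^sub>F z in nhds (t y). g y z = v z)"
    if "P f x" "x \<in> I" "y \<in> I" "\<forall>c\<in>closed_segment x y. ode_germ q v (t c)"
       "\<forall>\<^sub>F z in nhds (t x). f x z = v z" for f x y v
  proof -
    have "continuous_on (closed_segment s x \<union> closed_segment x y) t"
      using continuous_on_subset[OF t(1)] seg s that(2,3) by (meson Un_least)
    with that obtain g where g: "continued_along t (closed_segment s y) g"
      "\<And>c. c \<in> closed_segment s y \<Longrightarrow> ode_germ q (g c) (t c)"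
      "g s = f s" "\<forall>\<^sub>F z in nhds (t y). g y z = v z"
      using ode_continuation_step[where s = s and x = x and y = y and t = t and f = f and q = q and v = v]
      unfolding P_def by blast
    then show ?thesis using that(1) unfolding P_def by (intro exI[of _ g]) simp
  qed
  have dst: "dist z c < d" if "z \<in> closed_segment x y" "dist x c < d" "dist y c < d" for x y z c d :: real
    using that convex_ball[of c d] closed_segment_subset[of x "ball c d" y] by (auto simp: dist_commute)
  have ex: "\<exists>f. P f x" if "x \<in> I" for x
  proof (rule connected_induction_simple[OF I s that, where P = "\<lambda>x. \<exists>f. P f x"])
    show "\<exists>f. P f s"
      using w by (intro exI[of _ "\<lambda>_. w"]) (auto simp: P_def ode_germ_def continued_along_def)
    fix c assume c: "c \<in> I"
    obtain r d where rd: "r > 0" "d > 0" "ball (t c) r \<subseteq> \<Delta>" "\<forall>x\<in>I. dist x c < d \<longrightarrow> t x \<in> ball (t c) r"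
      using loc[OF c] by blast
    have "\<exists>g. P g y" if x: "x \<in> I \<inter> ball c d" and y: "y \<in> I \<inter> ball c d" and f: "P f x" for x y f
    proof -
      have q: "q holomorphic_on ball (t c) r" using \<Delta>(2) rd(3) by (rule holomorphic_on_subset)
      have "t x \<in> ball (t c) r" using rd x by (auto simp: dist_commute)
      moreover have "ode_germ q (f x) (t x)" using f by (auto simp: P_def)
      ultimately obtain v where v: "v holomorphic_on ball (t c) r"
        "\<And>z. z \<in> ball (t c) r \<Longrightarrow> deriv (deriv v) z = q z * v z" "\<forall>\<^sub>F z in nhds (t x). f x z = v z"
        using ode_germ_extend[OF q] by metis
      have "\<forall>z\<in>closed_segment x y. ode_germ q v (t z)"
        using dst[of _ x y c d] x y rd(4) seg[of x y]
        by (intro ballI ode_germ_if_solution[OF open_ball v(1,2)]) (auto simp: dist_commute)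
      from step[OF f _ _ this v(3)] x y show ?thesis by blast
    qed
    then show "\<exists>T. openin (top_of_set I) T \<and> c \<in> T \<and> (\<forall>x\<in>T. \<forall>y\<in>T. (\<exists>f. P f x) \<longrightarrow> (\<exists>f. P f y))"
      using c rd(2) openin_open_Int[OF open_ball, of I c d]
      by (intro exI[of _ "I \<inter> ball c d"] conjI ballI impI) (simp_all, blast)
  qed
  then obtain F where F: "\<And>x. x \<in> I \<Longrightarrow> P (F x) x" by metis
  \<comment> \<open>By uniqueness the families \<open>F x\<close> agree wherever they are all
    defined, so the diagonal, which takes from \<open>F x\<close> only its element at
    \<open>x\<close>, is itself a continuation.\<close>
  show ?thesis
  proof (rule that[of "\<lambda>x. F x x"])
    show "ode_germ q (F x x) (t x)" if "x \<in> I" for x using F[OF that] by (auto simp: P_def)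
    show "\<forall>\<^sub>F z in nhds (t s). F s s z = w z" using F[OF s] by (auto simp: P_def)
    show "continued_along t I (\<lambda>x. F x x)"
      unfolding continued_along_def
    proof (intro ballI conjI)
      fix c assume c: "c \<in> I"
      show "F c c analytic_on {t c}" using F[OF c] by (auto simp: P_def ode_germ_def)
      obtain r d where rd: "r > 0" "d > 0" "ball (t c) r \<subseteq> \<Delta>" "\<forall>x\<in>I. dist x c < d \<longrightarrow> t x \<in> ball (t c) r"
        using loc[OF c] by blast
      have q: "q holomorphic_on ball (t c) r" using \<Delta>(2) rd(3) by (rule holomorphic_on_subset)
      have "ode_germ q (F c c) (t c)" using F[OF c] by (auto simp: P_def)
      from ode_germ_extend[OF q _ this] rd(1) obtain v where v: "v holomorphic_on ball (t c) r"
        "\<And>z. z \<in> ball (t c) r \<Longrightarrow> deriv (deriv v) z = q z * v z" "\<forall>\<^sub>F z in nhds (t c). F c c z = v z"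
        by (metis centre_in_ball)
      have *: "\<forall>\<^sub>F z in nhds (t x). F x x z = v z" if x: "x \<in> I" "dist x c < d" for x
      proof -
        have "\<forall>z\<in>closed_segment c x. ode_germ q v (t z)"
          using dst[of _ c x c d] x c rd(2,4) seg[of c x]
          by (intro ballI ode_germ_if_solution[OF open_ball v(1,2)]) auto
        from step[OF F[OF c] c x(1) this v(3)] obtain g where
          g: "P g x" "\<forall>\<^sub>F z in nhds (t x). g x z = v z" by blast
        have "\<forall>\<^sub>F z in nhds (t x). F x x z = g x z"
        proof (rule continued_along_unique[of "closed_segment s x" t "F x" g s])
          show "continuous_on (closed_segment s x) t"
            using t(1) seg[OF s x(1)] by (rule continuous_on_subset)
          have "\<forall>\<^sub>F z in nhds (t s). F x s z = w z" "\<forall>\<^sub>F z in nhds (t s). g s z = w z"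
            using F[OF x(1)] g(1) by (auto simp: P_def)
          then show "\<forall>\<^sub>F z in nhds (t s). F x s z = g s z" by eventually_elim simp
        qed (use F[OF x(1)] g(1) in \<open>auto simp: P_def\<close>)
        then show ?thesis using g(2) by eventually_elim simp
      qed
      have "\<forall>\<^sub>F x in at c within I. x \<in> I \<and> dist x c < d"
        using rd(2) by (auto simp: eventually_at intro!: exI[of _ d])
      moreover have "\<forall>\<^sub>F x in at c within I. \<forall>\<^sub>F z in nhds (t x). F c c z = v z"
        by (rule eventually_nhds_path[OF t(1) c v(3)])
      ultimately show "\<forall>\<^sub>F x in at c within I. \<forall>\<^sub>F z in nhds (t x). F x x z = F c c z"
      proof eventually_elim
        case (elim x)
        from * elim have "\<forall>\<^sub>F z in nhds (t x). F x x z = v z" by blast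
        with elim(2) show ?case by eventually_elim simp
      qed
    qed
  qed
qed

lemma continued_along_deriv:
  assumes "continued_along t I f"
  shows "continued_along t I (\<lambda>x. deriv (f x))"
  unfolding continued_along_def
proof (intro ballI conjI)
  fix c assume c: "c \<in> I"
  show "deriv (f c) analytic_on {t c}"
    using assms c by (auto simp: continued_along_def intro: analytic_deriv)
  have "\<forall>\<^sub>F x in at c within I. \<forall>\<^sub>F z in nhds (t x). f x z = f c z"
    using assms c by (auto simp: continued_along_def)
  then show "\<forall>\<^sub>F x in at c within I. \<forall>\<^sub>F z in nhds (t x). deriv (f x) z = deriv (f c) z"
    by eventually_elim (rule deriv_eventually_cong)
qed

text \<open>The derivatives of the elements form a continuation, and so does the constant family
  \<open>g\<close>; they agree at \<open>s\<close>, hence everywhere by uniqueness.\<close>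

lemma continued_along_antiderivative:
  assumes \<Delta>: "open \<Delta>" "g holomorphic_on \<Delta>" and I: "connected I"
    and t: "continuous_on I t" "t ` I \<subseteq> \<Delta>" and f: "continued_along t I f"
    and s: "s \<in> I" "\<forall>\<^sub>F z in nhds (t s). (f s has_field_derivative g z) (at z)" and x: "x \<in> I"
  shows "\<forall>\<^sub>F z in nhds (t x). (f x has_field_derivative g z) (at z)"
proof -
  have "\<forall>\<^sub>F z in nhds (t x). deriv (f x) z = g z"
  proof (rule continued_along_unique[OF I t(1) continued_along_deriv[OF f] _ s(1) _ x])
    show "continued_along t I (\<lambda>_. g)"
    proof (rule continued_along_const)
      fix y assume "y \<in> I"
      then have "t y \<in> \<Delta>" using t(2) by blast
      then show "g analytic_on {t y}" using \<Delta> analytic_at by blast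
    qed
    show "\<forall>\<^sub>F z in nhds (t s). deriv (f s) z = g z"
      using s(2) by eventually_elim (rule DERIV_imp_deriv)
  qed
  moreover have "\<forall>\<^sub>F z in nhds (t x). (f x has_field_derivative deriv (f x) z) (at z)"
  proof -
    obtain r where r: "r > 0" "f x holomorphic_on ball (t x) r"
      using f x by (auto simp: continued_along_def analytic_at_ball)
    have "\<forall>\<^sub>F z in nhds (t x). z \<in> ball (t x) r" using r by (intro eventually_nhds_in_open) auto
    then show ?thesis
      by eventually_elim (rule holomorphic_derivI[OF r(2) open_ball])
  qed
  ultimately show ?thesis by eventually_elim simp
qed

text \<open>Near \<open>c\<close> the element \<open>f x\<close> may be replaced by the fixed
  function \<open>f c\<close> when evaluated at \<open>t x\<close>, which reduces the claim to the
  ordinary chain rule.\<close>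

lemma continued_along_has_vector_derivative:
  assumes f: "continued_along t I f" and "c \<in> J" "J \<subseteq> I"
    and t: "(t has_vector_derivative t') (at c within J)"
  shows "((\<lambda>x. f x (t x)) has_vector_derivative (t' * deriv (f c) (t c))) (at c within J)"
proof -
  have "f c analytic_on {t c}" using assms by (auto simp: continued_along_def)
  then have "f c field_differentiable at (t c)"
    by (rule analytic_on_imp_differentiable_at) simp
  then have "(f c has_field_derivative deriv (f c) (t c)) (at (t c) within t ` J)"
    by (rule has_field_derivative_at_within[OF iffD2[OF DERIV_deriv_iff_field_differentiable]])
  from field_vector_diff_chain_within[OF t this]
  have 1: "((\<lambda>x. f c (t x)) has_vector_derivative (t' * deriv (f c) (t c))) (at c within J)"
    by (simp add: o_def)
  have "\<forall>\<^sub>F x in at c within J. \<forall>\<^sub>F z in nhds (t x). f x z = f c z"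
    using continued_along_subset[OF f assms(3)] assms(2) by (auto simp: continued_along_def)
  then have "\<forall>\<^sub>F x in at c within J. f c (t x) = f x (t x)"
    by eventually_elim (auto dest: eventually_nhds_x_imp_x)
  then show ?thesis
    using 1 assms(2) unfolding has_vector_derivative_def
    by (simp add: has_derivative_transform_eventually[where f = "\<lambda>x. f c (t x)"])
qed

section \<open>Chains of arcs and comparison\<close>

lemma R2_arc_subset:
  assumes "R2_arc t I" "J \<subseteq> I"
  shows "R2_arc t J"
proof -
  obtain t' t'' where "\<forall>\<tau>\<in>I. (t has_vector_derivative t' \<tau>) (at \<tau> within I)
      \<and> (t' has_vector_derivative t'' \<tau>) (at \<tau> within I) \<and> t' \<tau> \<noteq> 0" "continuous_on I t''"
    using assms(1) unfolding R2_arc_def by blast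
  then show ?thesis
    unfolding R2_arc_def using assms(2)
    by (intro exI[of _ t'] exI[of _ t''])
       (auto intro: has_vector_derivative_within_subset continuous_on_subset)
qed

lemma R2_arc_continuous: "R2_arc t I \<Longrightarrow> continuous_on I t"
  unfolding R2_arc_def by (blast intro: continuous_on_vector_derivative)

lemma R2_arc_derivative:
  assumes "R2_arc t {a..b}"
  obtains t' where "continuous_on {a..b} t'"
    "\<And>x. x \<in> {a<..<b} \<Longrightarrow> (t has_vector_derivative t' x) (at x)"
    "\<And>x. x \<in> {a<..<b} \<Longrightarrow> vector_derivative t (at x) = t' x"
proof -
  obtain t' t'' where t: "\<And>\<tau>. \<tau> \<in> {a..b} \<Longrightarrow> (t has_vector_derivative t' \<tau>) (at \<tau> within {a..b})"
      "\<And>\<tau>. \<tau> \<in> {a..b} \<Longrightarrow> (t' has_vector_derivative t'' \<tau>) (at \<tau> within {a..b})"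
    using assms(1) unfolding R2_arc_def by blast
  have d: "(t has_vector_derivative t' x) (at x)" if "x \<in> {a<..<b}" for x
    using t(1)[of x] that by (simp add: at_within_Icc_at)
  show ?thesis
  proof (rule that[of t'])
    show "continuous_on {a..b} t'" using t(2) by (blast intro: continuous_on_vector_derivative)
  qed (use d vector_derivative_at in blast)+
qed

lemma R2_chain_closed: "R2_chain t I \<Longrightarrow> closed I"
  by (induction rule: R2_chain.induct) auto

lemma R2_chain_continuous: "R2_chain t I \<Longrightarrow> continuous_on I t"
proof (induction rule: R2_chain.induct)
  case (snoc I b c)
  then show ?case
    by (intro continuous_on_closed_Un) (auto dest: R2_chain_closed R2_arc_continuous)
qed (auto intro: R2_arc_continuous)

text \<open>Induction over the chain, by which any reflexive and transitive relation between
  parameters has to be checked only across a single smooth arc. Junctions, where the curve may have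
  corners, enter only as end points.\<close>

lemma R2_chain_propagate:
  assumes "R2_chain t I"
    and refl: "\<And>x. P x x"
    and trans: "\<And>a b c. P a b \<Longrightarrow> P b c \<Longrightarrow> P a c"
    and arc: "\<And>a b. a < b \<Longrightarrow> {a..b} \<subseteq> I \<Longrightarrow> R2_arc t {a..b} \<Longrightarrow> P a b"
    and "x \<in> I" "y \<in> I" "x \<le> y"
  shows "P x y"
  using assms(1) arc assms(5-7)
proof (induction arbitrary: x y rule: R2_chain.induct)
  case (point a)
  then show ?case by (simp add: refl)
next
  case (ray b)
  show ?case
  proof (cases "x = y")
    case False
    then have "x < y" "{x..y} \<subseteq> {..b}" using ray by auto
    then show ?thesis using ray.prems(1) R2_arc_subset[OF ray.hyps] by blast
  qed (simp add: refl)
next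
  case (snoc I b c)
  have late: "P x y" if "x \<in> {b..c}" "y \<in> {b..c}" "x \<le> y" for x y
  proof (cases "x = y")
    case False
    then have "x < y" "{x..y} \<subseteq> {b..c}" using that by auto
    then show ?thesis using snoc.prems(1) R2_arc_subset[OF snoc.hyps(5)] by blast
  qed (simp add: refl)
  have early: "P x y" if "x \<in> I" "y \<in> I" "x \<le> y" for x y
    using snoc.IH[of x y] snoc.prems(1) that by blast
  consider "x \<in> I" "y \<in> I" | "x \<in> {b..c}" "y \<in> {b..c}" | "x \<in> I" "y \<in> {b..c}"
    using snoc.prems(2-4) snoc.hyps(3) by force
  then show ?case
  proof cases
    case 3
    then have "P x b" "P b y" using early[of x b] late[of b y] snoc.hyps(2-4) by auto
    then show ?thesis by (rule trans)
  qed (use early late snoc.prems in auto)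
qed

section \<open>Arc-length integrals as functions of the parameter\<close>

definition arc_primitive :: "(real \<Rightarrow> complex) \<Rightarrow> real set \<Rightarrow> (complex \<Rightarrow> complex) \<Rightarrow> (real \<Rightarrow> real) \<Rightarrow> bool" where
  "arc_primitive t I h F \<longleftrightarrow> (\<forall>x\<in>I. 0 \<le> F x) \<and>
     (\<forall>a b. a < b \<longrightarrow> {a..b} \<subseteq> I \<longrightarrow> R2_arc t {a..b} \<longrightarrow>
        continuous_on {a..b} F \<and> (\<forall>x\<in>{a<..<b}. (F has_real_derivative arc_density t h x) (at x)))"

lemma arc_density_nonneg: "0 \<le> arc_density t h x"
  by (simp add: arc_density_def)

text \<open>A nonnegative integrable density is absolutely integrable, and absolute integrability
  passes to measurable subsets.\<close>

lemma arc_integrable_subset: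
  assumes "arc_integrable t I h" "J \<subseteq> I" "closed J"
  shows "arc_integrable t J h"
proof -
  have "arc_density t h absolutely_integrable_on I"
    using assms(1) by (auto simp: arc_integrable_def arc_density_nonneg intro: nonnegative_absolutely_integrable_1)
  then have "arc_density t h absolutely_integrable_on J"
    using assms(2,3) by (intro set_integrable_subset[of lebesgue I _ J]) auto
  then show ?thesis
    by (simp add: arc_integrable_def absolutely_integrable_on_def)
qed

text \<open>Differentiability is claimed only inside arcs: at a junction the two-sided derivative in
  \<open>arc_density\<close> need not exist, but the integral stays continuous there.\<close>

lemma arc_primitive_integral:
  assumes I: "closed I" and h: "continuous_on (t ` I) h" and int: "arc_integrable t I h"
  shows "arc_primitive t I h (\<lambda>x. arc_integral t (I \<inter> {..x}) h)"
  unfolding arc_primitive_def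
proof (intro conjI ballI allI impI)
  let ?d = "arc_density t h" and ?F = "\<lambda>x. arc_integral t (I \<inter> {..x}) h"
  fix x show "0 \<le> ?F x"
    unfolding arc_integral_def by (rule Henstock_Kurzweil_Integration.integral_nonneg)
      (use arc_integrable_subset[OF int, of "I \<inter> {..x}"] I in
        \<open>auto simp: arc_density_nonneg arc_integrable_def intro: closed_Int\<close>)
next
  let ?d = "arc_density t h" and ?F = "\<lambda>x. arc_integral t (I \<inter> {..x}) h"
  fix a b :: real
  assume ab: "a < b" "{a..b} \<subseteq> I" and arc: "R2_arc t {a..b}"
  obtain t' where t': "continuous_on {a..b} t'"
    "\<And>x. x \<in> {a<..<b} \<Longrightarrow> vector_derivative t (at x) = t' x"
    using R2_arc_derivative[OF arc] by metis
  \<comment> \<open>This extends the density continuously to the end points of the arc. The two can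
    differ only at \<open>a\<close> and \<open>b\<close>, a null set, so the fundamental theorem may
    be applied to \<open>g\<close>.\<close>
  define g where "g x = norm (h (t x)) * norm (t' x)" for x
  have g: "continuous_on {a..b} g"
    unfolding g_def
    by (intro continuous_intros t'(1) continuous_on_compose2[OF h R2_arc_continuous[OF arc]]) (use ab in auto)
  have dg: "?d x = g x" if "x \<in> {a<..<b}" for x
    using t'(2)[OF that] by (simp add: arc_density_def g_def)
  have F: "?F x = ?F a + integral {a..x} g" if x: "x \<in> {a..b}" for x
  proof -
    have "?d integrable_on (I \<inter> {..a})" "?d integrable_on {a..x}"
      using arc_integrable_subset[OF int, of "I \<inter> {..a}"] arc_integrable_subset[OF int, of "{a..x}"] I x ab
      by (auto simp: arc_integrable_def closed_Int subset_iff)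
    then have hi: "(?d has_integral (integral (I \<inter> {..a}) ?d + integral {a..x} ?d)) ((I \<inter> {..a}) \<union> {a..x})"
      by (intro has_integral_Un integrable_integral) (auto intro: negligible_subset[of "{a}"])
    have "{a..x} \<subseteq> I" by (rule subset_trans[OF _ ab(2)]) (use x in auto)
    moreover have "{..x} = {..a} \<union> {a..x}" using x by auto
    ultimately have un: "(I \<inter> {..a}) \<union> {a..x} = I \<inter> {..x}" by blast
    have sp: "integral {a..x} ?d = integral {a..x} g"
      by (rule integral_spike[of "{a,b}"]) (use dg x in auto)
    show ?thesis unfolding arc_integral_def using integral_unique[OF hi] unfolding un sp .
  qed
  have D: "((\<lambda>x. ?F a + integral {a..x} g) has_real_derivative g x) (at x within {a..b})"
    if "x \<in> {a..b}" for x
    by (rule derivative_eq_intros refl integral_has_real_derivative[OF g that] | simp)+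
  have D': "(?F has_real_derivative g x) (at x within {a..b})" if "x \<in> {a..b}" for x
    using has_derivative_transform[OF that F D[OF that, unfolded has_field_derivative_def]]
    by (simp add: has_field_derivative_def)
  show "continuous_on {a..b} ?F" using D' by (rule DERIV_continuous_on)
  fix x assume x: "x \<in> {a<..<b}"
  then show "(?F has_real_derivative ?d x) (at x)"
    using D'[of x] dg[OF x] by (simp add: at_within_Icc_at)
qed

lemma arc_integral_tendsto_at_bot:
  assumes "arc_integrable t {..b} h"
  shows "((\<lambda>x. arc_integral t ({..b} \<inter> {..x}) h) \<longlongrightarrow> 0) at_bot"
proof -
  let ?d = "arc_density t h"
  have abs: "?d absolutely_integrable_on {..b}"
    using assms by (auto simp: arc_integrable_def arc_density_nonneg intro: nonnegative_absolutely_integrable_1)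
  have "((\<lambda>a. set_lebesgue_integral lebesgue {a..b} ?d) \<longlongrightarrow> set_lebesgue_integral lebesgue {..b} ?d) at_bot"
    by (rule tendsto_set_lebesgue_integral_at_bot[OF _ abs]) auto
  then have 1: "((\<lambda>a. set_lebesgue_integral lebesgue {..b} ?d - set_lebesgue_integral lebesgue {a..b} ?d) \<longlongrightarrow> 0) at_bot"
    by (auto intro: tendsto_eq_intros)
  have eq: "set_lebesgue_integral lebesgue {..b} ?d - set_lebesgue_integral lebesgue {a..b} ?d
       = arc_integral t ({..b} \<inter> {..a}) h" if "a \<le> b" for a
  proof -
    have i: "?d absolutely_integrable_on {a..b}" "?d absolutely_integrable_on {..a}"
      by (rule set_integrable_subset[OF abs]; use that in auto)+
    then have "(?d has_integral (integral {..a} ?d + integral {a..b} ?d)) ({..a} \<union> {a..b})"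
      by (intro has_integral_Un integrable_integral)
         (auto simp: absolutely_integrable_on_def intro: negligible_subset[of "{a}"])
    moreover have "{..a} \<union> {a..b} = {..b}" "{..b} \<inter> {..a} = {..a}" using that by auto
    ultimately show ?thesis
      using i abs by (simp add: set_lebesgue_integral_eq_integral arc_integral_def integral_unique)
  qed
  show ?thesis
    by (rule Lim_transform_eventually[OF 1])
       (use eq in \<open>auto simp: eventually_at_bot_linorder intro!: exI[of _ b]\<close>)
qed

text \<open>The curves need not agree at \<open>b\<close>: it is a null set, and the two-sided
  derivative there depends on the curve beyond \<open>b\<close> anyway. Below \<open>b\<close>
  agreement holds in neighbourhoods, so the derivatives coincide.\<close>

lemma arc_integrable_cong_path:
  assumes "\<And>x. x < b \<Longrightarrow> t x = s x"
  shows "arc_integrable t {..b} h \<longleftrightarrow> arc_integrable s {..b} h"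
proof -
  have "arc_density t h x = arc_density s h x" if "x \<in> {..b} - {b}" for x
  proof -
    have x: "x < b" using that by auto
    have "\<forall>\<^sub>F y in nhds x. y < b" using x by (simp add: eventually_nhds_in_open[of "{..<b}"] flip: lessThan_iff)
    then have "\<forall>\<^sub>F y in nhds x. y \<in> UNIV \<longrightarrow> t y = s y" by eventually_elim (use assms in simp)
    then have "vector_derivative t (at x) = vector_derivative s (at x)"
      by (rule vector_derivative_cong_eq) simp_all
    then show ?thesis using assms[OF x] by (simp add: arc_density_def)
  qed
  from has_integral_spike_eq[of "{b}" "{..b}" "arc_density s h" "arc_density t h"] this
  have "(arc_density t h has_integral y) {..b} \<longleftrightarrow> (arc_density s h has_integral y) {..b}" for y
    by auto
  then show ?thesis
    unfolding arc_integrable_def integrable_on_def by simp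
qed

text \<open>First-exit argument: let \<open>m\<close> be the first parameter at which
  \<open>max (norm (G m)) (norm (H m))\<close> reaches the barrier \<open>X m / 2\<close>. Before
  \<open>m\<close> the barrier bounds \<open>R\<close>, and integrating from \<open>a\<close> to
  \<open>m\<close> gives strict inequalities at \<open>m\<close>, a contradiction. The offset
  \<open>c > 0\<close> in the barrier leaves room for a strict inequality at the start.\<close>

lemma comparison_on_arc:
  fixes G H \<Theta> P R :: "real \<Rightarrow> complex" and A B A' B' :: "real \<Rightarrow> real" and c :: real
  defines "X \<equiv> \<lambda>x. (c + A x) * exp (A x + B x)"
  assumes ab: "a < b"
    and cont: "continuous_on {a..b} G" "continuous_on {a..b} H" "continuous_on {a..b} \<Theta>"
      "continuous_on {a..b} A" "continuous_on {a..b} B"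
    and G: "\<And>x. x \<in> {a<..<b} \<Longrightarrow> (G has_vector_derivative R x / 2) (at x)"
    and H: "\<And>x. x \<in> {a<..<b} \<Longrightarrow> (H has_vector_derivative - 2 * P x * H x - R x / 2) (at x)"
    and \<Theta>: "\<And>x. x \<in> {a<..<b} \<Longrightarrow> (\<Theta> has_vector_derivative P x) (at x)"
    and A: "\<And>x. x \<in> {a<..<b} \<Longrightarrow> (A has_real_derivative A' x) (at x)"
    and B: "\<And>x. x \<in> {a<..<b} \<Longrightarrow> (B has_real_derivative B' x) (at x)"
    and R: "\<And>x. x \<in> {a<..<b} \<Longrightarrow> norm (R x) \<le> A' x * (1 + norm (G x) + norm (H x)) + 2 * B' x * norm (H x)"
    and nonneg: "\<And>x. x \<in> {a..b} \<Longrightarrow> 0 \<le> A x" "\<And>x. x \<in> {a..b} \<Longrightarrow> 0 \<le> B x"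
      "\<And>x. x \<in> {a<..<b} \<Longrightarrow> 0 \<le> A' x" "\<And>x. x \<in> {a<..<b} \<Longrightarrow> 0 \<le> B' x" "c > 0"
    and mono: "\<And>x y. x \<in> {a..b} \<Longrightarrow> y \<in> {a..b} \<Longrightarrow> x \<le> y \<Longrightarrow> Re (\<Theta> x) \<le> Re (\<Theta> y)"
    and start: "norm (G a) < X a / 2" "norm (H a) < X a / 2"
  shows "norm (G b) < X b / 2 \<and> norm (H b) < X b / 2"
proof (rule ccontr)
  assume neg: "\<not> ?thesis"
  define D where "D x = max (norm (G x)) (norm (H x)) - X x / 2" for x
  have Xc: "continuous_on {a..b} X" unfolding X_def by (intro continuous_intros cont)
  have Dc: "continuous_on {a..b} D" unfolding D_def by (intro continuous_intros cont Xc) auto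
  define K where "K = {x \<in> {a..b}. 0 \<le> D x}"
  have "closed K"
    unfolding K_def using continuous_closed_preimage[OF Dc closed_atLeastAtMost closed_atLeast, of 0]
    by (simp add: vimage_def Int_def)
  moreover have bdd: "bdd_below K" unfolding K_def by (rule bdd_belowI[of _ a]) auto
  moreover have "b \<in> K" using neg ab by (auto simp: K_def D_def)
  ultimately have m: "Inf K \<in> K" using closed_contains_Inf by blast
  define m where "m = Inf K"
  have mK: "m \<in> {a..b}" "0 \<le> D m" using m by (auto simp: m_def K_def)
  have "D a < 0" using start by (simp add: D_def)
  then have am: "a < m" using mK by (cases "m = a") auto
  have below: "norm (G x) < X x / 2 \<and> norm (H x) < X x / 2" if "x \<in> {a..<m}" for x
  proof -
    have "x \<notin> K" using that cInf_lower[OF _ bdd, of x] by (auto simp: m_def)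
    then show ?thesis using that mK(1) by (auto simp: K_def D_def)
  qed
  \<comment> \<open>The derivative of the barrier equals A' exp(A + B) + (A' + B') X. As exp(A + B)
    is at least 1, it dominates A' (1 + X) + B' X, which bounds \<open>norm (R x)\<close> as long as
    \<open>G\<close> and \<open>H\<close> stay below X / 2.\<close>
  define X' where "X' x = A' x * exp (A x + B x) + (c + A x) * (exp (A x + B x) * (A' x + B' x))" for x
  have Xd: "(X has_real_derivative X' x) (at x)" if "x \<in> {a<..<b}" for x
    unfolding X_def X'_def by (rule derivative_eq_intros refl A[OF that] B[OF that] | simp)+
  have RX: "norm (R x) \<le> X' x" if x: "x \<in> {a<..<m}" for x
  proof -
    have x': "x \<in> {a<..<b}" using x mK by auto
    have lt: "norm (G x) \<le> X x / 2" "norm (H x) \<le> X x / 2" using below[of x] x by auto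
    have "norm (R x) \<le> A' x * (1 + norm (G x) + norm (H x)) + 2 * B' x * norm (H x)" by (rule R[OF x'])
    also have "\<dots> \<le> A' x * (1 + X x / 2 + X x / 2) + 2 * B' x * (X x / 2)"
      using lt nonneg(3,4)[OF x'] by (intro add_mono mult_left_mono) auto
    also have "\<dots> = A' x * 1 + (A' x + B' x) * X x" by (simp add: algebra_simps)
    also have "\<dots> \<le> A' x * exp (A x + B x) + (A' x + B' x) * X x"
      using nonneg x' by (intro add_mono mult_left_mono) auto
    also have "\<dots> = X' x" by (simp add: X'_def X_def)
    finally show ?thesis .
  qed
  have sub: "{a..m} \<subseteq> {a..b}" using mK by auto
  have "norm (G m - G a) \<le> X m / 2 - X a / 2"
  proof (rule differentiable_bound_general[OF am, of G "\<lambda>x. X x / 2" "\<lambda>x. R x / 2" "\<lambda>x. X' x / 2"])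
    show "continuous_on {a..m} G" "continuous_on {a..m} (\<lambda>x. X x / 2)"
      using cont(1) Xc sub by (auto intro!: continuous_intros intro: continuous_on_subset)
    fix x assume x: "a < x" "x < m"
    then have xb: "x \<in> {a<..<b}" using mK by auto
    show "(G has_vector_derivative R x / 2) (at x)" by (rule G[OF xb])
    have "((\<lambda>x. X x / 2) has_real_derivative X' x / 2) (at x)"
      by (rule derivative_eq_intros refl Xd[OF xb] | simp)+
    then show "((\<lambda>x. X x / 2) has_vector_derivative X' x / 2) (at x)"
      by (simp add: has_real_derivative_iff_has_vector_derivative)
    show "norm (R x / 2) \<le> X' x / 2" using RX[of x] x by (simp add: norm_divide)
  qed
  then have Gm: "norm (G m) < X m / 2"
    using start(1) norm_triangle_ineq2[of "G m" "G a"] by linarith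
  \<comment> \<open>The integrating factor exp(2 \<Theta>) absorbs the term - 2 P H. Monotonicity
    bounds its modulus on \<open>{a..m}\<close> by the value \<open>E\<close> at \<open>m\<close>,
    so it can be divided out there without loss.\<close>
  define E where "E = exp (2 * Re (\<Theta> m))"
  have E0: "E > 0" by (simp add: E_def)
  have nE: "norm (exp (2 * \<Theta> x)) \<le> E" if "x \<in> {a..m}" for x
    using mono[of x m] that mK by (simp add: E_def)
  have Em: "norm (exp (2 * \<Theta> m)) = E" by (simp add: E_def)
  have "norm (H m * exp (2 * \<Theta> m) - H a * exp (2 * \<Theta> a)) \<le> E * X m / 2 - E * X a / 2"
  proof (rule differentiable_bound_general[OF am, of "\<lambda>x. H x * exp (2 * \<Theta> x)" "\<lambda>x. E * X x / 2"
        "\<lambda>x. - (R x / 2) * exp (2 * \<Theta> x)" "\<lambda>x. E * X' x / 2"])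
    show "continuous_on {a..m} (\<lambda>x. H x * exp (2 * \<Theta> x))" "continuous_on {a..m} (\<lambda>x. E * X x / 2)"
      using cont(2,3) Xc sub by (auto intro!: continuous_intros intro: continuous_on_subset)
    fix x assume x: "a < x" "x < m"
    then have xb: "x \<in> {a<..<b}" using mK by auto
    have "((\<lambda>x. exp (2 * \<Theta> x)) has_vector_derivative (2 * P x) * exp (2 * \<Theta> x)) (at x)"
      using field_vector_diff_chain_at[OF has_vector_derivative_mult_right[OF \<Theta>[OF xb], of 2], of exp] DERIV_exp
      by (auto simp: o_def)
    from has_vector_derivative_mult[OF H[OF xb] this]
    show "((\<lambda>x. H x * exp (2 * \<Theta> x)) has_vector_derivative - (R x / 2) * exp (2 * \<Theta> x)) (at x)"
      by (simp add: algebra_simps)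
    have "((\<lambda>x. E * X x / 2) has_real_derivative E * X' x / 2) (at x)"
      by (rule derivative_eq_intros refl Xd[OF xb] | simp)+
    then show "((\<lambda>x. E * X x / 2) has_vector_derivative E * X' x / 2) (at x)"
      by (simp add: has_real_derivative_iff_has_vector_derivative)
    have "norm (R x) * norm (exp (2 * \<Theta> x)) \<le> X' x * E"
      using RX[of x] nE[of x] x by (intro mult_mono) (auto intro: order_trans[OF norm_ge_zero])
    then show "norm (- (R x / 2) * exp (2 * \<Theta> x)) \<le> E * X' x / 2"
      by (simp add: norm_mult norm_divide mult.commute)
  qed
  then have "norm (H m) * E \<le> norm (H a) * norm (exp (2 * \<Theta> a)) + E * X m / 2 - E * X a / 2"
    using norm_triangle_ineq2[of "H m * exp (2 * \<Theta> m)" "H a * exp (2 * \<Theta> a)"] Em by (simp add: norm_mult)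
  also have "norm (H a) * norm (exp (2 * \<Theta> a)) \<le> norm (H a) * E"
    using nE[of a] am by (intro mult_left_mono) auto
  also have "norm (H a) * E < X a / 2 * E" using start(2) E0 by simp
  finally have "norm (H m) * E < X m / 2 * E" by (simp add: mult.commute)
  then have "norm (H m) < X m / 2" using E0 by simp
  with Gm mK(2) show False by (simp add: D_def)
qed

section \<open>The transformed equation\<close>

lemma analytic_at_if_eventually_derivative:
  assumes "\<forall>\<^sub>F z in nhds a. (f has_field_derivative f' z) (at z)"
  shows "f analytic_on {a}"
proof -
  obtain U where "open U" "a \<in> U" "\<And>z. z \<in> U \<Longrightarrow> (f has_field_derivative f' z) (at z)"
    using assms unfolding eventually_nhds by blast
  then show ?thesis using analytic_at holomorphic_on_open by blast
qed

lemma eventually_analytic_at: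
  assumes "f analytic_on {a}"
  shows "\<forall>\<^sub>F z in nhds a. f analytic_on {z}"
proof -
  obtain r where r: "r > 0" "f holomorphic_on ball a r"
    using assms by (auto simp: analytic_at_ball)
  then have "\<forall>\<^sub>F z in nhds a. z \<in> ball a r" by (intro eventually_nhds_in_open) auto
  then show ?thesis by eventually_elim (use r(2) analytic_at in blast)
qed

lemma analytic_at_derivative:
  "f analytic_on {z} \<Longrightarrow> (f has_field_derivative deriv f z) (at z)"
  by (simp add: DERIV_deriv_iff_field_differentiable analytic_on_imp_differentiable_at)

text \<open>Of the sign only \<open>\<sigma> * \<sigma> = 1\<close> is assumed, so both solutions
  are treated at once.\<close>

locale liouville_green =
  fixes \<Delta> :: "complex set" and \<phi> \<psi> :: "complex \<Rightarrow> complex" and n :: nat and u \<sigma> :: complex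
  assumes open_dom: "open \<Delta>" and hol_phi: "\<phi> holomorphic_on \<Delta>" and hol_psi: "\<psi> holomorphic_on \<Delta>"
    and n_pos: "n \<ge> 1" and u_nz: "u \<noteq> 0" and sigma_sq: "\<sigma> * \<sigma> = 1"
begin

lemma sigma_nz: "\<sigma> \<noteq> 0" and norm_sigma: "norm \<sigma> = 1"
  using sigma_sq by (auto simp: square_eq_1_iff)

definition q :: "complex \<Rightarrow> complex" where "q z = u\<^sup>2 + u * \<phi> z + \<psi> z"
definition p :: "complex \<Rightarrow> complex" where "p z = \<sigma> * (u + \<phi> z / 2)"
definition F :: "nat \<Rightarrow> complex \<Rightarrow> complex" where "F s = LG_F \<sigma> \<phi> \<psi> s"
definition T :: "complex \<Rightarrow> complex" where "T = LG_T \<sigma> \<phi> \<psi> n u"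
text \<open>The derivative of S. The factor \<open>\<sigma> / u\<close> is the reciprocal of
  \<open>\<sigma> * u\<close>.\<close>

definition V :: "complex \<Rightarrow> complex" where "V z = \<sigma> * T z / u"
definition chi :: "complex \<Rightarrow> complex" where "chi = LG_chi \<sigma> \<phi> \<psi> n u"

lemma hol_q: "q holomorphic_on \<Delta>"
  unfolding q_def using hol_phi hol_psi by (auto intro!: holomorphic_intros)

lemma p_eq: "p z = \<sigma> * u * (1 + \<phi> z / (2 * u))"
  using u_nz by (simp add: p_def field_simps)

lemma hol_F: "F s holomorphic_on \<Delta>"
proof (induction s rule: less_induct)
  case (less s)
  note deriv_phi = holomorphic_deriv[OF hol_phi open_dom]
  consider "s = 0" | "s = Suc 0" | m where "s = Suc (Suc m)" by (metis not0_implies_Suc)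
  then show ?case
  proof cases
    case 3
    have IH: "LG_F \<sigma> \<phi> \<psi> j holomorphic_on \<Delta>" if "j \<le> Suc m" for j
      using less[of j] that 3 by (simp add: F_def)
    have "deriv (LG_F \<sigma> \<phi> \<psi> (Suc m)) holomorphic_on \<Delta>"
      by (rule holomorphic_deriv[OF IH open_dom]) simp
    then show ?thesis
      unfolding 3 F_def LG_F.simps by (intro holomorphic_intros IH open_dom) auto
  qed (auto simp: F_def intro!: holomorphic_intros hol_phi hol_psi deriv_phi)
qed

lemma hol_T: "T holomorphic_on \<Delta>"
  unfolding T_def LG_T_def using hol_F u_nz by (auto simp: F_def intro!: holomorphic_intros)

lemma hol_chi: "chi holomorphic_on \<Delta>"
  unfolding chi_def LG_chi_def
  using hol_T holomorphic_deriv[OF hol_T open_dom] holomorphic_deriv[OF hol_phi open_dom] hol_phi hol_psi u_nz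
  by (auto simp: T_def intro!: holomorphic_intros)

lemma hol_has_derivative: "f holomorphic_on \<Delta> \<Longrightarrow> z \<in> \<Delta> \<Longrightarrow> (f has_field_derivative deriv f z) (at z)"
  using open_dom by (simp add: holomorphic_derivI)

lemma p_derivative: "z \<in> \<Delta> \<Longrightarrow> (p has_field_derivative \<sigma> * deriv \<phi> z / 2) (at z)"
  unfolding p_def by (rule derivative_eq_intros refl hol_has_derivative[OF hol_phi] | assumption | simp)+

lemma V_derivative: "z \<in> \<Delta> \<Longrightarrow> (V has_field_derivative \<sigma> * deriv T z / u) (at z)"
  unfolding V_def using u_nz
  by (auto intro!: derivative_eq_intros hol_has_derivative[OF hol_T])

text \<open>The terms other than the last one are (p + V)' + (p + V)^2. Hence \<open>chi\<close> is,
  up to a power of \<open>\<sigma> * u\<close>, the defect of p + V in the Riccati equation y' + y^2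
  = q, that is, the defect of exp(S + \<theta>) in the differential equation.\<close>

lemma q_eq:
  "q z = (p z)\<^sup>2 + \<sigma> * deriv \<phi> z / 2 + 2 * V z * p z + \<sigma> * deriv T z / u + (V z)\<^sup>2 + chi z / (\<sigma> * u) ^ (n - 1)"
proof -
  have "chi z / (\<sigma> * u) ^ (n - 1) = \<psi> z - \<sigma> * (deriv \<phi> z / 2) - (\<phi> z)\<^sup>2 / 4 - 2 * T z
      - \<phi> z * T z / u - \<sigma> * (deriv T z / u) - (T z)\<^sup>2 / u\<^sup>2"
    unfolding chi_def LG_chi_def T_def[symmetric] using sigma_nz u_nz by simp
  moreover have "(p z)\<^sup>2 = u\<^sup>2 + u * \<phi> z + (\<phi> z)\<^sup>2 / 4"
  proof -
    have "(p z)\<^sup>2 = (\<sigma> * \<sigma>) * (u + \<phi> z / 2)\<^sup>2" by (simp add: p_def power2_eq_square)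
    then show ?thesis unfolding sigma_sq by (simp add: power2_eq_square field_simps)
  qed
  moreover have "V z * p z = T z + \<phi> z * T z / (2 * u)"
  proof -
    have "V z * p z = (\<sigma> * \<sigma>) * (T z * (u + \<phi> z / 2) / u)" by (simp add: V_def p_def)
    then show ?thesis using sigma_sq u_nz by (simp add: field_simps)
  qed
  moreover have "(V z)\<^sup>2 = (T z)\<^sup>2 / u\<^sup>2"
  proof -
    have "(V z)\<^sup>2 = (\<sigma> * \<sigma>) * ((T z)\<^sup>2 / u\<^sup>2)" by (simp add: V_def power2_eq_square)
    then show ?thesis using sigma_sq by simp
  qed
  ultimately show ?thesis by (simp add: q_def mult.assoc)
qed

abbreviation "S e \<equiv> LG_S \<sigma> n u e"

lemma S_derivative:
  assumes "\<And>s. s < n \<Longrightarrow> (e s has_field_derivative F s z) (at z)"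
  shows "(S e has_field_derivative V z) (at z)"
proof -
  have "(S e has_field_derivative (\<Sum>s\<in>{1..<n}. \<sigma> ^ s * (F s z / u ^ s))) (at z)"
    unfolding LG_S_def[abs_def] by (intro DERIV_sum DERIV_cmult DERIV_cdivide assms) auto
  also have "(\<Sum>s\<in>{1..<n}. \<sigma> ^ s * (F s z / u ^ s)) = V z"
  proof -
    \<comment> \<open>The shift of the index turns the terms of T into those of S' and supplies the
      factor \<open>\<sigma> / u\<close>; for \<open>n = 1\<close> both sums are empty.\<close>
    have "{1..<n} = Suc ` {..<n - 1}" using n_pos by (auto simp: image_Suc_lessThan)
    then have "(\<Sum>s\<in>{1..<n}. \<sigma> ^ s * (F s z / u ^ s)) = (\<Sum>s<n - 1. \<sigma> ^ Suc s * (F (Suc s) z / u ^ Suc s))"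
      by (simp add: sum.reindex)
    also have "\<dots> = V z"
      by (simp add: V_def T_def LG_T_def F_def sum_distrib_left sum_divide_distrib mult_ac)
    finally show ?thesis .
  qed
  finally show ?thesis .
qed

definition \<theta> :: "(nat \<Rightarrow> complex \<Rightarrow> complex) \<Rightarrow> complex \<Rightarrow> complex" where
  "\<theta> e z = \<sigma> * u * z + e 0 z"

lemma theta_derivative:
  assumes "(e 0 has_field_derivative F 0 z) (at z)"
  shows "(\<theta> e has_field_derivative p z) (at z)"
proof -
  have "(\<theta> e has_field_derivative \<sigma> * u * 1 + F 0 z) (at z)"
    unfolding \<theta>_def[abs_def] by (intro DERIV_add DERIV_cmult DERIV_ident assms)
  also have "\<sigma> * u * 1 + F 0 z = p z" by (simp add: F_def p_def algebra_simps)
  finally show ?thesis .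
qed

text \<open>In the notation of the header, \<open>gG\<close> and \<open>gH\<close> are the coefficients \<open>g\<close> and \<open>h\<close>.\<close>

definition gE where "gE e z = exp (- S e z - \<theta> e z)"
text \<open>\<open>gY\<close> and the next function \<open>gZ\<close> are the solution and its
  derivative relative to exp(S + \<theta>). Subtracting \<open>V z * w z\<close> removes the
  contribution of S to the derivative, and division by \<open>p z\<close> brings both functions to
  the same scale.\<close>

definition gY where "gY w e z = w z * gE e z"
definition gZ where "gZ w e z = (deriv w z - V z * w z) * gE e z / p z"
definition gG where "gG w e z = (gY w e z + gZ w e z) / 2 - 1"
definition gH where "gH w e z = (gY w e z - gZ w e z) / 2"
definition gR where "gR w e z = chi z / ((\<sigma> * u) ^ (n - 1) * p z) * (1 + gG w e z + gH w e z)
    + 2 * (2 * V z + \<sigma> * deriv \<phi> z / 2 / p z) * gH w e z"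

lemma gZ_mult: "p z \<noteq> 0 \<Longrightarrow> p z * gZ w e z = (deriv w z - V z * w z) * gE e z"
  by (simp add: gZ_def)

text \<open>With X the scaled \<open>chi\<close>, one finds Y' = p (Z - Y) and Z' = X Y / p + (p + 2
  V + p' / p) (Y - Z). In the sum of the two the terms with p alone cancel; in the difference they
  add up to the - 2 p h of the second equation.\<close>

lemma coefficient_derivatives:
  assumes z: "z \<in> \<Delta>" and pz: "p z \<noteq> 0" and w: "w analytic_on {z}" "deriv (deriv w) z = q z * w z"
    and e: "\<And>s. s < n \<Longrightarrow> (e s has_field_derivative F s z) (at z)"
  shows "(gG w e has_field_derivative gR w e z / 2) (at z)"
    and "(gH w e has_field_derivative - 2 * p z * gH w e z - gR w e z / 2) (at z)"
proof -
  let ?p' = "\<sigma> * deriv \<phi> z / 2" and ?V' = "\<sigma> * deriv T z / u" and ?X = "chi z / (\<sigma> * u) ^ (n - 1)"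
  have dw: "(w has_field_derivative deriv w z) (at z)"
    using w(1) by (rule analytic_at_derivative)
  have ddw: "(deriv w has_field_derivative q z * w z) (at z)"
    using analytic_at_derivative[OF analytic_deriv[OF w(1)]] w(2) by simp
  have dE: "(gE e has_field_derivative gE e z * (- V z - p z)) (at z)"
    unfolding gE_def[abs_def]
    by (rule derivative_eq_intros refl S_derivative theta_derivative e | use n_pos in simp)+
  have "(gY w e has_field_derivative deriv w z * gE e z + w z * (gE e z * (- V z - p z))) (at z)"
    unfolding gY_def[abs_def] by (rule derivative_eq_intros refl dw dE)+ (simp add: algebra_simps)
  also have "deriv w z * gE e z + w z * (gE e z * (- V z - p z)) = p z * (gZ w e z - gY w e z)"
    unfolding right_diff_distrib gZ_mult[OF pz] by (simp add: gY_def algebra_simps)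
  finally have Y: "(gY w e has_field_derivative p z * (gZ w e z - gY w e z)) (at z)" .
  have "(gZ w e has_field_derivative (((q z * w z - (?V' * w z + V z * deriv w z)) * gE e z
      + (deriv w z - V z * w z) * (gE e z * (- V z - p z))) * p z - (deriv w z - V z * w z) * gE e z * ?p') / (p z * p z)) (at z)"
    unfolding gZ_def[abs_def]
    by (rule derivative_eq_intros refl dw ddw dE V_derivative[OF z] p_derivative[OF z] pz)+ (simp add: algebra_simps)
  also have "(((q z * w z - (?V' * w z + V z * deriv w z)) * gE e z
      + (deriv w z - V z * w z) * (gE e z * (- V z - p z))) * p z - (deriv w z - V z * w z) * gE e z * ?p') / (p z * p z)
    = ?X / p z * gY w e z + (p z + 2 * V z + ?p' / p z) * (gY w e z - gZ w e z)"
  proof -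
    \<comment> \<open>With all functions replaced by free variables, and \<open>Q\<close> eliminated
      by \<open>q_eq\<close>, this is a rational identity.\<close>
    have "(((Q * b - (V' * b + v * a)) * E + (a - v * b) * (E * (- v - P))) * P - (a - v * b) * E * P') / (P * P)
       = X / P * (b * E) + (P + 2 * v + P' / P) * (b * E - (a - v * b) * E / P)"
      if "P \<noteq> 0" "Q = P\<^sup>2 + P' + 2 * v * P + V' + v\<^sup>2 + X" for Q b V' v a E P P' X :: complex
      unfolding that(2) using that(1) by (simp add: field_simps power2_eq_square)
    from this[OF pz q_eq[of z]] show ?thesis unfolding gY_def gZ_def .
  qed
  finally have Z: "(gZ w e has_field_derivative
     ?X / p z * gY w e z + (p z + 2 * V z + ?p' / p z) * (gY w e z - gZ w e z)) (at z)" .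
  have Yeq: "1 + gG w e z + gH w e z = gY w e z" by (simp add: gG_def gH_def field_simps)
  have R: "gR w e z = ?X / p z * gY w e z + (2 * V z + ?p' / p z) * (gY w e z - gZ w e z)"
    unfolding gR_def Yeq by (simp add: gH_def)
  have "(gG w e has_field_derivative (p z * (gZ w e z - gY w e z) +
     (?X / p z * gY w e z + (p z + 2 * V z + ?p' / p z) * (gY w e z - gZ w e z))) / 2) (at z)"
    unfolding gG_def[abs_def] using DERIV_diff[OF DERIV_cdivide[OF DERIV_add[OF Y Z]] DERIV_const] by simp
  also have "(p z * (gZ w e z - gY w e z) +
     (?X / p z * gY w e z + (p z + 2 * V z + ?p' / p z) * (gY w e z - gZ w e z))) / 2 = gR w e z / 2"
    unfolding R by (simp add: ring_distribs)
  finally show "(gG w e has_field_derivative gR w e z / 2) (at z)" .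
  have "(gH w e has_field_derivative (p z * (gZ w e z - gY w e z) -
     (?X / p z * gY w e z + (p z + 2 * V z + ?p' / p z) * (gY w e z - gZ w e z))) / 2) (at z)"
    unfolding gH_def[abs_def] by (rule DERIV_cdivide[OF DERIV_diff[OF Y Z]])
  also have "(p z * (gZ w e z - gY w e z) -
     (?X / p z * gY w e z + (p z + 2 * V z + ?p' / p z) * (gY w e z - gZ w e z))) / 2
     = - 2 * p z * gH w e z - gR w e z / 2"
    unfolding R gH_def by (simp add: field_simps)
  finally show "(gH w e has_field_derivative - 2 * p z * gH w e z - gR w e z / 2) (at z)" .
qed

end

text \<open>No initial condition on \<open>w\<close> is included: the same estimates serve solutions
  normalised at a finite point, at a point of an unbounded arc, or at infinity.\<close>

locale liouville_green_path = liouville_green +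
  fixes t :: "real \<Rightarrow> complex" and I :: "real set" and e :: "nat \<Rightarrow> real \<Rightarrow> complex \<Rightarrow> complex"
    and w :: "real \<Rightarrow> complex \<Rightarrow> complex"
  assumes chain: "R2_chain t I" and in_dom: "t ` I \<subseteq> \<Delta>"
    and e_cont: "\<And>s. continued_along t I (e s)"
    and e_der: "\<And>x s. x \<in> I \<Longrightarrow> \<forall>\<^sub>F z in nhds (t x). (e s x has_field_derivative F s z) (at z)"
    and w_cont: "continued_along t I w"
    and w_ode: "\<And>x. x \<in> I \<Longrightarrow> ode_germ q (w x) (t x)"
    and p_nz: "\<And>x. x \<in> I \<Longrightarrow> 1 + \<phi> (t x) / (2 * u) \<noteq> 0"
begin

abbreviation "el x \<equiv> (\<lambda>s. e s x)"

definition G where "G x = gG (w x) (el x) (t x)"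
definition H where "H x = gH (w x) (el x) (t x)"
definition \<Theta> where "\<Theta> x = \<theta> (el x) (t x)"
definition R where "R x = gR (w x) (el x) (t x)"

lemma p_nonzero: "x \<in> I \<Longrightarrow> p (t x) \<noteq> 0"
  using p_nz[of x] sigma_nz u_nz by (simp add: p_eq)

lemma eventually_coefficient_derivatives:
  assumes x: "x \<in> I"
  shows "\<forall>\<^sub>F z in nhds (t x). (gG (w x) (el x) has_field_derivative gR (w x) (el x) z / 2) (at z)"
    and "\<forall>\<^sub>F z in nhds (t x). (gH (w x) (el x) has_field_derivative - 2 * p z * gH (w x) (el x) z - gR (w x) (el x) z / 2) (at z)"
    and "\<forall>\<^sub>F z in nhds (t x). (\<theta> (el x) has_field_derivative p z) (at z)"
proof -
  have tx: "t x \<in> \<Delta>" using x in_dom by blast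
  have 1: "\<forall>\<^sub>F z in nhds (t x). z \<in> \<Delta>" using open_dom tx by (rule eventually_nhds_in_open)
  have "p \<midarrow>t x\<rightarrow> p (t x)"
    using p_derivative[OF tx] DERIV_isCont isContD by blast
  then have 2: "\<forall>\<^sub>F z in nhds (t x). p z \<noteq> 0"
    using p_nonzero[OF x] by (auto simp: eventually_nhds_conv_at intro: tendsto_imp_eventually_ne)
  have 3: "\<forall>\<^sub>F z in nhds (t x). w x analytic_on {z}"
    using w_ode[OF x] by (simp add: ode_germ_def eventually_analytic_at)
  have 4: "\<forall>\<^sub>F z in nhds (t x). deriv (deriv (w x)) z = q z * w x z"
    using w_ode[OF x] by (simp add: ode_germ_def)
  have 5: "\<forall>\<^sub>F z in nhds (t x). \<forall>s\<in>{..<n}. (e s x has_field_derivative F s z) (at z)"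
    using e_der[OF x] by (intro eventually_ball_finite) auto
  show "\<forall>\<^sub>F z in nhds (t x). (gG (w x) (el x) has_field_derivative gR (w x) (el x) z / 2) (at z)"
    using 1 2 3 4 5 by eventually_elim (rule coefficient_derivatives(1); simp)
  show "\<forall>\<^sub>F z in nhds (t x). (gH (w x) (el x) has_field_derivative - 2 * p z * gH (w x) (el x) z - gR (w x) (el x) z / 2) (at z)"
    using 1 2 3 4 5 by eventually_elim (rule coefficient_derivatives(2); simp)
  show "\<forall>\<^sub>F z in nhds (t x). (\<theta> (el x) has_field_derivative p z) (at z)"
    using 5 by eventually_elim (rule theta_derivative, use n_pos in simp)
qed

lemma continued_coefficients:
  shows "continued_along t I (\<lambda>x. gG (w x) (el x))" "continued_along t I (\<lambda>x. gH (w x) (el x))"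
    "continued_along t I (\<lambda>x. \<theta> (el x))"
proof -
  have an: "gG (w x) (el x) analytic_on {t x}" "gH (w x) (el x) analytic_on {t x}" "\<theta> (el x) analytic_on {t x}"
    if "x \<in> I" for x
    using eventually_coefficient_derivatives[OF that, THEN analytic_at_if_eventually_derivative] by simp_all
  \<comment> \<open>Only the elements with \<open>s < n\<close> enter the coefficients; their
    finiteness allows the neighbourhoods for different \<open>s\<close> to be intersected.\<close>
  have data: "\<forall>\<^sub>F x in at c within I. \<forall>\<^sub>F z in nhds (t x).
     w x z = w c z \<and> deriv (w x) z = deriv (w c) z \<and> (\<forall>s\<in>{..<n}. e s x z = e s c z)" if c: "c \<in> I" for c
  proof -
    have w1: "\<forall>\<^sub>F x in at c within I. \<forall>\<^sub>F z in nhds (t x). w x z = w c z"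
      using w_cont c by (auto simp: continued_along_def)
    have "\<forall>\<^sub>F x in at c within I. \<forall>s\<in>{..<n}. \<forall>\<^sub>F z in nhds (t x). e s x z = e s c z"
      using e_cont c by (intro eventually_ball_finite) (auto simp: continued_along_def)
    with w1 show ?thesis
    proof eventually_elim
      case (elim x)
      have "\<forall>\<^sub>F z in nhds (t x). \<forall>s\<in>{..<n}. e s x z = e s c z"
        using elim(2) by (intro eventually_ball_finite) auto
      with elim(1) deriv_eventually_cong[OF elim(1)] show ?case by eventually_elim auto
    qed
  qed
  have coef: "gG (w x) (el x) z = gG (w c) (el c) z \<and> gH (w x) (el x) z = gH (w c) (el c) z \<and> \<theta> (el x) z = \<theta> (el c) z"
    if "w x z = w c z \<and> deriv (w x) z = deriv (w c) z \<and> (\<forall>s\<in>{..<n}. e s x z = e s c z)" for x c z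
  proof -
    have "S (el x) z = S (el c) z" "\<theta> (el x) z = \<theta> (el c) z"
      using that n_pos by (auto simp: LG_S_def \<theta>_def intro!: sum.cong)
    then show ?thesis using that by (simp add: gG_def gH_def gY_def gZ_def gE_def)
  qed
  have ev: "\<forall>\<^sub>F x in at c within I. \<forall>\<^sub>F z in nhds (t x).
     gG (w x) (el x) z = gG (w c) (el c) z \<and> gH (w x) (el x) z = gH (w c) (el c) z \<and> \<theta> (el x) z = \<theta> (el c) z"
    if "c \<in> I" for c
    by (rule eventually_mono[OF data[OF that]]) (erule eventually_mono, rule coef)
  show "continued_along t I (\<lambda>x. gG (w x) (el x))" "continued_along t I (\<lambda>x. gH (w x) (el x))"
    "continued_along t I (\<lambda>x. \<theta> (el x))"
    unfolding continued_along_def using an ev by (simp_all add: eventually_conj_iff)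
qed

lemma path_derivatives:
  assumes x: "x \<in> J" "J \<subseteq> I" and t': "(t has_vector_derivative t') (at x within J)"
  shows "(G has_vector_derivative t' * R x / 2) (at x within J)"
    "(H has_vector_derivative - 2 * (t' * p (t x)) * H x - t' * R x / 2) (at x within J)"
    "(\<Theta> has_vector_derivative t' * p (t x)) (at x within J)"
proof -
  have xI: "x \<in> I" using x by blast
  note ev = eventually_coefficient_derivatives[OF xI, THEN eventually_nhds_x_imp_x, THEN DERIV_imp_deriv]
  note vd = continued_coefficients[THEN continued_along_has_vector_derivative, OF x t', unfolded ev]
  show "(G has_vector_derivative t' * R x / 2) (at x within J)"
    using vd(1) by (simp add: G_def[abs_def] R_def)
  show "(H has_vector_derivative - 2 * (t' * p (t x)) * H x - t' * R x / 2) (at x within J)"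
    using vd(2) by (simp add: H_def[abs_def] R_def algebra_simps)
  show "(\<Theta> has_vector_derivative t' * p (t x)) (at x within J)"
    using vd(3) by (simp add: \<Theta>_def[abs_def])
qed

text \<open>The origin of the constants: p = \<sigma> u (1 + \<phi> / (2 u)) gives 1 / |p| \<le>
  \<kappa> / |u|. The \<open>chi\<close> term thus gets \<kappa> / |u|^n, the term p' / p gets
  \<kappa> / (2 |u|), and 2 V has modulus exactly 2 |T| / |u|.\<close>

lemma norm_R_le:
  assumes x: "x \<in> I" and \<kappa>: "1 / norm (1 + \<phi> (t x) / (2 * u)) \<le> \<kappa>"
  shows "norm (R x) \<le> \<kappa> / norm u ^ n * norm (chi (t x)) * (1 + norm (G x) + norm (H x))
     + 2 * (2 / norm u * norm (T (t x)) + \<kappa> / (2 * norm u) * norm (deriv \<phi> (t x))) * norm (H x)"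
proof -
  have \<kappa>0: "0 \<le> \<kappa>" using \<kappa> by (rule order_trans[rotated]) simp
  have np: "1 / norm (p (t x)) \<le> \<kappa> / norm u"
    using divide_right_mono[OF \<kappa>, of "norm u"] by (simp add: p_eq norm_mult norm_sigma mult.commute)
  have nn: "norm u ^ n = norm u ^ (n - 1) * norm u"
    using n_pos by (metis Suc_diff_1 less_eq_Suc_le One_nat_def power_Suc2)
  have "norm (chi (t x) / ((\<sigma> * u) ^ (n - 1) * p (t x))) = norm (chi (t x)) / norm u ^ (n - 1) * (1 / norm (p (t x)))"
    by (simp add: norm_divide norm_mult norm_power norm_sigma)
  also have "\<dots> \<le> norm (chi (t x)) / norm u ^ (n - 1) * (\<kappa> / norm u)"
    using np by (intro mult_left_mono) auto
  also have "\<dots> = \<kappa> / norm u ^ n * norm (chi (t x))" by (simp add: nn)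
  finally have 1: "norm (chi (t x) / ((\<sigma> * u) ^ (n - 1) * p (t x))) \<le> \<kappa> / norm u ^ n * norm (chi (t x))" .
  have "norm (\<sigma> * deriv \<phi> (t x) / 2 / p (t x)) = norm (deriv \<phi> (t x)) / 2 * (1 / norm (p (t x)))"
    by (simp add: norm_divide norm_mult norm_sigma)
  also have "\<dots> \<le> norm (deriv \<phi> (t x)) / 2 * (\<kappa> / norm u)"
    using np by (intro mult_left_mono) auto
  finally have 2: "norm (\<sigma> * deriv \<phi> (t x) / 2 / p (t x)) \<le> \<kappa> / (2 * norm u) * norm (deriv \<phi> (t x))"
    by (simp add: mult_ac)
  have 3: "norm (2 * V (t x)) = 2 / norm u * norm (T (t x))"
    by (simp add: V_def norm_divide norm_mult norm_sigma)
  have "norm (R x) \<le> norm (chi (t x) / ((\<sigma> * u) ^ (n - 1) * p (t x))) * norm (1 + G x + H x)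
      + 2 * norm (2 * V (t x) + \<sigma> * deriv \<phi> (t x) / 2 / p (t x)) * norm (H x)"
    unfolding R_def gR_def G_def[symmetric] H_def[symmetric]
    by (rule order_trans[OF norm_triangle_ineq]) (simp only: norm_mult norm_numeral order_refl)
  also have "\<dots> \<le> (\<kappa> / norm u ^ n * norm (chi (t x))) * (1 + norm (G x) + norm (H x))
      + 2 * (2 / norm u * norm (T (t x)) + \<kappa> / (2 * norm u) * norm (deriv \<phi> (t x))) * norm (H x)"
  proof (intro add_mono mult_mono mult_left_mono mult_right_mono)
    show "norm (1 + G x + H x) \<le> 1 + norm (G x) + norm (H x)"
      by (metis norm_one norm_triangle_le norm_triangle_mono order_refl)
    show "norm (2 * V (t x) + \<sigma> * deriv \<phi> (t x) / 2 / p (t x))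
        \<le> 2 / norm u * norm (T (t x)) + \<kappa> / (2 * norm u) * norm (deriv \<phi> (t x))"
      using 2 3 by (intro norm_triangle_le) linarith
    show "0 \<le> \<kappa> / norm u ^ n * norm (chi (t x))" using 1 norm_ge_zero order_trans by blast
  qed (use 1 \<kappa>0 in auto)
  finally show ?thesis .
qed

text \<open>The comparison carried along the whole chain. The primitives are kept abstract; the
  factor \<open>norm (t' x)\<close> in the arc-length densities matches the one that the chain rule
  puts on the right-hand side of the equations.\<close>

lemma coefficients_less:
  fixes J0 J1 J2 :: "real \<Rightarrow> real" and c \<kappa> :: real
  defines "A \<equiv> \<lambda>x. \<kappa> / norm u ^ n * J0 x"
    and "B \<equiv> \<lambda>x. 2 / norm u * J1 x + \<kappa> / (2 * norm u) * J2 x"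
  assumes \<kappa>: "\<And>x. x \<in> I \<Longrightarrow> 1 / norm (1 + \<phi> (t x) / (2 * u)) \<le> \<kappa>"
    and mono: "\<And>x y. x \<in> I \<Longrightarrow> y \<in> I \<Longrightarrow> x \<le> y \<Longrightarrow> Re (\<Theta> x) \<le> Re (\<Theta> y)"
    and J: "arc_primitive t I chi J0" "arc_primitive t I T J1" "arc_primitive t I (deriv \<phi>) J2"
    and c: "c > 0" and xy: "x \<in> I" "y \<in> I" "x \<le> y"
    and start: "norm (G x) < (c + A x) * exp (A x + B x) / 2" "norm (H x) < (c + A x) * exp (A x + B x) / 2"
  shows "norm (G y) < (c + A y) * exp (A y + B y) / 2 \<and> norm (H y) < (c + A y) * exp (A y + B y) / 2"
proof -
  define Q where "Q x \<longleftrightarrow> norm (G x) < (c + A x) * exp (A x + B x) / 2 \<and> norm (H x) < (c + A x) * exp (A x + B x) / 2" for x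
  have \<kappa>0: "\<kappa> \<ge> 0" using \<kappa>[OF xy(1)] by (rule order_trans[rotated]) simp
  \<comment> \<open>Staying below the barrier at an end point is all that has to be handed on from
    one arc to the next, and implication is reflexive and transitive.\<close>
  have "Q x \<longrightarrow> Q y"
  proof (rule R2_chain_propagate[OF chain, where P = "\<lambda>x y. Q x \<longrightarrow> Q y"])
    fix a b :: real assume ab: "a < b" "{a..b} \<subseteq> I" "R2_arc t {a..b}"
    obtain t' where t': "\<And>x. x \<in> {a<..<b} \<Longrightarrow> (t has_vector_derivative t' x) (at x)"
      "\<And>x. x \<in> {a<..<b} \<Longrightarrow> vector_derivative t (at x) = t' x"
      using R2_arc_derivative[OF ab(3)] by metis
    have sub: "{a<..<b} \<subseteq> {a..b}" by auto
    have subI: "{a<..<b} \<subseteq> I" using sub ab(2) by (rule subset_trans)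
    have tc: "\<exists>t'. (t has_vector_derivative t') (at x within {a..b})" if "x \<in> {a..b}" for x
      using ab(3) that unfolding R2_arc_def by blast
    then have cont: "continuous_on {a..b} G" "continuous_on {a..b} H" "continuous_on {a..b} \<Theta>"
      using path_derivatives[OF _ ab(2)] unfolding continuous_on_eq_continuous_within
      by (meson has_vector_derivative_continuous)+
    have Jc: "continuous_on {a..b} J0" "continuous_on {a..b} J1" "continuous_on {a..b} J2"
      using J ab unfolding arc_primitive_def by blast+
    have Jnn: "0 \<le> J0 x" "0 \<le> J1 x" "0 \<le> J2 x" if "x \<in> {a..b}" for x
      using J ab(2) that unfolding arc_primitive_def by blast+
    have Jd: "(J0 has_real_derivative arc_density t chi x) (at x)"
      "(J1 has_real_derivative arc_density t T x) (at x)"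
      "(J2 has_real_derivative arc_density t (deriv \<phi>) x) (at x)" if "x \<in> {a<..<b}" for x
      using J ab that unfolding arc_primitive_def by blast+
    have vd: "(G has_vector_derivative t' x * R x / 2) (at x)"
        "(H has_vector_derivative - 2 * (t' x * p (t x)) * H x - t' x * R x / 2) (at x)"
        "(\<Theta> has_vector_derivative t' x * p (t x)) (at x)" if x: "x \<in> {a<..<b}" for x
      using path_derivatives[OF x subI has_vector_derivative_at_within[OF t'(1)[OF x]]]
      by (simp_all add: at_within_open[OF x open_greaterThanLessThan])
    show "Q a \<longrightarrow> Q b"
    proof
      assume Qa: "Q a"
      show "Q b"
        unfolding Q_def
      proof (rule comparison_on_arc[OF ab(1), where \<Theta> = \<Theta> and P = "\<lambda>x. t' x * p (t x)" and R = "\<lambda>x. t' x * R x"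
          and A' = "\<lambda>x. \<kappa> / norm u ^ n * arc_density t chi x"
          and B' = "\<lambda>x. 2 / norm u * arc_density t T x + \<kappa> / (2 * norm u) * arc_density t (deriv \<phi>) x"])
        show "continuous_on {a..b} A" "continuous_on {a..b} B"
          unfolding A_def B_def by (intro continuous_intros Jc)+
        show "c > 0" by (rule c)
        show "norm (G a) < (c + A a) * exp (A a + B a) / 2" "norm (H a) < (c + A a) * exp (A a + B a) / 2"
          using Qa by (simp_all add: Q_def)
        fix x assume x: "x \<in> {a<..<b}"
        have xI: "x \<in> I" using x subI by blast
        show "(A has_real_derivative \<kappa> / norm u ^ n * arc_density t chi x) (at x)"
          unfolding A_def by (intro DERIV_cmult Jd x)
        show "(B has_real_derivative 2 / norm u * arc_density t T x + \<kappa> / (2 * norm u) * arc_density t (deriv \<phi>) x) (at x)"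
          unfolding B_def by (intro DERIV_cmult DERIV_add Jd x)
        show "0 \<le> \<kappa> / norm u ^ n * arc_density t chi x"
          "0 \<le> 2 / norm u * arc_density t T x + \<kappa> / (2 * norm u) * arc_density t (deriv \<phi>) x"
          using \<kappa>0 by (simp_all add: arc_density_nonneg)
        have "norm (t' x * R x) \<le> norm (t' x) * (\<kappa> / norm u ^ n * norm (chi (t x)) * (1 + norm (G x) + norm (H x))
          + 2 * (2 / norm u * norm (T (t x)) + \<kappa> / (2 * norm u) * norm (deriv \<phi> (t x))) * norm (H x))"
          unfolding norm_mult by (rule mult_left_mono[OF norm_R_le[OF xI \<kappa>[OF xI]]]) simp
        then show "norm (t' x * R x) \<le> \<kappa> / norm u ^ n * arc_density t chi x * (1 + norm (G x) + norm (H x))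
          + 2 * (2 / norm u * arc_density t T x + \<kappa> / (2 * norm u) * arc_density t (deriv \<phi>) x) * norm (H x)"
          unfolding arc_density_def t'(2)[OF x] by (simp add: algebra_simps)
      next
        fix x assume "x \<in> {a..b}"
        from Jnn[OF this] show "0 \<le> A x" "0 \<le> B x" using \<kappa>0 by (simp_all add: A_def B_def)
      next
        fix x y assume "x \<in> {a..b}" "y \<in> {a..b}" "x \<le> y"
        then show "Re (\<Theta> x) \<le> Re (\<Theta> y)" using mono ab(2) by blast
      qed (use cont vd in auto)
    qed
  qed (use xy in auto)
  then show ?thesis using start by (simp add: Q_def)
qed

text \<open>Since exp(\<theta>) \<open>gE\<close> = exp(- S), the error is exp(\<theta>) (Y - 1).
  Differentiating exp(- S) W produces exactly W' - V W, so the derivative of the error is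
  exp(\<theta>) p (Z - 1); this is what the definition of \<open>gZ\<close> is made for.\<close>

lemma error_identities:
  assumes x: "x \<in> I"
  defines "\<epsilon> \<equiv> \<lambda>z. exp (- S (el x) z) * w x z - exp (\<theta> (el x) z)"
  shows "\<epsilon> analytic_on {t x}"
    and "\<epsilon> (t x) = exp (\<Theta> x) * (G x + H x)"
    and "deriv \<epsilon> (t x) = exp (\<Theta> x) * p (t x) * (G x - H x)"
proof -
  have ex: "exp (\<theta> (el x) z) * gE (el x) z = exp (- S (el x) z)" for z
    by (simp add: gE_def flip: exp_add)
  have GH: "G x + H x = gY (w x) (el x) (t x) - 1" "G x - H x = gZ (w x) (el x) (t x) - 1"
    by (simp_all add: G_def H_def gG_def gH_def field_simps)
  show "\<epsilon> (t x) = exp (\<Theta> x) * (G x + H x)"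
    unfolding GH by (simp add: \<epsilon>_def \<Theta>_def gY_def algebra_simps flip: ex)
  have wx: "w x analytic_on {t x}" using w_ode[OF x] by (simp add: ode_germ_def)
  have 5: "\<forall>\<^sub>F z in nhds (t x). \<forall>s\<in>{..<n}. (e s x has_field_derivative F s z) (at z)"
    using e_der[OF x] by (intro eventually_ball_finite) auto
  have ev: "\<forall>\<^sub>F z in nhds (t x). (\<epsilon> has_field_derivative
      exp (- S (el x) z) * (deriv (w x) z - V z * w x z) - exp (\<theta> (el x) z) * p z) (at z)"
    using eventually_analytic_at[OF wx] 5
  proof eventually_elim
    case (elim z)
    note dw = analytic_at_derivative[OF elim(1)]
    have dS: "(S (el x) has_field_derivative V z) (at z)" by (rule S_derivative) (use elim in auto)
    have d\<theta>: "(\<theta> (el x) has_field_derivative p z) (at z)" by (rule theta_derivative) (use elim n_pos in auto)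
    show ?case unfolding \<epsilon>_def
      by (rule derivative_eq_intros refl dw dS d\<theta>)+ (simp add: algebra_simps)
  qed
  then show "\<epsilon> analytic_on {t x}" by (rule analytic_at_if_eventually_derivative)
  have "deriv \<epsilon> (t x) = exp (- S (el x) (t x)) * (deriv (w x) (t x) - V (t x) * w x (t x)) - exp (\<theta> (el x) (t x)) * p (t x)"
    using eventually_nhds_x_imp_x[OF ev] by (rule DERIV_imp_deriv)
  also have "\<dots> = exp (\<Theta> x) * (p (t x) * gZ (w x) (el x) (t x)) - exp (\<Theta> x) * p (t x)"
    unfolding gZ_mult[OF p_nonzero[OF x]] by (simp add: \<Theta>_def mult_ac flip: ex)
  finally show "deriv \<epsilon> (t x) = exp (\<Theta> x) * p (t x) * (G x - H x)"
    unfolding GH by (simp add: algebra_simps)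
qed

end

section \<open>Paths from a reference point and the solution space\<close>

lemma continued_along_cong_path:
  assumes "continued_along t I f" and eq: "\<And>x. x \<in> I \<Longrightarrow> t x = t' x"
  shows "continued_along t' I f"
  unfolding continued_along_def
proof (intro ballI conjI)
  fix c assume c: "c \<in> I"
  show "f c analytic_on {t' c}" using assms(1) c eq[OF c] by (auto simp: continued_along_def)
  have "\<forall>\<^sub>F x in at c within I. \<forall>\<^sub>F z in nhds (t x). f x z = f c z"
    using assms(1) c by (auto simp: continued_along_def)
  moreover have "\<forall>\<^sub>F x in at c within I. x \<in> I" by (auto simp: eventually_at_filter)
  ultimately show "\<forall>\<^sub>F x in at c within I. \<forall>\<^sub>F z in nhds (t' x). f x z = f c z"
    by eventually_elim (use eq in simp)
qed

lemma R2_chain_nonempty: "R2_chain t I \<Longrightarrow> I \<noteq> {}"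
  by (induction rule: R2_chain.induct) auto

lemma connected_path_dom: "connected (path_dom \<alpha> b)"
  by (cases \<alpha>) (auto intro: convex_connected)

lemma path_from_end:
  assumes "path_from \<Delta> \<alpha> t b \<xi>"
  shows "b \<in> path_dom \<alpha> b" "t b = \<xi>" "\<And>x. x \<in> path_dom \<alpha> b \<Longrightarrow> x \<le> b"
  using assms R2_chain_nonempty[of t "path_dom \<alpha> b"] by (cases \<alpha>; auto simp: path_from_def)+

text \<open>Turns a property that holds near \<alpha> into one at an actual parameter common to path
  and reference curve: 0 for a finite point, a sufficiently negative one for an infinite
  end.\<close>

lemma path_from_base:
  assumes "path_from \<Delta> \<alpha> t b \<xi>" "\<forall>\<^sub>F \<tau> in ref_filter \<alpha>. Q \<tau>"
  obtains s where "s \<in> path_dom \<alpha> b" "s \<in> ref_dom \<alpha>" "t s = ref_curve \<alpha> s" "Q s"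
proof (cases \<alpha>)
  case (Finite_Point a)
  then show ?thesis
    using that[of 0] assms R2_chain_nonempty[of t "path_dom \<alpha> b"]
    by (auto simp: path_from_def eventually_principal)
next
  case (Infinite_End A)
  have "\<forall>\<^sub>F \<tau> in at_bot. Q \<tau> \<and> t \<tau> = A \<tau> \<and> \<tau> \<le> b \<and> \<tau> \<le> 0"
    using assms Infinite_End by (auto simp: path_from_def eventually_conj_iff eventually_le_at_bot)
  then obtain s where "Q s \<and> t s = A s \<and> s \<le> b \<and> s \<le> 0"
    using eventually_happens trivial_limit_at_bot_linorder by blast
  then show ?thesis using that[of s] Infinite_End by simp
qed

lemma ref_curve_regular:
  assumes "ref_point_in \<Delta> \<alpha>"
  shows "connected (ref_dom \<alpha>)" "continuous_on (ref_dom \<alpha>) (ref_curve \<alpha>)" "ref_curve \<alpha> ` ref_dom \<alpha> \<subseteq> \<Delta>"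
  using assms by (cases \<alpha>; auto intro: convex_connected R2_arc_continuous)+

lemma continued_along_linear:
  assumes "continued_along t I f" "continued_along t I g"
  shows "continued_along t I (\<lambda>x z. a * f x z + b * g x z)"
  unfolding continued_along_def
proof (intro ballI conjI)
  fix c assume c: "c \<in> I"
  show "(\<lambda>z. a * f c z + b * g c z) analytic_on {t c}"
    using assms c by (auto simp: continued_along_def intro!: analytic_intros)
  have "\<forall>\<^sub>F x in at c within I. \<forall>\<^sub>F z in nhds (t x). f x z = f c z"
    "\<forall>\<^sub>F x in at c within I. \<forall>\<^sub>F z in nhds (t x). g x z = g c z"
    using assms c by (auto simp: continued_along_def)
  then show "\<forall>\<^sub>F x in at c within I. \<forall>\<^sub>F z in nhds (t x). a * f x z + b * g x z = a * f c z + b * g c z"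
  proof eventually_elim
    case (elim x)
    then show ?case by eventually_elim simp
  qed
qed

lemma deriv_linear:
  assumes "f analytic_on {z}" "g analytic_on {z}"
  shows "deriv (\<lambda>z. a * f z + b * g z) z = a * deriv f z + b * deriv g z"
  by (intro DERIV_imp_deriv DERIV_add DERIV_cmult analytic_at_derivative assms)

lemma ode_germ_linear:
  assumes "ode_germ q f c" "ode_germ q g c"
  shows "ode_germ q (\<lambda>z. a * f z + b * g z) c"
  unfolding ode_germ_def
proof
  have an: "f analytic_on {c}" "g analytic_on {c}" using assms by (auto simp: ode_germ_def)
  show "(\<lambda>z. a * f z + b * g z) analytic_on {c}" using an by (auto intro!: analytic_intros)
  have 1: "\<forall>\<^sub>F z in nhds c. deriv (\<lambda>z. a * f z + b * g z) z = a * deriv f z + b * deriv g z"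
    using eventually_analytic_at[OF an(1)] eventually_analytic_at[OF an(2)]
    by eventually_elim (rule deriv_linear)
  have "\<forall>\<^sub>F z in nhds c. deriv (\<lambda>z. a * deriv f z + b * deriv g z) z = a * deriv (deriv f) z + b * deriv (deriv g) z"
    using eventually_analytic_at[OF analytic_deriv[OF an(1)]] eventually_analytic_at[OF analytic_deriv[OF an(2)]]
    by eventually_elim (rule deriv_linear)
  moreover have "\<forall>\<^sub>F z in nhds c. deriv (deriv f) z = q z * f z" "\<forall>\<^sub>F z in nhds c. deriv (deriv g) z = q z * g z"
    using assms by (auto simp: ode_germ_def)
  ultimately show "\<forall>\<^sub>F z in nhds c. deriv (deriv (\<lambda>z. a * f z + b * g z)) z = q z * (a * f z + b * g z)"
    using deriv_eventually_cong[OF 1] by eventually_elim (simp add: algebra_simps)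
qed

lemma ode_germ_with_data:
  assumes "open \<Delta>" "q holomorphic_on \<Delta>" "a \<in> \<Delta>"
  obtains w where "ode_germ q w a" "w a = c0" "deriv w a = c1"
proof -
  obtain r where r: "r > 0" "ball a r \<subseteq> \<Delta>" using assms openE by blast
  have a: "a \<in> ball a r" using r by simp
  obtain w where w: "w holomorphic_on ball a r" "w a = c0" "deriv w a = c1"
    "\<And>z. z \<in> ball a r \<Longrightarrow> deriv (deriv w) z = q z * w z"
    using linear_ode_simply_connected[OF open_ball convex_imp_simply_connected[OF convex_ball]
        holomorphic_on_subset[OF assms(2) r(2)] a, of c0 c1] by blast
  then show ?thesis using that ode_germ_if_solution[OF open_ball w(1,4) a] by blast
qed

lemma germ_values:
  assumes "\<forall>\<^sub>F z in nhds a. f z = g z"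
  shows "f a = g a" "deriv f a = deriv g a"
  using eventually_nhds_x_imp_x[OF assms] deriv_cong_ev[OF assms refl] by auto

lemma ode_solution_from_data:
  fixes t :: "real \<Rightarrow> complex"
  assumes \<Delta>: "open \<Delta>" "q holomorphic_on \<Delta>" and I: "connected I"
    and t: "continuous_on I t" "t ` I \<subseteq> \<Delta>" and s: "s \<in> I"
  obtains f where "continued_along t I f" "\<And>x. x \<in> I \<Longrightarrow> ode_germ q (f x) (t x)"
    "f s (t s) = c0" "deriv (f s) (t s) = c1"
proof -
  have ts: "t s \<in> \<Delta>" using t(2) s by blast
  obtain w where w: "ode_germ q w (t s)" "w (t s) = c0" "deriv w (t s) = c1"
    using ode_germ_with_data[OF \<Delta> ts] by blast
  obtain f where f: "continued_along t I f" "\<And>x. x \<in> I \<Longrightarrow> ode_germ q (f x) (t x)"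
    "\<forall>\<^sub>F z in nhds (t s). f s z = w z"
    using ode_continuation[OF \<Delta> I t s w(1)] by blast
  show ?thesis by (rule that[OF f(1,2)]) (use germ_values[OF f(3)] w in auto)
qed

text \<open>Values along the path depend linearly on the data at \<open>s\<close>, through a fixed
  fundamental system. Convergence of initial data at one parameter therefore implies convergence at
  every other.\<close>

lemma ode_solution_linear:
  fixes t :: "real \<Rightarrow> complex"
  assumes \<Delta>: "open \<Delta>" "q holomorphic_on \<Delta>" and I: "connected I"
    and t: "continuous_on I t" "t ` I \<subseteq> \<Delta>" and s: "s \<in> I" and x: "x \<in> I"
    and f: "continued_along t I f" "\<And>x. x \<in> I \<Longrightarrow> ode_germ q (f x) (t x)" "f s (t s) = 1" "deriv (f s) (t s) = 0"
    and g: "continued_along t I g" "\<And>x. x \<in> I \<Longrightarrow> ode_germ q (g x) (t x)" "g s (t s) = 0" "deriv (g s) (t s) = 1"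
    and h: "continued_along t I h" "\<And>x. x \<in> I \<Longrightarrow> ode_germ q (h x) (t x)"
  shows "h x (t x) = h s (t s) * f x (t x) + deriv (h s) (t s) * g x (t x)"
    and "deriv (h x) (t x) = h s (t s) * deriv (f x) (t x) + deriv (h s) (t s) * deriv (g x) (t x)"
proof -
  let ?a = "h s (t s)" and ?b = "deriv (h s) (t s)"
  have ts: "t s \<in> \<Delta>" using t(2) s by blast
  have an: "f x analytic_on {t x}" "g x analytic_on {t x}" if "x \<in> I" for x
    using f(2) g(2) that by (auto simp: ode_germ_def)
  have d: "deriv (\<lambda>z. ?a * f x z + ?b * g x z) (t x) = ?a * deriv (f x) (t x) + ?b * deriv (g x) (t x)"
    if "x \<in> I" for x using an[OF that] by (rule deriv_linear)
  have "\<forall>\<^sub>F z in nhds (t s). h s z = ?a * f s z + ?b * g s z"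
    by (rule ode_germ_unique[OF \<Delta> ts h(2)[OF s] ode_germ_linear[OF f(2)[OF s] g(2)[OF s]]])
       (use f g d[OF s] in simp_all)
  from continued_along_unique[OF I t(1) h(1) continued_along_linear[OF f(1) g(1)] s this x]
  have "\<forall>\<^sub>F z in nhds (t x). h x z = ?a * f x z + ?b * g x z" .
  from germ_values[OF this] d[OF x]
  show "h x (t x) = ?a * f x (t x) + ?b * g x (t x)"
    "deriv (h x) (t x) = ?a * deriv (f x) (t x) + ?b * deriv (g x) (t x)" by auto
qed

section \<open>Bounds for the coefficients and for the error\<close>

context liouville_green_path
begin

text \<open>The number \<open>c\<close> is both the size allowed at the starting parameter and the
  offset of the barrier: as A and B are nonnegative there, the barrier is at least
  \<open>c / 2\<close> at the start. Letting \<open>c\<close> tend to 0 removes it; the starting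
  parameter may move with \<open>c\<close>, which covers decay at infinity.\<close>

lemma coefficient_bounds:
  assumes \<kappa>: "\<And>x. x \<in> I \<Longrightarrow> 1 / norm (1 + \<phi> (t x) / (2 * u)) \<le> \<kappa>"
    and mono: "\<And>x y. x \<in> I \<Longrightarrow> y \<in> I \<Longrightarrow> x \<le> y \<Longrightarrow> Re (\<Theta> x) \<le> Re (\<Theta> y)"
    and int: "arc_integrable t I chi" "arc_integrable t I T" "arc_integrable t I (deriv \<phi>)"
    and small: "\<And>c. c > 0 \<Longrightarrow> \<exists>s\<in>I. s \<le> x \<and> norm (G s) < c / 2 \<and> norm (H s) < c / 2"
    and x: "x \<in> I"
  defines "A \<equiv> \<kappa> / norm u ^ n * arc_integral t (I \<inter> {..x}) chi"
    and "B \<equiv> 2 / norm u * arc_integral t (I \<inter> {..x}) T + \<kappa> / (2 * norm u) * arc_integral t (I \<inter> {..x}) (deriv \<phi>)"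
  shows "norm (G x) \<le> A * exp (A + B) / 2" "norm (H x) \<le> A * exp (A + B) / 2" "0 \<le> A" "0 \<le> B"
proof -
  have cl: "closed I" using chain by (rule R2_chain_closed)
  have cont: "continuous_on (t ` I) chi" "continuous_on (t ` I) T" "continuous_on (t ` I) (deriv \<phi>)"
    using in_dom hol_chi hol_T holomorphic_deriv[OF hol_phi open_dom]
    by (meson continuous_on_subset holomorphic_on_imp_continuous_on)+
  note prim = arc_primitive_integral[OF cl cont(1) int(1)] arc_primitive_integral[OF cl cont(2) int(2)]
    arc_primitive_integral[OF cl cont(3) int(3)]
  have \<kappa>0: "\<kappa> \<ge> 0" using \<kappa>[OF x] by (rule order_trans[rotated]) simp
  have nn: "0 \<le> arc_integral t (I \<inter> {..y}) chi" "0 \<le> arc_integral t (I \<inter> {..y}) T"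
    "0 \<le> arc_integral t (I \<inter> {..y}) (deriv \<phi>)" if "y \<in> I" for y
    using prim that by (auto simp: arc_primitive_def)
  show "0 \<le> A" "0 \<le> B" using nn[OF x] \<kappa>0 by (simp_all add: A_def B_def)
  have lt: "norm (G x) < (c + A) * exp (A + B) / 2 \<and> norm (H x) < (c + A) * exp (A + B) / 2" if c: "c > 0" for c
  proof -
    obtain s where s: "s \<in> I" "s \<le> x" "norm (G s) < c / 2" "norm (H s) < c / 2" using small[OF c] by blast
    define a where "a = \<kappa> / norm u ^ n * arc_integral t (I \<inter> {..s}) chi"
    define b where "b = 2 / norm u * arc_integral t (I \<inter> {..s}) T + \<kappa> / (2 * norm u) * arc_integral t (I \<inter> {..s}) (deriv \<phi>)"
    have "0 \<le> a" "0 \<le> b" using nn[OF s(1)] \<kappa>0 by (simp_all add: a_def b_def)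
    then have "c * 1 \<le> (c + a) * exp (a + b)" using c by (intro mult_mono) auto
    then have "norm (G s) < (c + a) * exp (a + b) / 2" "norm (H s) < (c + a) * exp (a + b) / 2"
      using s by auto
    from coefficients_less[OF \<kappa> mono prim c s(1) x s(2) this[unfolded a_def b_def]]
    show ?thesis unfolding A_def B_def .
  qed
  have lim: "((\<lambda>c. (c + A) * exp (A + B) / 2) \<longlongrightarrow> (0 + A) * exp (A + B) / 2) (at_right 0)"
    by (intro tendsto_intros) simp
  have ev: "\<forall>\<^sub>F c in at_right 0. norm (G x) \<le> (c + A) * exp (A + B) / 2"
    "\<forall>\<^sub>F c in at_right 0. norm (H x) \<le> (c + A) * exp (A + B) / 2"
    using lt by (auto intro!: eventually_mono[OF eventually_at_right_less[of 0]] less_imp_le)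
  show "norm (G x) \<le> A * exp (A + B) / 2" "norm (H x) \<le> A * exp (A + B) / 2"
    using tendsto_lowerbound[OF lim ev(1)] tendsto_lowerbound[OF lim ev(2)] by simp_all
qed

lemma error_bounds:
  assumes b: "b \<in> I" "\<And>x. x \<in> I \<Longrightarrow> x \<le> b"
    and mono: "\<And>x y. x \<in> I \<Longrightarrow> y \<in> I \<Longrightarrow> x \<le> y \<Longrightarrow> Re (\<Theta> x) \<le> Re (\<Theta> y)"
    and fin: "bound_finite \<sigma> \<phi> \<psi> n u t I"
    and small: "\<And>c. c > 0 \<Longrightarrow> \<exists>s\<in>I. norm (G s) < c / 2 \<and> norm (H s) < c / 2"
  defines "\<epsilon> \<equiv> \<lambda>z. exp (- S (el b) z) * w b z - exp (\<theta> (el b) z)"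
  shows "norm (\<epsilon> (t b)) \<le> error_bound \<sigma> \<phi> \<psi> n u (e 0 b) t I (t b)"
    and "norm (1 / (u + \<phi> (t b) / 2) * deriv \<epsilon> (t b)) \<le> error_bound \<sigma> \<phi> \<psi> n u (e 0 b) t I (t b)"
proof -
  define \<kappa> where "\<kappa> = kappa0 \<phi> u (t ` I)"
  define \<kappa>2 where "\<kappa>2 = kappa2 \<phi> (t ` I)"
  have \<kappa>: "1 / norm (1 + \<phi> (t x) / (2 * u)) \<le> \<kappa>" if "x \<in> I" for x
    unfolding \<kappa>_def kappa0_def by (rule cSUP_upper) (use fin that in \<open>auto simp: bound_finite_def\<close>)
  have "norm (\<phi> (t b)) \<le> \<kappa>2"
    unfolding \<kappa>2_def kappa2_def by (rule cSUP_upper) (use fin b in \<open>auto simp: bound_finite_def\<close>)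
  then have \<kappa>2: "0 \<le> \<kappa>2" by (rule order_trans[OF norm_ge_zero])
  have \<kappa>0: "0 \<le> \<kappa>" using \<kappa>[OF b(1)] by (rule order_trans[rotated]) simp
  have int: "arc_integrable t I chi" "arc_integrable t I T" "arc_integrable t I (deriv \<phi>)"
    using fin by (auto simp: bound_finite_def chi_def T_def)
  have Ib: "I \<inter> {..b} = I" using b by auto
  define A where "A = \<kappa> / norm u ^ n * arc_integral t I chi"
  define B where "B = 2 / norm u * arc_integral t I T + \<kappa> / (2 * norm u) * arc_integral t I (deriv \<phi>)"
  define M where "M = 1 / norm u * (2 + 2 * \<kappa> + \<kappa> * \<kappa>2 / norm u) * arc_integral t I T
     + \<kappa> / norm u * arc_integral t I (deriv \<phi>) + A"
  have GH: "norm (G b) \<le> A * exp (A + B) / 2" "norm (H b) \<le> A * exp (A + B) / 2" and A0: "0 \<le> A"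
    using coefficient_bounds[OF \<kappa> mono int _ b(1)] small b(2) unfolding Ib A_def B_def by blast+
  have nn: "0 \<le> arc_integral t I T" "0 \<le> arc_integral t I (deriv \<phi>)"
    unfolding arc_integral_def using int
    by (auto intro!: Henstock_Kurzweil_Integration.integral_nonneg simp: arc_integrable_def arc_density_nonneg)
  \<comment> \<open>The exponent \<open>M\<close> of the stated bound exceeds A + B by multiples of
    the integrals of |T| and |\<phi>'| whose coefficients are nonnegative.\<close>
  have "A + B \<le> M"
  proof -
    have "0 \<le> (2 * \<kappa> + \<kappa> * \<kappa>2 / norm u) / norm u * arc_integral t I T" using nn \<kappa>0 \<kappa>2 by simp
    moreover have "0 \<le> \<kappa> / (2 * norm u) * arc_integral t I (deriv \<phi>)" using nn \<kappa>0 by simp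
    moreover have "M - (A + B) = (2 * \<kappa> + \<kappa> * \<kappa>2 / norm u) / norm u * arc_integral t I T
        + \<kappa> / (2 * norm u) * arc_integral t I (deriv \<phi>)"
      using u_nz by (simp add: M_def B_def field_simps)
    ultimately show ?thesis by linarith
  qed
  then have AM: "A * exp (A + B) \<le> A * exp M" using A0 by (intro mult_left_mono) auto
  have eb: "error_bound \<sigma> \<phi> \<psi> n u (e 0 b) t I (t b) = norm (exp (\<Theta> b)) * (A * exp M)"
    unfolding error_bound_def Let_def A_def M_def \<kappa>_def[symmetric] \<kappa>2_def[symmetric] chi_def[symmetric] T_def[symmetric]
    by (simp add: \<Theta>_def \<theta>_def norm_divide norm_power)
  \<comment> \<open>One estimate for both claims: the error involves G + H, its scaled derivative G
    - H, and both moduli are at most |G| + |H|.\<close>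
  have le: "norm (exp (\<Theta> b)) * x \<le> error_bound \<sigma> \<phi> \<psi> n u (e 0 b) t I (t b)" if "x \<le> norm (G b) + norm (H b)" for x
    unfolding eb using that GH AM by (intro mult_left_mono) auto
  have \<epsilon>: "\<epsilon> (t b) = exp (\<Theta> b) * (G b + H b)" "deriv \<epsilon> (t b) = exp (\<Theta> b) * p (t b) * (G b - H b)"
    unfolding \<epsilon>_def by (rule error_identities[OF b(1)])+
  show "norm (\<epsilon> (t b)) \<le> error_bound \<sigma> \<phi> \<psi> n u (e 0 b) t I (t b)"
    unfolding \<epsilon>(1) norm_mult by (rule le[OF norm_triangle_ineq])
  have "norm (1 / (u + \<phi> (t b) / 2) * deriv \<epsilon> (t b)) = norm (exp (\<Theta> b)) * norm (G b - H b)"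
    using p_nonzero[OF b(1)] unfolding \<epsilon>(2) by (simp add: p_def norm_mult norm_divide norm_sigma)
  also have "\<dots> \<le> error_bound \<sigma> \<phi> \<psi> n u (e 0 b) t I (t b)" by (rule le[OF norm_triangle_ineq4])
  finally show "norm (1 / (u + \<phi> (t b) / 2) * deriv \<epsilon> (t b)) \<le> error_bound \<sigma> \<phi> \<psi> n u (e 0 b) t I (t b)" .
qed

end

section \<open>Solutions singled out at the reference point\<close>

context liouville_green
begin

lemma solves_near_iff: "solves_near u \<phi> \<psi> w a \<longleftrightarrow> ode_germ q w a"
  by (simp add: solves_near_def ode_germ_def q_def)

lemma coefficients_cong:
  assumes "w z = w' z" "deriv w z = deriv w' z" "\<And>s. s < n \<Longrightarrow> e s z = e' s z"
  shows "gG w e z = gG w' e' z" "gH w e z = gH w' e' z"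
proof -
  have "S e z = S e' z" "\<theta> e z = \<theta> e' z"
    using assms(3) n_pos by (auto simp: LG_S_def \<theta>_def intro!: sum.cong)
  then show "gG w e z = gG w' e' z" "gH w e z = gH w' e' z"
    using assms(1,2) by (simp_all add: gG_def gH_def gY_def gZ_def gE_def)
qed

text \<open>Inverts the passage from the solution and its derivative to g and h, so that limits of
  the coefficients become limits of initial data.\<close>

lemma data_from_coefficients:
  assumes "p z \<noteq> 0"
  shows "w z = (1 + gG w e z + gH w e z) * exp (S e z + \<theta> e z)"
    and "deriv w z = (p z * (1 + gG w e z - gH w e z) + V z * (1 + gG w e z + gH w e z)) * exp (S e z + \<theta> e z)"
proof -
  have E: "gE e z * exp (S e z + \<theta> e z) = 1" by (simp add: gE_def flip: exp_add)
  have Y: "1 + gG w e z + gH w e z = gY w e z" and Z: "1 + gG w e z - gH w e z = gZ w e z"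
    by (simp_all add: gG_def gH_def field_simps)
  show w: "w z = (1 + gG w e z + gH w e z) * exp (S e z + \<theta> e z)"
    unfolding Y gY_def using E by (simp add: mult.assoc)
  show "deriv w z = (p z * (1 + gG w e z - gH w e z) + V z * (1 + gG w e z + gH w e z)) * exp (S e z + \<theta> e z)"
    unfolding Z gZ_mult[OF assms] Y gY_def using E by (simp add: algebra_simps)
qed

text \<open>The hypotheses say that the solution agrees with exp(S + \<theta>) to first order at
  \<open>z\<close>.\<close>

lemma coefficients_vanish:
  assumes "p z \<noteq> 0" "w z = exp (S e z + \<theta> e z)" "deriv w z = (p z + V z) * exp (S e z + \<theta> e z)"
  shows "gG w e z = 0" "gH w e z = 0"
proof -
  have E: "exp (S e z + \<theta> e z) * gE e z = 1" by (simp add: gE_def flip: exp_add)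
  have "gY w e z = 1" using E assms(2) by (simp add: gY_def)
  moreover have "p z * gZ w e z = p z * 1"
    unfolding gZ_mult[OF assms(1)] using E assms(2,3) by (simp add: algebra_simps)
  then have "gZ w e z = 1" using assms(1) by simp
  ultimately show "gG w e z = 0" "gH w e z = 0" by (simp_all add: gG_def gH_def)
qed

text \<open>On a simply connected domain the germs are taken from one global solution, as a constant
  family; otherwise the data are continued along the reference curve.\<close>

lemma reference_solution:
  assumes ref: "ref_point_in \<Delta> \<alpha>" and s: "s \<in> ref_dom \<alpha>"
  obtains W where "continued_along (ref_curve \<alpha>) (ref_dom \<alpha>) W"
    "\<And>x. x \<in> ref_dom \<alpha> \<Longrightarrow> ode_germ q (W x) (ref_curve \<alpha> x)"
    "simply_connected \<Delta> \<Longrightarrow> \<exists>w. w holomorphic_on \<Delta> \<and> (\<forall>z\<in>\<Delta>. deriv (deriv w) z = q z * w z) \<and> (\<forall>x\<in>ref_dom \<alpha>. W x = w)"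
    "W s (ref_curve \<alpha> s) = c0" "deriv (W s) (ref_curve \<alpha> s) = c1"
proof (cases "simply_connected \<Delta>")
  case True
  note ref_curve_regular = ref_curve_regular[OF ref]
  have cs: "ref_curve \<alpha> s \<in> \<Delta>" using ref_curve_regular(3) s by blast
  obtain w where w: "w holomorphic_on \<Delta>" "w (ref_curve \<alpha> s) = c0" "deriv w (ref_curve \<alpha> s) = c1"
    "\<And>z. z \<in> \<Delta> \<Longrightarrow> deriv (deriv w) z = q z * w z"
    using linear_ode_simply_connected[OF open_dom True hol_q cs] by blast
  have og: "ode_germ q w (ref_curve \<alpha> x)" if "x \<in> ref_dom \<alpha>" for x
    by (rule ode_germ_if_solution[OF open_dom w(1,4)]) (use ref_curve_regular(3) that in auto)
  show ?thesis
  proof (rule that[of "\<lambda>_. w"])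
    show "continued_along (ref_curve \<alpha>) (ref_dom \<alpha>) (\<lambda>_. w)"
      using og by (intro continued_along_const) (auto simp: ode_germ_def)
  qed (use og w in auto)
next
  case False
  show ?thesis
    by (rule ode_solution_from_data[OF open_dom hol_q ref_curve_regular[OF ref] s, of c0 c1])
       (rule that, use False in auto)
qed

lemma continuation_exists:
  assumes path: "path_from \<Delta> \<alpha> t b \<xi>"
    and W: "continued_along (ref_curve \<alpha>) (ref_dom \<alpha>) W" "\<And>x. x \<in> ref_dom \<alpha> \<Longrightarrow> ode_germ q (W x) (ref_curve \<alpha> x)"
  obtains WL where "continuation_from \<alpha> W t b WL" "\<And>x. x \<in> path_dom \<alpha> b \<Longrightarrow> ode_germ q (WL x) (t x)"
proof -
  have t: "continuous_on (path_dom \<alpha> b) t" "t ` path_dom \<alpha> b \<subseteq> \<Delta>"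
    using path R2_chain_continuous by (auto simp: path_from_def)
  note cont = ode_continuation[OF open_dom hol_q connected_path_dom t]
  show ?thesis
  proof (cases \<alpha>)
    case (Finite_Point a)
    obtain s where s: "s \<in> path_dom \<alpha> b" "s \<in> ref_dom \<alpha>" "t s = ref_curve \<alpha> s"
      using path_from_base[OF path, of "\<lambda>_. True"] by auto
    obtain f where f: "continued_along t (path_dom \<alpha> b) f" "\<And>x. x \<in> path_dom \<alpha> b \<Longrightarrow> ode_germ q (f x) (t x)"
      "\<forall>\<^sub>F z in nhds (t s). f s z = W s z"
      using cont[OF s(1)] W(2)[OF s(2)] s(3) by metis
    then show ?thesis
      using s Finite_Point by (intro that[of f]) (auto simp: continuation_from_def eventually_principal)
  next
    case (Infinite_End A)
    have "\<forall>\<^sub>F x in at_bot. t x = A x \<and> x \<le> b \<and> x \<le> 0"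
      using path Infinite_End by (auto simp: path_from_def eventually_conj_iff eventually_le_at_bot)
    \<comment> \<open>Below \<open>N\<close> the path is the reference arc itself. It suffices to
      match the germ at \<open>N\<close>; uniqueness then gives agreement at all smaller
      parameters.\<close>
    then obtain N where N: "\<And>x. x \<le> N \<Longrightarrow> t x = A x \<and> x \<le> b \<and> x \<le> 0"
      unfolding eventually_at_bot_linorder by blast
    have NI: "N \<in> path_dom \<alpha> b" using N[of N] Infinite_End by simp
    have "ode_germ q (W N) (t N)" using W(2)[of N] N[of N] Infinite_End by simp
    from cont[OF NI this] obtain f where f: "continued_along t (path_dom \<alpha> b) f"
      "\<And>x. x \<in> path_dom \<alpha> b \<Longrightarrow> ode_germ q (f x) (t x)" "\<forall>\<^sub>F z in nhds (t N). f N z = W N z"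
      by blast
    have sub: "{..N} \<subseteq> path_dom \<alpha> b" using N Infinite_End by auto
    have WN: "continued_along t {..N} W"
    proof (rule continued_along_cong_path)
      show "continued_along A {..N} W"
        using W(1) Infinite_End N by (auto intro: continued_along_subset)
    qed (use N in auto)
    have "\<forall>\<^sub>F z in nhds (t x). f x z = W x z" if "x \<le> N" for x
      by (rule continued_along_unique[OF _ continuous_on_subset[OF t(1) sub]
            continued_along_subset[OF f(1) sub] WN _ f(3)]) (use that in \<open>auto intro: convex_connected\<close>)
    then show ?thesis
      using f Infinite_End
      by (intro that[of f]) (auto simp: continuation_from_def eventually_at_bot_linorder)
  qed
qed

lemma branch_derivative:
  assumes ref: "ref_point_in \<Delta> \<alpha>" and path: "path_from \<Delta> \<alpha> t b \<xi>"
    and e: "antiderivative_branch \<alpha> (F s) e" and f: "continuation_from \<alpha> e t b f" and x: "x \<in> path_dom \<alpha> b"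
  shows "\<forall>\<^sub>F z in nhds (t x). (f x has_field_derivative F s z) (at z)"
proof -
  have t: "continuous_on (path_dom \<alpha> b) t" "t ` path_dom \<alpha> b \<subseteq> \<Delta>"
    using path R2_chain_continuous by (auto simp: path_from_def)
  have "\<forall>\<^sub>F \<tau> in ref_filter \<alpha>. \<forall>\<^sub>F z in nhds (t \<tau>). f \<tau> z = e \<tau> z"
    using f by (simp add: continuation_from_def)
  from path_from_base[OF path this] obtain y where y: "y \<in> path_dom \<alpha> b" "y \<in> ref_dom \<alpha>" "t y = ref_curve \<alpha> y"
    "\<forall>\<^sub>F z in nhds (t y). f y z = e y z" by blast
  have "\<forall>\<^sub>F z in nhds (t y). (e y has_field_derivative F s z) (at z)"
    using e y by (simp add: antiderivative_branch_def)
  with eventually_nhds_transfer[OF y(4)]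
  have base: "\<forall>\<^sub>F z in nhds (t y). (f y has_field_derivative F s z) (at z)"
  proof eventually_elim
    case (elim z)
    then show ?case using DERIV_cong_ev[OF refl elim(1) refl] by simp
  qed
  show ?thesis
    by (rule continued_along_antiderivative[where t = t and f = f, OF open_dom hol_F connected_path_dom t _ y(1) base x])
       (use f in \<open>simp add: continuation_from_def\<close>)
qed

text \<open>The result is a pair of initial data at \<open>N\<close>, not a solution: every
  continuation with these data decays, so the decaying solution may later be taken to be a global
  one.\<close>

lemma solution_from_infinity:
  assumes arc: "R2_arc A {..N}" and dom: "A ` {..N} \<subseteq> \<Delta>"
    and e_cont: "\<And>s. continued_along A {..N} (e s)"
    and e_der: "\<And>x s. x \<le> N \<Longrightarrow> \<forall>\<^sub>F z in nhds (A x). (e s x has_field_derivative F s z) (at z)"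
    and p_nz: "\<And>x. x \<le> N \<Longrightarrow> 1 + \<phi> (A x) / (2 * u) \<noteq> 0"
    and \<kappa>: "\<And>x. x \<le> N \<Longrightarrow> 1 / norm (1 + \<phi> (A x) / (2 * u)) \<le> \<kappa>"
    and mono: "\<And>x y. x \<le> y \<Longrightarrow> y \<le> N \<Longrightarrow> Re (\<theta> (\<lambda>s. e s x) (A x)) \<le> Re (\<theta> (\<lambda>s. e s y) (A y))"
    and int: "arc_integrable A {..N} chi" "arc_integrable A {..N} T" "arc_integrable A {..N} (deriv \<phi>)"
  shows "\<exists>c0 c1. \<forall>W. continued_along A {..N} W \<longrightarrow> (\<forall>x\<le>N. ode_germ q (W x) (A x)) \<longrightarrow>
       W N (A N) = c0 \<longrightarrow> deriv (W N) (A N) = c1 \<longrightarrow>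
       ((\<lambda>x. gG (W x) (\<lambda>s. e s x) (A x)) \<longlongrightarrow> 0) at_bot \<and> ((\<lambda>x. gH (W x) (\<lambda>s. e s x) (A x)) \<longlongrightarrow> 0) at_bot"
proof -
  have conn: "connected {..N}" by (simp add: convex_connected)
  have Ac: "continuous_on {..N} A" using arc by (rule R2_arc_continuous)
  have loc: "liouville_green_path \<Delta> \<phi> \<psi> n u \<sigma> A {..N} e W"
    if "continued_along A {..N} W" "\<And>x. x \<le> N \<Longrightarrow> ode_germ q (W x) (A x)" for W
    by unfold_locales (use that arc dom e_cont e_der p_nz in \<open>auto intro: R2_chain.ray\<close>)
  have pz: "p (A x) \<noteq> 0" if "x \<le> N" for x
    using p_nz[OF that] sigma_nz u_nz by (simp add: p_eq)
  define a where "a x = \<kappa> / norm u ^ n * arc_integral A ({..N} \<inter> {..x}) chi" for x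
  define b where "b x = 2 / norm u * arc_integral A ({..N} \<inter> {..x}) T + \<kappa> / (2 * norm u) * arc_integral A ({..N} \<inter> {..x}) (deriv \<phi>)" for x
  \<comment> \<open>A common bound for g and h at \<open>x\<close>. It tends to 0 because the
    integrals over \<open>{..x}\<close> are tails of convergent ones.\<close>
  define m where "m x = a x * exp (a x + b x) / 2" for x
  have "(m \<longlongrightarrow> (\<kappa> / norm u ^ n * 0) * exp (\<kappa> / norm u ^ n * 0 + (2 / norm u * 0 + \<kappa> / (2 * norm u) * 0)) / 2) at_bot"
    unfolding m_def a_def b_def using u_nz
    by (intro tendsto_intros arc_integral_tendsto_at_bot int) auto
  then have m0: "(m \<longlongrightarrow> 0) at_bot" by simp
  define E where "E x = exp (S (\<lambda>s. e s x) (A x) + \<theta> (\<lambda>s. e s x) (A x))" for x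
  \<comment> \<open>\<open>v\<close> is the solution that agrees with exp(S + \<theta>) to first
    order at the parameter \<open>N - real k\<close>, so that g and h vanish there.\<close>
  define Q where "Q k v \<longleftrightarrow> continued_along A {..N} v \<and> (\<forall>x\<le>N. ode_germ q (v x) (A x)) \<and>
      v (N - real k) (A (N - real k)) = E (N - real k) \<and>
      deriv (v (N - real k)) (A (N - real k)) = (p (A (N - real k)) + V (A (N - real k))) * E (N - real k)" for k v
  have "\<exists>v. Q k v" for k
  proof -
    have "N - real k \<in> {..N}" by simp
    from ode_solution_from_data[OF open_dom hol_q conn Ac dom this, of "E (N - real k)"
        "(p (A (N - real k)) + V (A (N - real k))) * E (N - real k)"]
    obtain v where "continued_along A {..N} v" "\<And>x. x \<in> {..N} \<Longrightarrow> ode_germ q (v x) (A x)"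
      "v (N - real k) (A (N - real k)) = E (N - real k)"
      "deriv (v (N - real k)) (A (N - real k)) = (p (A (N - real k)) + V (A (N - real k))) * E (N - real k)"
      by blast
    then show ?thesis unfolding Q_def by (intro exI[of _ v]) simp
  qed
  then obtain v where Qv: "\<And>k. Q k (v k)" by metis
  have v: "continued_along A {..N} (v k)" "\<And>x. x \<le> N \<Longrightarrow> ode_germ q (v k x) (A x)"
    "v k (N - real k) (A (N - real k)) = E (N - real k)"
    "deriv (v k (N - real k)) (A (N - real k)) = (p (A (N - real k)) + V (A (N - real k))) * E (N - real k)" for k
    using Qv[of k] by (simp_all add: Q_def)
  have bound: "norm (gG (v k x) (\<lambda>s. e s x) (A x)) \<le> m x \<and> norm (gH (v k x) (\<lambda>s. e s x) (A x)) \<le> m x"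
    if x: "N - real k \<le> x" "x \<le> N" for k x
  proof -
    interpret K: liouville_green_path \<Delta> \<phi> \<psi> n u \<sigma> A "{..N}" e "v k" by (rule loc) (use v in auto)
    have "K.G (N - real k) = 0" "K.H (N - real k) = 0"
      unfolding K.G_def K.H_def
      by (rule coefficients_vanish[OF pz]; simp add: v(3,4) E_def)+
    then have "\<exists>s\<in>{..N}. s \<le> x \<and> norm (K.G s) < c / 2 \<and> norm (K.H s) < c / 2" if "c > 0" for c
      using x that by (intro bexI[of _ "N - real k"]) auto
    from K.coefficient_bounds(1,2)[where \<kappa> = \<kappa>, OF _ _ int this] \<kappa> mono x(2)
    show ?thesis unfolding m_def a_def b_def K.G_def K.H_def K.\<Theta>_def by auto
  qed
  \<comment> \<open>Compactness is needed only for the pair of coefficients at \<open>N\<close>,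
    which stays in a bounded set because \<open>m N\<close> does not depend on
    \<open>k\<close>.\<close>
  define g where "g k = (gG (v k N) (\<lambda>s. e s N) (A N), gH (v k N) (\<lambda>s. e s N) (A N))" for k
  have "bounded (range g)"
    unfolding bounded_iff
  proof (intro exI ballI)
    fix y assume "y \<in> range g"
    then obtain k where "y = g k" by blast
    then show "norm y \<le> m N + m N"
      using bound[of k N] norm_Pair_le[of "fst y" "snd y"] by (simp add: g_def)
  qed
  then obtain l r where r: "strict_mono (r :: nat \<Rightarrow> nat)" "(g \<circ> r) \<longlonglongrightarrow> l"
    using bounded_imp_convergent_subsequence by blast
  have gl: "(\<lambda>k. gG (v (r k) N) (\<lambda>s. e s N) (A N)) \<longlonglongrightarrow> fst l" "(\<lambda>k. gH (v (r k) N) (\<lambda>s. e s N) (A N)) \<longlonglongrightarrow> snd l"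
    using tendsto_fst[OF r(2)] tendsto_snd[OF r(2)] by (simp_all add: g_def o_def)
  define c0 where "c0 = (1 + fst l + snd l) * E N"
  define c1 where "c1 = (p (A N) * (1 + fst l - snd l) + V (A N) * (1 + fst l + snd l)) * E N"
  have c0: "(\<lambda>k. v (r k) N (A N)) \<longlonglongrightarrow> c0"
    unfolding data_from_coefficients(1)[OF pz[OF order_refl], of "v k N" "\<lambda>s. e s N" for k] c0_def E_def
    by (intro tendsto_intros gl)
  have c1: "(\<lambda>k. deriv (v (r k) N) (A N)) \<longlonglongrightarrow> c1"
    unfolding data_from_coefficients(2)[OF pz[OF order_refl], of "v k N" "\<lambda>s. e s N" for k] c1_def E_def
    by (intro tendsto_intros gl)
  obtain f1 where f1: "continued_along A {..N} f1" "\<And>x. x \<in> {..N} \<Longrightarrow> ode_germ q (f1 x) (A x)"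
    "f1 N (A N) = 1" "deriv (f1 N) (A N) = 0"
    using ode_solution_from_data[OF open_dom hol_q conn Ac dom, of N 1 0] by auto
  obtain f2 where f2: "continued_along A {..N} f2" "\<And>x. x \<in> {..N} \<Longrightarrow> ode_germ q (f2 x) (A x)"
    "f2 N (A N) = 0" "deriv (f2 N) (A N) = 1"
    using ode_solution_from_data[OF open_dom hol_q conn Ac dom, of N 0 1] by auto
  have N: "N \<in> {..N}" by simp
  show ?thesis
  proof (rule exI[of _ c0], rule exI[of _ c1], intro allI impI)
    fix W assume "continued_along A {..N} W" "\<forall>x\<le>N. ode_germ q (W x) (A x)"
      "W N (A N) = c0" "deriv (W N) (A N) = c1"
    then have W: "continued_along A {..N} W" "\<And>x. x \<le> N \<Longrightarrow> ode_germ q (W x) (A x)"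
      "W N (A N) = c0" "deriv (W N) (A N) = c1" by auto
    have lin: "h x (A x) = h N (A N) * f1 x (A x) + deriv (h N) (A N) * f2 x (A x)"
        "deriv (h x) (A x) = h N (A N) * deriv (f1 x) (A x) + deriv (h N) (A N) * deriv (f2 x) (A x)"
      if "x \<le> N" "continued_along A {..N} h" "\<And>x. x \<le> N \<Longrightarrow> ode_germ q (h x) (A x)" for x h
      by (rule ode_solution_linear[OF open_dom hol_q conn Ac dom N _ f1 f2]; use that in auto)+
    have le: "norm (gG (W x) (\<lambda>s. e s x) (A x)) \<le> m x \<and> norm (gH (W x) (\<lambda>s. e s x) (A x)) \<le> m x" if x: "x \<le> N" for x
    proof -
      have linv: "v k x (A x) = v k N (A N) * f1 x (A x) + deriv (v k N) (A N) * f2 x (A x)"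
          "deriv (v k x) (A x) = v k N (A N) * deriv (f1 x) (A x) + deriv (v k N) (A N) * deriv (f2 x) (A x)" for k
        by (rule lin[OF x], use v in auto)+
      have linW: "W x (A x) = c0 * f1 x (A x) + c1 * f2 x (A x)"
          "deriv (W x) (A x) = c0 * deriv (f1 x) (A x) + c1 * deriv (f2 x) (A x)"
        unfolding W(3,4)[symmetric] by (rule lin[OF x], use W in auto)+
      have l1: "(\<lambda>k. v (r k) x (A x)) \<longlonglongrightarrow> W x (A x)"
        unfolding linv linW by (intro tendsto_intros c0 c1)
      have l2: "(\<lambda>k. deriv (v (r k) x) (A x)) \<longlonglongrightarrow> deriv (W x) (A x)"
        unfolding linv linW by (intro tendsto_intros c0 c1)
      have lG: "(\<lambda>k. gG (v (r k) x) (\<lambda>s. e s x) (A x)) \<longlonglongrightarrow> gG (W x) (\<lambda>s. e s x) (A x)"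
        and lH: "(\<lambda>k. gH (v (r k) x) (\<lambda>s. e s x) (A x)) \<longlonglongrightarrow> gH (W x) (\<lambda>s. e s x) (A x)"
        unfolding gG_def gH_def gY_def gZ_def using pz[OF x] by (intro tendsto_intros l1 l2; simp)+
      \<comment> \<open>The bound at \<open>x\<close> is available for \<open>v k\<close> once its
        starting parameter lies to the left of \<open>x\<close>. As \<open>r k\<close> is at least
        \<open>k\<close>, this holds for all large \<open>k\<close> of the subsequence.\<close>
      obtain K :: nat where K: "N - x \<le> real K" using real_arch_simple by blast
      have ev: "\<forall>k\<ge>K. norm (gG (v (r k) x) (\<lambda>s. e s x) (A x)) \<le> m x \<and> norm (gH (v (r k) x) (\<lambda>s. e s x) (A x)) \<le> m x"
      proof (intro allI impI)
        fix k assume "K \<le> k"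
        then have "real K \<le> real (r k)" using seq_suble[OF r(1), of k] by simp
        then show "norm (gG (v (r k) x) (\<lambda>s. e s x) (A x)) \<le> m x \<and> norm (gH (v (r k) x) (\<lambda>s. e s x) (A x)) \<le> m x"
          using bound[of "r k" x] K x by linarith
      qed
      then show ?thesis
        using Lim_bounded[OF tendsto_norm[OF lG]] Lim_bounded[OF tendsto_norm[OF lH]] by blast
    qed
    have ev: "\<forall>\<^sub>F x in at_bot. x \<le> N" by (rule eventually_le_at_bot)
    show "((\<lambda>x. gG (W x) (\<lambda>s. e s x) (A x)) \<longlongrightarrow> 0) at_bot \<and> ((\<lambda>x. gH (W x) (\<lambda>s. e s x) (A x)) \<longlongrightarrow> 0) at_bot"
    proof
      show "((\<lambda>x. gG (W x) (\<lambda>s. e s x) (A x)) \<longlongrightarrow> 0) at_bot"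
        by (rule Lim_null_comparison[OF eventually_mono[OF ev] m0]) (use le in blast)
      show "((\<lambda>x. gH (W x) (\<lambda>s. e s x) (A x)) \<longlongrightarrow> 0) at_bot"
        by (rule Lim_null_comparison[OF eventually_mono[OF ev] m0]) (use le in blast)
    qed
  qed
qed

end

section \<open>One solution for all paths from the reference point\<close>

context liouville_green
begin

text \<open>What an admissible path with a finite bound forces on the part of the fixed arc that it
  shares. The condition mentions no path, so the solution can be chosen by cases on it in
  advance.\<close>

definition tame_at_infinity :: "(real \<Rightarrow> complex) \<Rightarrow> (nat \<Rightarrow> real \<Rightarrow> complex \<Rightarrow> complex) \<Rightarrow> real \<Rightarrow> bool" where
  "tame_at_infinity A e N \<longleftrightarrow> N \<le> 0 \<and> arc_integrable A {..N} chi \<and> arc_integrable A {..N} T \<and>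
     arc_integrable A {..N} (deriv \<phi>) \<and> (\<forall>x\<le>N. 1 + \<phi> (A x) / (2 * u) \<noteq> 0) \<and>
     (\<exists>\<kappa>. \<forall>x\<le>N. 1 / norm (1 + \<phi> (A x) / (2 * u)) \<le> \<kappa>) \<and>
     (\<forall>x y. x \<le> y \<longrightarrow> y \<le> N \<longrightarrow> Re (\<theta> (\<lambda>s. e s x) (A x)) \<le> Re (\<theta> (\<lambda>s. e s y) (A y)))"

lemma tame_at_infinity_if_admissible:
  assumes path: "admissible_path \<Delta> u j (Infinite_End A) (e 0) t b (f 0) \<xi>" and sg: "(- 1) ^ j = - \<sigma>"
    and f: "continuation_from (Infinite_End A) (e 0) t b (f 0)"
    and fin: "bound_finite \<sigma> \<phi> \<psi> n u t {..b}"
  shows "\<exists>N. tame_at_infinity A e N"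
proof -
  have "\<forall>\<^sub>F x in at_bot. t x = A x \<and> (\<forall>\<^sub>F z in nhds (t x). f 0 x z = e 0 x z) \<and> x \<le> b \<and> x \<le> 0"
    using path f by (auto simp: admissible_path_def path_from_def continuation_from_def eventually_conj_iff eventually_le_at_bot)
  then obtain N where N: "\<And>x. x \<le> N \<Longrightarrow> t x = A x \<and> (\<forall>\<^sub>F z in nhds (t x). f 0 x z = e 0 x z) \<and> x \<le> b \<and> x \<le> 0"
    unfolding eventually_at_bot_linorder by blast
  have tA: "t x = A x" if "x \<le> N" for x using N[OF that] by simp
  have Nb: "N \<le> b" "N \<le> 0" using N[of N] by auto
  have int: "arc_integrable A {..N} h" if "arc_integrable t {..b} h" for h
  proof -
    have "arc_integrable t {..N} h" using that Nb by (auto intro: arc_integrable_subset)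
    then show ?thesis using arc_integrable_cong_path[of N t A h] tA by simp
  qed
  have nz: "1 + \<phi> (A x) / (2 * u) \<noteq> 0" if "x \<le> N" for x
    using fin that Nb tA[OF that, symmetric] by (auto simp: bound_finite_def)
  have "bdd_above ((\<lambda>z. 1 / norm (1 + \<phi> z / (2 * u))) ` t ` {..b})"
    using fin by (simp add: bound_finite_def)
  then obtain \<kappa> where \<kappa>: "\<And>x. x \<le> b \<Longrightarrow> 1 / norm (1 + \<phi> (t x) / (2 * u)) \<le> \<kappa>"
    unfolding bdd_above_def by auto
  have \<kappa>A: "1 / norm (1 + \<phi> (A x) / (2 * u)) \<le> \<kappa>" if "x \<le> N" for x
    using \<kappa>[of x] tA[OF that] that Nb by simp
  \<comment> \<open>As \<open>(- 1) ^ j = - \<sigma>\<close>, the quantity required to be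
    nonincreasing is - Re \<theta>.\<close>
  have mono: "Re (\<theta> (\<lambda>s. e s x) (A x)) \<le> Re (\<theta> (\<lambda>s. e s y) (A y))" if xy: "x \<le> y" "y \<le> N" for x y
  proof -
    have eq: "f 0 x (A x) = e 0 x (A x)" if "x \<le> N" for x
      using N[OF that] germ_values(1)[where a = "t x" and f = "f 0 x" and g = "e 0 x"] by auto
    have "Re ((- 1) ^ j * u * t y - f 0 y (t y)) \<le> Re ((- 1) ^ j * u * t x - f 0 x (t x))"
      using path xy Nb by (auto simp: admissible_path_def monotone_on_def)
    then show ?thesis using xy eq[of x] eq[of y] tA[of x] tA[of y] by (simp add: sg \<theta>_def)
  qed
  show ?thesis
    unfolding tame_at_infinity_def using fin Nb int nz \<kappa>A mono
    by (intro exI[of _ N]) (auto simp: bound_finite_def chi_def T_def)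
qed

text \<open>The last property supplies the starting smallness for the coefficient bounds, for every
  path at once, although the solution is chosen from \<alpha> and the branches alone.\<close>

lemma reference_choice:
  assumes ref: "ref_point_in \<Delta> \<alpha>" and e: "\<And>s. antiderivative_branch \<alpha> (F s) (e s)" and sg: "(- 1) ^ j = - \<sigma>"
  obtains W where "continued_along (ref_curve \<alpha>) (ref_dom \<alpha>) W"
    "\<And>x. x \<in> ref_dom \<alpha> \<Longrightarrow> ode_germ q (W x) (ref_curve \<alpha> x)"
    "simply_connected \<Delta> \<Longrightarrow> \<exists>w. w holomorphic_on \<Delta> \<and> (\<forall>z\<in>\<Delta>. deriv (deriv w) z = q z * w z) \<and> (\<forall>x\<in>ref_dom \<alpha>. W x = w)"
    "\<And>t b f v \<xi> c. admissible_path \<Delta> u j \<alpha> (e 0) t b (f 0) \<xi> \<Longrightarrow> (\<And>s. continuation_from \<alpha> (e s) t b (f s)) \<Longrightarrow>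
      bound_finite \<sigma> \<phi> \<psi> n u t (path_dom \<alpha> b) \<Longrightarrow> continuation_from \<alpha> W t b v \<Longrightarrow> c > 0 \<Longrightarrow>
      \<exists>x\<in>path_dom \<alpha> b. norm (gG (v x) (\<lambda>s. f s x) (t x)) < c / 2 \<and> norm (gH (v x) (\<lambda>s. f s x) (t x)) < c / 2"
proof (cases \<alpha>)
  case (Finite_Point a)
  have 0: "0 \<in> ref_dom \<alpha>" using Finite_Point by simp
  let ?E = "exp (S (\<lambda>s. e s 0) a + \<theta> (\<lambda>s. e s 0) a)"
  obtain W where W: "continued_along (ref_curve \<alpha>) (ref_dom \<alpha>) W"
    "\<And>x. x \<in> ref_dom \<alpha> \<Longrightarrow> ode_germ q (W x) (ref_curve \<alpha> x)"
    "simply_connected \<Delta> \<Longrightarrow> \<exists>w. w holomorphic_on \<Delta> \<and> (\<forall>z\<in>\<Delta>. deriv (deriv w) z = q z * w z) \<and> (\<forall>x\<in>ref_dom \<alpha>. W x = w)"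
    "W 0 (ref_curve \<alpha> 0) = ?E" "deriv (W 0) (ref_curve \<alpha> 0) = (p a + V a) * ?E"
    by (rule reference_solution[OF ref 0, of ?E "(p a + V a) * ?E"]) (rule that; (assumption | blast))
  show ?thesis
  proof (rule that[OF W(1-3)])
    fix t b f v \<xi> and c :: real
    assume path: "admissible_path \<Delta> u j \<alpha> (e 0) t b (f 0) \<xi>" and f: "\<And>s. continuation_from \<alpha> (e s) t b (f s)"
      and fin: "bound_finite \<sigma> \<phi> \<psi> n u t (path_dom \<alpha> b)" and v: "continuation_from \<alpha> W t b v" and c: "c > 0"
    have pf: "path_from \<Delta> \<alpha> t b \<xi>" using path by (simp add: admissible_path_def)
    obtain s where "s \<in> path_dom \<alpha> b" "s \<in> ref_dom \<alpha>" "t s = ref_curve \<alpha> s"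
      using path_from_base[OF pf, of "\<lambda>_. True"] by auto
    then have 0: "0 \<in> path_dom \<alpha> b" "t 0 = a" using Finite_Point by auto
    \<comment> \<open>The initial data at \<open>a\<close> make sense even if \<open>p a\<close> is
      zero; that it is not is known only now, from a path with a finite bound.\<close>
    have "1 + \<phi> (t 0) / (2 * u) \<noteq> 0" using fin 0(1) unfolding bound_finite_def by blast
    then have pa: "p a \<noteq> 0" using 0(2) sigma_nz u_nz by (simp add: p_eq)
    have v0: "\<forall>\<^sub>F z in nhds a. v 0 z = W 0 z" and f0: "\<forall>\<^sub>F z in nhds a. f s 0 z = e s 0 z" for s
      using v f[of s] Finite_Point 0(2) by (auto simp: continuation_from_def eventually_principal)
    have "gG (W 0) (\<lambda>s. e s 0) a = 0" "gH (W 0) (\<lambda>s. e s 0) a = 0"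
      using W(4,5) Finite_Point by (auto intro: coefficients_vanish[OF pa])
    then have "gG (v 0) (\<lambda>s. f s 0) a = 0" "gH (v 0) (\<lambda>s. f s 0) a = 0"
      using coefficients_cong[of "v 0" a "W 0" "\<lambda>s. f s 0" "\<lambda>s. e s 0"] germ_values[OF v0] germ_values(1)[OF f0]
      by auto
    then show "\<exists>x\<in>path_dom \<alpha> b. norm (gG (v x) (\<lambda>s. f s x) (t x)) < c / 2 \<and> norm (gH (v x) (\<lambda>s. f s x) (t x)) < c / 2"
      using 0 c by (intro bexI[of _ 0]) auto
  qed
next
  case (Infinite_End A)
  have A: "R2_arc A {..0}" "A ` {..0} \<subseteq> \<Delta>" using ref Infinite_End by auto
  show ?thesis
  proof (cases "\<exists>N. tame_at_infinity A e N")
    case False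
    \<comment> \<open>No path from \<open>\<alpha>\<close> has a finite bound, so that any solution will do.\<close>
    have 0: "0 \<in> ref_dom \<alpha>" using Infinite_End by simp
    obtain W where W: "continued_along (ref_curve \<alpha>) (ref_dom \<alpha>) W"
      "\<And>x. x \<in> ref_dom \<alpha> \<Longrightarrow> ode_germ q (W x) (ref_curve \<alpha> x)"
      "simply_connected \<Delta> \<Longrightarrow> \<exists>w. w holomorphic_on \<Delta> \<and> (\<forall>z\<in>\<Delta>. deriv (deriv w) z = q z * w z) \<and> (\<forall>x\<in>ref_dom \<alpha>. W x = w)"
      by (rule reference_solution[OF ref 0]) (rule that; (assumption | blast))
    show ?thesis
    proof (rule that[OF W])
      fix t b f v \<xi> and c :: real
      assume path: "admissible_path \<Delta> u j \<alpha> (e 0) t b (f 0) \<xi>" and f: "\<And>s. continuation_from \<alpha> (e s) t b (f s)"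
        and fin: "bound_finite \<sigma> \<phi> \<psi> n u t (path_dom \<alpha> b)"
      have "\<exists>N. tame_at_infinity A e N"
        by (rule tame_at_infinity_if_admissible[OF _ sg]) (use path f[of 0] fin Infinite_End in auto)
      with False show "\<exists>x\<in>path_dom \<alpha> b. norm (gG (v x) (\<lambda>s. f s x) (t x)) < c / 2 \<and> norm (gH (v x) (\<lambda>s. f s x) (t x)) < c / 2"
        by contradiction
    qed
  next
    case True
    then obtain N where N: "tame_at_infinity A e N" by blast
    then have N0: "N \<in> ref_dom \<alpha>" "N \<le> 0" using Infinite_End by (auto simp: tame_at_infinity_def)
    obtain \<kappa> where \<kappa>: "\<And>x. x \<le> N \<Longrightarrow> 1 / norm (1 + \<phi> (A x) / (2 * u)) \<le> \<kappa>"
      using N unfolding tame_at_infinity_def by blast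
    have e': "continued_along A {..0} (e s)" "\<And>x. x \<le> 0 \<Longrightarrow> \<forall>\<^sub>F z in nhds (A x). (e s x has_field_derivative F s z) (at z)" for s
      using e[of s] Infinite_End by (auto simp: antiderivative_branch_def)
    have sub: "{..N} \<subseteq> {..0}" using N0 by auto
    have "\<exists>c0 c1. \<forall>W. continued_along A {..N} W \<longrightarrow> (\<forall>x\<le>N. ode_germ q (W x) (A x)) \<longrightarrow>
       W N (A N) = c0 \<longrightarrow> deriv (W N) (A N) = c1 \<longrightarrow>
       ((\<lambda>x. gG (W x) (\<lambda>s. e s x) (A x)) \<longlongrightarrow> 0) at_bot \<and> ((\<lambda>x. gH (W x) (\<lambda>s. e s x) (A x)) \<longlongrightarrow> 0) at_bot"
    proof (rule solution_from_infinity[of A N e \<kappa>])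
      show "R2_arc A {..N}" by (rule R2_arc_subset[OF A(1) sub])
      show "A ` {..N} \<subseteq> \<Delta>" by (rule subset_trans[OF image_mono[OF sub] A(2)])
      show "continued_along A {..N} (e s)" for s using e'(1) sub by (rule continued_along_subset)
      show "\<forall>\<^sub>F z in nhds (A x). (e s x has_field_derivative F s z) (at z)" if "x \<le> N" for x s
        using e'(2)[of x s] that N0 by simp
    qed (use N \<kappa> in \<open>simp_all add: tame_at_infinity_def\<close>)
    then obtain c0 c1 where decay: "\<And>W. continued_along A {..N} W \<Longrightarrow> (\<forall>x\<le>N. ode_germ q (W x) (A x)) \<Longrightarrow>
       W N (A N) = c0 \<Longrightarrow> deriv (W N) (A N) = c1 \<Longrightarrow>
       ((\<lambda>x. gG (W x) (\<lambda>s. e s x) (A x)) \<longlongrightarrow> 0) at_bot \<and> ((\<lambda>x. gH (W x) (\<lambda>s. e s x) (A x)) \<longlongrightarrow> 0) at_bot"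
      by blast
    obtain W where W: "continued_along (ref_curve \<alpha>) (ref_dom \<alpha>) W"
      "\<And>x. x \<in> ref_dom \<alpha> \<Longrightarrow> ode_germ q (W x) (ref_curve \<alpha> x)"
      "simply_connected \<Delta> \<Longrightarrow> \<exists>w. w holomorphic_on \<Delta> \<and> (\<forall>z\<in>\<Delta>. deriv (deriv w) z = q z * w z) \<and> (\<forall>x\<in>ref_dom \<alpha>. W x = w)"
      "W N (ref_curve \<alpha> N) = c0" "deriv (W N) (ref_curve \<alpha> N) = c1"
      by (rule reference_solution[OF ref N0(1), of c0 c1]) (rule that; (assumption | blast))
    have lim: "((\<lambda>x. gG (W x) (\<lambda>s. e s x) (A x)) \<longlongrightarrow> 0) at_bot" "((\<lambda>x. gH (W x) (\<lambda>s. e s x) (A x)) \<longlongrightarrow> 0) at_bot"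
      using decay[of W] W(1,2,4,5) Infinite_End N0 sub by (auto intro: continued_along_subset)
    show ?thesis
    proof (rule that[OF W(1-3)])
      fix t b f v \<xi> and c :: real
      assume path: "admissible_path \<Delta> u j \<alpha> (e 0) t b (f 0) \<xi>" and f: "\<And>s. continuation_from \<alpha> (e s) t b (f s)"
        and v: "continuation_from \<alpha> W t b v" and c: "c > 0"
      have pf: "path_from \<Delta> \<alpha> t b \<xi>" using path by (simp add: admissible_path_def)
      have "\<forall>\<^sub>F x in at_bot. \<forall>s\<in>{..<n}. \<forall>\<^sub>F z in nhds (t x). f s x z = e s x z"
        using f Infinite_End by (intro eventually_ball_finite) (auto simp: continuation_from_def)
      moreover have "\<forall>\<^sub>F x in at_bot. \<forall>\<^sub>F z in nhds (t x). v x z = W x z"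
        using v Infinite_End by (simp add: continuation_from_def)
      moreover have "\<forall>\<^sub>F x in at_bot. norm (gG (W x) (\<lambda>s. e s x) (A x)) < c / 2"
        "\<forall>\<^sub>F x in at_bot. norm (gH (W x) (\<lambda>s. e s x) (A x)) < c / 2"
        using tendstoD[OF lim(1), of "c / 2"] tendstoD[OF lim(2), of "c / 2"] c by simp_all
      \<comment> \<open>Far out on the arc the continued elements are the prescribed ones and g and
        h are already small; a single such parameter on the path is enough.\<close>
      ultimately have "\<forall>\<^sub>F x in ref_filter \<alpha>. (\<forall>s\<in>{..<n}. \<forall>\<^sub>F z in nhds (t x). f s x z = e s x z)
          \<and> (\<forall>\<^sub>F z in nhds (t x). v x z = W x z) \<and> norm (gG (W x) (\<lambda>s. e s x) (A x)) < c / 2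
          \<and> norm (gH (W x) (\<lambda>s. e s x) (A x)) < c / 2"
        using Infinite_End by (simp add: eventually_conj_iff)
      from path_from_base[OF pf this] obtain x where x: "x \<in> path_dom \<alpha> b" "t x = ref_curve \<alpha> x"
          "\<forall>s\<in>{..<n}. \<forall>\<^sub>F z in nhds (t x). f s x z = e s x z" "\<forall>\<^sub>F z in nhds (t x). v x z = W x z"
          "norm (gG (W x) (\<lambda>s. e s x) (A x)) < c / 2" "norm (gH (W x) (\<lambda>s. e s x) (A x)) < c / 2"
        by blast
      have "f s x (t x) = e s x (t x)" if "s < n" for s
        by (rule germ_values(1)) (use x(3) that in blast)
      then have "gG (v x) (\<lambda>s. f s x) (t x) = gG (W x) (\<lambda>s. e s x) (t x)" "gH (v x) (\<lambda>s. f s x) (t x) = gH (W x) (\<lambda>s. e s x) (t x)"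
        using germ_values[OF x(4)] by (blast intro: coefficients_cong)+
      moreover have "t x = A x" using x(2) Infinite_End by simp
      ultimately show "\<exists>x\<in>path_dom \<alpha> b. norm (gG (v x) (\<lambda>s. f s x) (t x)) < c / 2 \<and> norm (gH (v x) (\<lambda>s. f s x) (t x)) < c / 2"
        using x(1,5,6) by (intro bexI[of _ x] conjI) simp_all
    qed
  qed
qed

lemma approximate_solution:
  assumes ref: "ref_point_in \<Delta> \<alpha>" and e: "\<forall>s. antiderivative_branch \<alpha> (LG_F \<sigma> \<phi> \<psi> s) (e s)" and sg: "(- 1) ^ j = - \<sigma>"
  shows "\<exists>W. continued_along (ref_curve \<alpha>) (ref_dom \<alpha>) W \<and>
    (\<forall>\<tau>\<in>ref_dom \<alpha>. solves_near u \<phi> \<psi> (W \<tau>) (ref_curve \<alpha> \<tau>)) \<and>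
    (simply_connected \<Delta> \<longrightarrow>
      (\<exists>w. w holomorphic_on \<Delta> \<and>
           (\<forall>z\<in>\<Delta>. deriv (deriv w) z = (u\<^sup>2 + u * \<phi> z + \<psi> z) * w z) \<and>
           (\<forall>\<tau>\<in>ref_dom \<alpha>. W \<tau> = w))) \<and>
    (\<forall>\<xi>\<in>Xi \<Delta> u j \<alpha> (e 0). \<forall>t b EL.
      admissible_path \<Delta> u j \<alpha> (e 0) t b (EL 0) \<xi> \<longrightarrow>
      (\<forall>s. continuation_from \<alpha> (e s) t b (EL s)) \<longrightarrow>
      bound_finite \<sigma> \<phi> \<psi> n u t (path_dom \<alpha> b) \<longrightarrow>
      (\<exists>WL \<epsilon>.
        continuation_from \<alpha> W t b WL \<and>
        (\<forall>\<tau>\<in>path_dom \<alpha> b. solves_near u \<phi> \<psi> (WL \<tau>) (t \<tau>)) \<and>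
        \<epsilon> analytic_on {\<xi>} \<and>
        (\<forall>\<^sub>F z in nhds \<xi>.
          WL b z = exp (LG_S \<sigma> n u (\<lambda>s. EL s b) z) * (exp (\<sigma> * u * z + EL 0 b z) + \<epsilon> z)) \<and>
        norm (\<epsilon> \<xi>) \<le> error_bound \<sigma> \<phi> \<psi> n u (EL 0 b) t (path_dom \<alpha> b) \<xi> \<and>
        norm (1 / (u + \<phi> \<xi> / 2) * deriv \<epsilon> \<xi>)
          \<le> error_bound \<sigma> \<phi> \<psi> n u (EL 0 b) t (path_dom \<alpha> b) \<xi>))"
proof -
  have eF: "antiderivative_branch \<alpha> (F s) (e s)" for s using e by (simp add: F_def)
  obtain W where W: "continued_along (ref_curve \<alpha>) (ref_dom \<alpha>) W"
    "\<And>x. x \<in> ref_dom \<alpha> \<Longrightarrow> ode_germ q (W x) (ref_curve \<alpha> x)"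
    "simply_connected \<Delta> \<Longrightarrow> \<exists>w. w holomorphic_on \<Delta> \<and> (\<forall>z\<in>\<Delta>. deriv (deriv w) z = q z * w z) \<and> (\<forall>x\<in>ref_dom \<alpha>. W x = w)"
    and small: "\<And>t b f v \<xi> c. admissible_path \<Delta> u j \<alpha> (e 0) t b (f 0) \<xi> \<Longrightarrow> (\<And>s. continuation_from \<alpha> (e s) t b (f s)) \<Longrightarrow>
      bound_finite \<sigma> \<phi> \<psi> n u t (path_dom \<alpha> b) \<Longrightarrow> continuation_from \<alpha> W t b v \<Longrightarrow> c > 0 \<Longrightarrow>
      \<exists>x\<in>path_dom \<alpha> b. norm (gG (v x) (\<lambda>s. f s x) (t x)) < c / 2 \<and> norm (gH (v x) (\<lambda>s. f s x) (t x)) < c / 2"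
    by (rule reference_choice[OF ref eF sg]) (rule that; (assumption | blast))
  have main: "\<exists>WL \<epsilon>. continuation_from \<alpha> W t b WL \<and>
        (\<forall>\<tau>\<in>path_dom \<alpha> b. solves_near u \<phi> \<psi> (WL \<tau>) (t \<tau>)) \<and> \<epsilon> analytic_on {\<xi>} \<and>
        (\<forall>\<^sub>F z in nhds \<xi>.
          WL b z = exp (LG_S \<sigma> n u (\<lambda>s. EL s b) z) * (exp (\<sigma> * u * z + EL 0 b z) + \<epsilon> z)) \<and>
        norm (\<epsilon> \<xi>) \<le> error_bound \<sigma> \<phi> \<psi> n u (EL 0 b) t (path_dom \<alpha> b) \<xi> \<and>
        norm (1 / (u + \<phi> \<xi> / 2) * deriv \<epsilon> \<xi>) \<le> error_bound \<sigma> \<phi> \<psi> n u (EL 0 b) t (path_dom \<alpha> b) \<xi>"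
    if path: "admissible_path \<Delta> u j \<alpha> (e 0) t b (EL 0) \<xi>" and EL: "\<And>s. continuation_from \<alpha> (e s) t b (EL s)"
      and fin: "bound_finite \<sigma> \<phi> \<psi> n u t (path_dom \<alpha> b)" for \<xi> t b EL
  proof -
    have pf: "path_from \<Delta> \<alpha> t b \<xi>" using path by (simp add: admissible_path_def)
    obtain WL where WL: "continuation_from \<alpha> W t b WL" "\<And>x. x \<in> path_dom \<alpha> b \<Longrightarrow> ode_germ q (WL x) (t x)"
      using continuation_exists[OF pf W(1,2)] by blast
    interpret P: liouville_green_path \<Delta> \<phi> \<psi> n u \<sigma> t "path_dom \<alpha> b" EL WL
    proof unfold_locales
      show "\<forall>\<^sub>F z in nhds (t x). (EL s x has_field_derivative F s z) (at z)" if "x \<in> path_dom \<alpha> b" for x s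
        by (rule branch_derivative[OF ref pf eF EL that])
      show "1 + \<phi> (t x) / (2 * u) \<noteq> 0" if "x \<in> path_dom \<alpha> b" for x
        using fin that unfolding bound_finite_def by blast
    qed (use pf EL WL in \<open>auto simp: path_from_def continuation_from_def\<close>)
    note ends = path_from_end[OF pf]
    have mono: "Re (P.\<Theta> x) \<le> Re (P.\<Theta> y)" if "x \<in> path_dom \<alpha> b" "y \<in> path_dom \<alpha> b" "x \<le> y" for x y
    proof -
      have "Re ((- 1) ^ j * u * t y - EL 0 y (t y)) \<le> Re ((- 1) ^ j * u * t x - EL 0 x (t x))"
        using path that unfolding admissible_path_def monotone_on_def by blast
      then show ?thesis by (simp add: sg P.\<Theta>_def \<theta>_def)
    qed
    have sm: "\<exists>s\<in>path_dom \<alpha> b. norm (P.G s) < c / 2 \<and> norm (P.H s) < c / 2" if "c > 0" for c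
      unfolding P.G_def P.H_def by (rule small[OF path EL fin WL(1) that])
    \<comment> \<open>The error is defined by solving the representation for it, so the
      representation holds identically in \<open>z\<close> and only the bounds remain.\<close>
    define \<epsilon> where "\<epsilon> = (\<lambda>z. exp (- S (P.el b) z) * WL b z - exp (\<theta> (P.el b) z))"
    have "WL b z = exp (LG_S \<sigma> n u (\<lambda>s. EL s b) z) * (exp (\<sigma> * u * z + EL 0 b z) + \<epsilon> z)" for z
      by (simp add: \<epsilon>_def \<theta>_def exp_minus)
    moreover have "\<epsilon> analytic_on {\<xi>}"
      using P.error_identities(1)[OF ends(1)] ends(2) by (simp add: \<epsilon>_def)
    moreover have "norm (\<epsilon> \<xi>) \<le> error_bound \<sigma> \<phi> \<psi> n u (EL 0 b) t (path_dom \<alpha> b) \<xi>"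
      "norm (1 / (u + \<phi> \<xi> / 2) * deriv \<epsilon> \<xi>) \<le> error_bound \<sigma> \<phi> \<psi> n u (EL 0 b) t (path_dom \<alpha> b) \<xi>"
      using P.error_bounds[OF ends(1,3) mono fin sm] unfolding ends(2) \<epsilon>_def by blast+
    ultimately show ?thesis
      using WL by (intro exI[of _ WL] exI[of _ \<epsilon>] conjI ballI) (auto simp: solves_near_iff)
  qed
  show ?thesis
  proof (intro exI[of _ W] conjI)
    show "simply_connected \<Delta> \<longrightarrow> (\<exists>w. w holomorphic_on \<Delta> \<and>
           (\<forall>z\<in>\<Delta>. deriv (deriv w) z = (u\<^sup>2 + u * \<phi> z + \<psi> z) * w z) \<and> (\<forall>\<tau>\<in>ref_dom \<alpha>. W \<tau> = w))"
      using W(3) by (simp add: q_def)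
  qed (use W main in \<open>auto simp: solves_near_iff\<close>)
qed

end

theorem theorem3p1:
  fixes \<Delta> :: "complex set" and \<phi> \<psi> :: "complex \<Rightarrow> complex" and n :: nat and u :: complex
    and \<alpha> :: "nat \<Rightarrow> ref_point" and E :: "nat \<Rightarrow> nat \<Rightarrow> real \<Rightarrow> complex \<Rightarrow> complex"
  assumes "open \<Delta>" and "connected \<Delta>"
    and "\<phi> holomorphic_on \<Delta>" and "\<psi> holomorphic_on \<Delta>"
    and "n \<ge> 1" and "u \<noteq> 0"
    and "\<forall>j\<in>{1, 2}. ref_point_in \<Delta> (\<alpha> j)"
    and "\<forall>j\<in>{1, 2}. \<forall>s. antiderivative_branch (\<alpha> j) (LG_F (pm j) \<phi> \<psi> s) (E j s)"
  shows "\<exists>W :: nat \<Rightarrow> real \<Rightarrow> complex \<Rightarrow> complex. \<forall>j\<in>{1, 2}.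
    continued_along (ref_curve (\<alpha> j)) (ref_dom (\<alpha> j)) (W j) \<and>
    (\<forall>\<tau>\<in>ref_dom (\<alpha> j). solves_near u \<phi> \<psi> (W j \<tau>) (ref_curve (\<alpha> j) \<tau>)) \<and>
    (simply_connected \<Delta> \<longrightarrow>
      (\<exists>w. w holomorphic_on \<Delta> \<and>
           (\<forall>z\<in>\<Delta>. deriv (deriv w) z = (u\<^sup>2 + u * \<phi> z + \<psi> z) * w z) \<and>
           (\<forall>\<tau>\<in>ref_dom (\<alpha> j). W j \<tau> = w))) \<and>
    (\<forall>\<xi>\<in>Xi \<Delta> u j (\<alpha> j) (E j 0). \<forall>t b EL.
      admissible_path \<Delta> u j (\<alpha> j) (E j 0) t b (EL 0) \<xi> \<longrightarrow>
      (\<forall>s. continuation_from (\<alpha> j) (E j s) t b (EL s)) \<longrightarrow>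
      bound_finite (pm j) \<phi> \<psi> n u t (path_dom (\<alpha> j) b) \<longrightarrow>
      (\<exists>WL \<epsilon>.
        continuation_from (\<alpha> j) (W j) t b WL \<and>
        (\<forall>\<tau>\<in>path_dom (\<alpha> j) b. solves_near u \<phi> \<psi> (WL \<tau>) (t \<tau>)) \<and>
        \<epsilon> analytic_on {\<xi>} \<and>
        (\<forall>\<^sub>F z in nhds \<xi>.
          WL b z = exp (LG_S (pm j) n u (\<lambda>s. EL s b) z) * (exp (pm j * u * z + EL 0 b z) + \<epsilon> z)) \<and>
        norm (\<epsilon> \<xi>) \<le> error_bound (pm j) \<phi> \<psi> n u (EL 0 b) t (path_dom (\<alpha> j) b) \<xi> \<and>
        norm (1 / (u + \<phi> \<xi> / 2) * deriv \<epsilon> \<xi>)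
          \<le> error_bound (pm j) \<phi> \<psi> n u (EL 0 b) t (path_dom (\<alpha> j) b) \<xi>))"
\<comment> \<open>The two values of \<open>j\<close> do not interact, so a solution is picked for
  each separately.\<close>
proof (rule bchoice, rule ballI)
  fix j :: nat
  assume j: "j \<in> {1, 2}"
  interpret liouville_green \<Delta> \<phi> \<psi> n u "pm j"
    by unfold_locales (use assms in \<open>auto simp: pm_def\<close>)
  show "\<exists>W. continued_along (ref_curve (\<alpha> j)) (ref_dom (\<alpha> j)) W \<and>
    (\<forall>\<tau>\<in>ref_dom (\<alpha> j). solves_near u \<phi> \<psi> (W \<tau>) (ref_curve (\<alpha> j) \<tau>)) \<and>
    (simply_connected \<Delta> \<longrightarrow>
      (\<exists>w. w holomorphic_on \<Delta> \<and>
           (\<forall>z\<in>\<Delta>. deriv (deriv w) z = (u\<^sup>2 + u * \<phi> z + \<psi> z) * w z) \<and>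
           (\<forall>\<tau>\<in>ref_dom (\<alpha> j). W \<tau> = w))) \<and>
    (\<forall>\<xi>\<in>Xi \<Delta> u j (\<alpha> j) (E j 0). \<forall>t b EL.
      admissible_path \<Delta> u j (\<alpha> j) (E j 0) t b (EL 0) \<xi> \<longrightarrow>
      (\<forall>s. continuation_from (\<alpha> j) (E j s) t b (EL s)) \<longrightarrow>
      bound_finite (pm j) \<phi> \<psi> n u t (path_dom (\<alpha> j) b) \<longrightarrow>
      (\<exists>WL \<epsilon>.
        continuation_from (\<alpha> j) W t b WL \<and>
        (\<forall>\<tau>\<in>path_dom (\<alpha> j) b. solves_near u \<phi> \<psi> (WL \<tau>) (t \<tau>)) \<and>
        \<epsilon> analytic_on {\<xi>} \<and>
        (\<forall>\<^sub>F z in nhds \<xi>.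
          WL b z = exp (LG_S (pm j) n u (\<lambda>s. EL s b) z) * (exp (pm j * u * z + EL 0 b z) + \<epsilon> z)) \<and>
        norm (\<epsilon> \<xi>) \<le> error_bound (pm j) \<phi> \<psi> n u (EL 0 b) t (path_dom (\<alpha> j) b) \<xi> \<and>
        norm (1 / (u + \<phi> \<xi> / 2) * deriv \<epsilon> \<xi>)
          \<le> error_bound (pm j) \<phi> \<psi> n u (EL 0 b) t (path_dom (\<alpha> j) b) \<xi>))"
    by (rule approximate_solution) (use assms(7,8) j in \<open>auto simp: pm_def\<close>)
qed

end
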